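(* Let $\alpha_1,\beta_1\in\mathbb{R}$, $\kappa\in(-\frac12,\frac12)$, $\sigma=e^{\pi ia(0)}$, and let $f_1,g_1$ be the automorphisms of $V_{\mathbb{Z}}$ with $\sigma f_1=e^{2\pi i\beta_1a(0)}$, $\sigma g_1=e^{-2\pi i\alpha_1a(0)}$. For every $n\ge1$ the generating form $$\mathcal{G}^{(1)}_n\begin{bmatrix}f_1\\ g_1\end{bmatrix}(x_1,y_1,\ldots,x_n,y_n)=Z^{(1)}_{V_{\mathbb{Z}}}\begin{bmatrix}f_1\\ g_1\end{bmatrix}\left(\psi^+,x_1;\psi^-,y_1;\ldots;\psi^+,x_n;\psi^-,y_n;e^\kappa,w;e^{-\kappa},0;q\right)\prod_{i=1}^ndx_i^{1/2}dy_i^{1/2}$$ is given by $$\mathcal{G}^{(1)}_n\begin{bmatrix}f_1\\ g_1\end{bmatrix}(x_1,y_1,\ldots,x_n,y_n)=Z^{(1)}_{V_{\mathbb{Z}}}\begin{bmatrix}f_1\\ g_1\end{bmatrix}\left(e^\kappa,w;e^{-\kappa},0;q\right)\;\det S_\kappa,$$ where $S_\kappa$ denotes the $n\times n$ matrix $\left(S_\kappa(x_i,y_j)\right)_{i,j=1}^n$ with $S_\kappa(x,y)$ the kernel defined in the context.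
   Context: $a(n)$ are Heisenberg modes, $[a(m),a(n)]=m\delta_{m,-n}$; $M$ is the rank one Heisenberg VOA with vacuum $\mathbf 1$, conformal vector $\frac12a(-1)^2\mathbf 1$, Virasoro modes $L(n)$. $M\otimes e^\alpha$ ($\alpha\in\mathbb{C}$) is the irreducible $M$-module with $a(0)=\alpha$; $\mathcal{M}=\bigoplus_{\alpha\in\mathbb{C}}M\otimes e^\alpha$; $e^{\alpha\widehat q}(u\otimes e^\beta)=u\otimes e^{\alpha+\beta}$; $e^\alpha$ abbreviates $\mathbf 1\otimes e^\alpha$. $Y_\pm(\alpha,z)=\exp\left(\mp\alpha\sum_{n>0}\frac{a(\pm n)}{n}z^{\mp n}\right)$, $\mathcal{Y}(u\otimes e^\alpha,z)=e^{\alpha\widehat q}Y_-(\alpha,z)Y(u,z)Y_+(\alpha,z)z^{\alpha a(0)}$. $V_{\mathbb{Z}}=\bigoplus_{m\in\mathbb{Z}}M\otimes e^m$ is the $\mathbb{Z}$-lattice VOSA with trivial cocycle, $\psi^\pm=\mathbf 1\otimes e^{\pm1}$; $V_{\mathbb{Z}+\alpha_1}=\bigoplus_{m\in\mathbb{Z}}M\otimes e^{m+\alpha_1}$. With $\tau$ in the upper half-plane, $q=e^{2\pi i\tau}$, $q_i=e^{z_i}$, $q_w=e^w$, for $u_i\in V_{\mathbb Z}$, $v_1,v_2\in\mathcal M$, $$Z^{(1)}_{V_{\mathbb Z}}\begin{bmatrix}f_1\\ g_1\end{bmatrix}(u_1,z_1;\ldots;u_n,z_n;v_1,w;v_2,0;q)=\mathrm{Tr}_{V_{\mathbb{Z}+\alpha_1}}\left(\sigma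 f_1\,\mathcal Y(q_1^{L(0)}u_1,q_1)\cdots\mathcal Y(q_n^{L(0)}u_n,q_n)\,\mathcal Y(q_w^{L(0)}v_1,q_w)\,\mathcal Y(v_2,1)\,q^{L(0)-1/24}\right).$$ $\vartheta\begin{bmatrix}\alpha\\ \beta\end{bmatrix}(z,\tau)=\sum_{n\in\mathbb{Z}}e^{i\pi(n+\alpha)^2\tau+(n+\alpha)(z+2\pi i\beta)}$, $\vartheta_1=\vartheta\begin{bmatrix}1/2\\ 1/2\end{bmatrix}$, $K(z,\tau)=\vartheta_1(z,\tau)/\partial_z\vartheta_1(0,\tau)$, and $$S_\kappa(x,y)=\left(\frac{\vartheta_1(x-w,\tau)\,\vartheta_1(y,\tau)}{\vartheta_1(x,\tau)\,\vartheta_1(y-w,\tau)}\right)^\kappa\frac{\vartheta\begin{bmatrix}\alpha_1\\ \beta_1\end{bmatrix}(x-y+\kappa w,\tau)}{\vartheta\begin{bmatrix}\alpha_1\\ \beta_1\end{bmatrix}(\kappa w,\tau)\,K(x-y,\tau)}\,dx^{1/2}dy^{1/2},$$ defined for $\vartheta\begin{bmatrix}\alpha_1\\ \beta_1\end{bmatrix}(\kappa w,\tau)\neq0$. Powers $K(x_i-w)^{\pm\kappa}$, $K(x_i)^{\pm\kappa}$, $K(y_j-w)^{\pm\kappa}$, $K(y_j)^{\pm\kappa}$ are taken with the same branches on both sides, namely those given by the ordered expansion $|x_1|>|y_1|>\dots>|x_n|>|y_n|>|w|$ of the vertex operators. *)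

theory Defs
  imports "HOL-Analysis.Analysis" "HOL-Library.Multiset" "Jordan_Normal_Form.Determinant"
begin

section \<open>The Heisenberg Fock spaces\<close>

text \<open>
  The index \<open>(\<beta>, {#k\<^sub>1, \<dots>, k\<^sub>r#})\<close> stands for the basis vector
  \<open>a(-k\<^sub>1-1) \<dots> a(-k\<^sub>r-1) 1 \<otimes> e\<^sup>\<beta>\<close>. The shift by one makes every multiset of
  naturals admissible.

  A \<open>state\<close> is a family of coefficients in this basis, so the type is the completion (direct
  product) of the sum \<open>\<M>\<close> of all \<open>M \<otimes> e\<^sup>\<beta>\<close>; vectors of \<open>\<M>\<close> itself are the finitely supported
  states. The completion is needed because vertex operators leave the direct sum.
\<close>

type_synonym fock_index = "complex \<times> nat multiset"
type_synonym state = "fock_index \<Rightarrow> complex"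

definition ket :: "fock_index \<Rightarrow> state" where
  "ket b = (\<lambda>b'. if b' = b then 1 else 0)"

definition supp :: "state \<Rightarrow> fock_index set" where
  "supp v = {b. v b \<noteq> 0}"

text \<open>The vector \<open>e\<^sup>\<alpha> = 1 \<otimes> e\<^sup>\<alpha>\<close>.\<close>

definition evec :: "complex \<Rightarrow> state" where
  "evec \<alpha> = ket (\<alpha>, {#})"

definition psi_plus :: state where "psi_plus = evec 1"
definition psi_minus :: state where "psi_minus = evec (-1)"

fun heis :: "int \<Rightarrow> state \<Rightarrow> state" where
  "heis n v (\<beta>, l) =
    (if n = 0 then \<beta> * v (\<beta>, l)
     else if n > 0 then
       of_int n * of_nat (Suc (count l (nat n - 1))) * v (\<beta>, add_mset (nat n - 1) l)
     else if nat (- n) - 1 \<in># l then v (\<beta>, l - {#nat (- n) - 1#}) else 0)"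

lemma heis_commutator:
  "heis m (heis n v) b - heis n (heis m v) b = (if m = - n then of_int m * v b else 0)"
proof (cases b)
  case (Pair \<beta> l)
  consider "m = 0" | "n = 0" | "m > 0" "n > 0" | "m < 0" "n < 0" | "m > 0" "n < 0" | "m < 0" "n > 0"
    by linarith
  then show ?thesis
  proof cases
    case 5
    then show ?thesis unfolding Pair
      by (cases "m = - n") (auto simp: algebra_simps add_mset_commute
           diff_union_swap2 insert_DiffM2 dest: in_diffD)
  next
    case 6
    then show ?thesis unfolding Pair
      by (cases "m = - n") (auto simp: algebra_simps add_mset_commute of_nat_diff
           diff_union_swap2 count_eq_zero_iff in_diff_count dest: in_diffD)
  qed (auto simp: Pair algebra_simps add_mset_commute diff_union_swap2 in_diff_count)
qed

text \<open>
  Exponentials of operators and infinite sums of modes are taken coefficientwise. For the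
  operators used below, applied to vectors of \<open>\<M>\<close>, each of these series is either finite in
  every coefficient or the exponential series of an eigenvalue.
\<close>

definition op_exp :: "(state \<Rightarrow> state) \<Rightarrow> state \<Rightarrow> state" where
  "op_exp A v = (\<lambda>b. \<Sum>k. (A ^^ k) v b / fact k)"

definition exp_a0 :: "complex \<Rightarrow> state \<Rightarrow> state" where
  "exp_a0 t = op_exp (\<lambda>v b. t * heis 0 v b)"

text \<open>
  The zero mode \<open>L(0) = 1/2 a(0)\<^sup>2 + \<Sum>\<^bsub>n>0\<^esub> a(-n) a(n)\<close> of the field of
  \<open>1/2 a(-1)\<^sup>2 1\<close>.
\<close>

definition L0 :: "state \<Rightarrow> state" where
  "L0 v = (\<lambda>b. heis 0 (heis 0 v) b / 2
              + (\<Sum>n. heis (- int (Suc n)) (heis (int (Suc n)) v) b))"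

lemma L0_coeff: "L0 v (\<beta>, l) = (\<beta>\<^sup>2 / 2 + of_nat (\<Sum>k\<in>#l. Suc k)) * v (\<beta>, l)"
proof -
  have [simp]: "nat (1 + int n) - Suc 0 = n" "nat (int n + 1) - Suc 0 = n" for n
    by auto
  have "(\<Sum>n. heis (- int (Suc n)) (heis (int (Suc n)) v) (\<beta>, l))
      = (\<Sum>n\<in>set_mset l. heis (- int (Suc n)) (heis (int (Suc n)) v) (\<beta>, l))"
    by (rule suminf_finite) auto
  also have "\<dots> = (\<Sum>n\<in>set_mset l. of_nat (count l n * Suc n) * v (\<beta>, l))"
    by (rule sum.cong) (auto simp: Suc_diff_le algebra_simps of_nat_diff)
  also have "\<dots> = of_nat (\<Sum>k\<in>#l. Suc k) * v (\<beta>, l)"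
  proof -
    have "(\<Sum>k\<in>#l. Suc k) = size_multiset (\<lambda>k. k) l"
      by (induction l) auto
    then show ?thesis
      by (simp add: size_multiset_eq sum_distrib_right)
  qed
  finally show ?thesis
    by (simp add: L0_def algebra_simps power2_eq_square)
qed

text \<open>\<open>exp_L0 t\<close> is \<open>(e\<^sup>t)\<close> raised to \<open>L(0)\<close>; \<open>qtau\<close> is \<open>q\<close> raised to \<open>L(0) - 1/24\<close>.\<close>

definition exp_L0 :: "complex \<Rightarrow> state \<Rightarrow> state" where
  "exp_L0 t = op_exp (\<lambda>v b. t * L0 v b)"

definition qtau :: "complex \<Rightarrow> state \<Rightarrow> state" where
  "qtau \<tau> = op_exp (\<lambda>v b. 2 * of_real pi * \<i> * \<tau> * (L0 v b - v b / 24))"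


section \<open>Vertex operators\<close>

text \<open>
  The formal variable \<open>z\<close> is always given through a logarithm \<open>\<zeta>\<close>, \<open>z = e\<^sup>\<zeta>\<close>, because
  the complex powers of \<open>z\<close> that occur depend on it.
\<close>

definition shift_charge :: "complex \<Rightarrow> state \<Rightarrow> state" where
  "shift_charge \<alpha> v = (\<lambda>(\<beta>, l). v (\<beta> - \<alpha>, l))"

definition Y_minus :: "complex \<Rightarrow> complex \<Rightarrow> state \<Rightarrow> state" where
  "Y_minus \<alpha> \<zeta> = op_exp (\<lambda>v b. \<alpha> *
     (\<Sum>n. heis (- int (Suc n)) v b / of_nat (Suc n) * exp (of_nat (Suc n) * \<zeta>)))"

definition Y_plus :: "complex \<Rightarrow> complex \<Rightarrow> state \<Rightarrow> state" where
  "Y_plus \<alpha> \<zeta> = op_exp (\<lambda>v b. - \<alpha> *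
     (\<Sum>n. heis (int (Suc n)) v b / of_nat (Suc n) * exp (- of_nat (Suc n) * \<zeta>)))"

text \<open>
  The creation part (modes \<open>m < 0\<close>) and the annihilation part (modes \<open>m \<ge> 0\<close>) of
  \<open>Y(a(-k-1) 1, z) = (1/k!) \<partial>\<^sup>k a(z)\<close>, where \<open>a(z)\<close> is the sum of all
  \<open>a(m)\<close> times \<open>z\<close> to the power \<open>-m-1\<close>.
\<close>

definition field_minus :: "nat \<Rightarrow> complex \<Rightarrow> state \<Rightarrow> state" where
  "field_minus k \<zeta> v = (\<lambda>b. \<Sum>j. (of_nat j gchoose k)
      * exp ((of_nat j - of_nat k) * \<zeta>) * heis (- int (Suc j)) v b)"

definition field_plus :: "nat \<Rightarrow> complex \<Rightarrow> state \<Rightarrow> state" where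
  "field_plus k \<zeta> v = (\<lambda>b. \<Sum>m. ((- of_nat m - 1) gchoose k)
      * exp ((- of_nat m - 1 - of_nat k) * \<zeta>) * heis (int m) v b)"

text \<open>
  \<open>Y_Heis [k\<^sub>1, \<dots>, k\<^sub>r]\<close> is the vertex operator on Fock modules of
  \<open>a(-k\<^sub>1-1) \<dots> a(-k\<^sub>r-1) 1 \<in> M\<close>, i.e. the normally ordered product of the fields above.
\<close>

fun Y_Heis :: "nat list \<Rightarrow> complex \<Rightarrow> state \<Rightarrow> state" where
  "Y_Heis [] \<zeta> v = v"
| "Y_Heis (k # ks) \<zeta> v =
     (\<lambda>b. field_minus k \<zeta> (Y_Heis ks \<zeta> v) b + Y_Heis ks \<zeta> (field_plus k \<zeta> v) b)"

text \<open>
  The operator \<open>\<Y>(u, e\<^sup>\<zeta>)\<close> for \<open>u \<in> \<M>\<close>, to be applied to vectors of \<open>\<M>\<close>.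
\<close>

definition vop :: "state \<Rightarrow> complex \<Rightarrow> state \<Rightarrow> state" where
  "vop u \<zeta> v = (\<lambda>b. \<Sum>(\<alpha>, l)\<in>supp u. u (\<alpha>, l) *
     shift_charge \<alpha>
       (Y_minus \<alpha> \<zeta>
         (Y_Heis (sorted_list_of_multiset l) \<zeta>
           (Y_plus \<alpha> \<zeta>
             (exp_a0 (\<zeta> * \<alpha>) v)))) b)"


section \<open>Traces of products of vertex operators\<close>

text \<open>
  A product \<open>A\<^sub>1 \<dots> A\<^sub>N\<close> of operators from \<open>\<M>\<close> to its completion is given by matrix
  multiplication, so its trace over the span of the basis vectors in \<open>S\<close> is the sum over
  \<open>b\<^sub>0 \<in> S\<close> and all intermediate basis vectors of
  \<open>\<langle>b\<^sub>0|A\<^sub>1|b\<^sub>1\<rangle> \<langle>b\<^sub>1|A\<^sub>2|b\<^sub>2\<rangle> \<dots> \<langle>b\<^sub>N\<^sub>-\<^sub>1|A\<^sub>N|b\<^sub>0\<rangle>\<close>. Being summable means absolute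
  convergence of this multiple series; the result then does not depend on any grouping by weight.
\<close>

definition closed_paths :: "fock_index set \<Rightarrow> nat \<Rightarrow> fock_index list set" where
  "closed_paths S N = {p. length p = Suc N \<and> p ! 0 \<in> S \<and> p ! N = p ! 0}"

definition path_term :: "(state \<Rightarrow> state) list \<Rightarrow> fock_index list \<Rightarrow> complex" where
  "path_term As p = (\<Prod>i<length As. (As ! i) (ket (p ! Suc i)) (p ! i))"

definition trace_converges :: "fock_index set \<Rightarrow> (state \<Rightarrow> state) list \<Rightarrow> bool" where
  "trace_converges S As \<longleftrightarrow> path_term As summable_on closed_paths S (length As)"

definition trace_prod :: "fock_index set \<Rightarrow> (state \<Rightarrow> state) list \<Rightarrow> complex" where
  "trace_prod S As = (\<Sum>\<^sub>\<infinity>p\<in>closed_paths S (length As). path_term As p)"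

text \<open>Index set of the basis of the lattice module with charges in \<open>\<int> + \<alpha>\<close>.\<close>

definition lattice_basis :: "real \<Rightarrow> fock_index set" where
  "lattice_basis \<alpha> = {(\<beta>, l). \<beta> - of_real \<alpha> \<in> \<int>}"

definition V_Z :: "state set" where
  "V_Z = {v. finite (supp v) \<and> supp v \<subseteq> lattice_basis 0}"

definition sigma :: "state \<Rightarrow> state" where
  "sigma = exp_a0 (of_real pi * \<i>)"

text \<open>
  The basis of the module with charges in \<open>\<int> + \<alpha>\<close>, with \<open>\<alpha>\<close> read off from
  \<open>\<sigma> g = exp (-2\<pi>i\<alpha> a(0))\<close> on the lattice VOSA, which fixes \<open>\<alpha>\<close> modulo \<open>\<int>\<close>.
\<close>

definition twisted_basis :: "(state \<Rightarrow> state) \<Rightarrow> fock_index set" where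
  "twisted_basis g = (\<Union>\<alpha>\<in>{\<alpha>. \<forall>v\<in>V_Z. sigma (g v) = exp_a0 (- 2 * of_real pi * \<i> * of_real \<alpha>) v}.
     lattice_basis \<alpha>)"

lemma exp_a0_apply: "exp_a0 t v (\<beta>, l) = exp (t * \<beta>) * v (\<beta>, l)"
proof -
  have "((\<lambda>v b. t * heis 0 v b) ^^ k) v (\<beta>, l) = (t * \<beta>) ^ k * v (\<beta>, l)" for k
    by (induction k) auto
  moreover have "(\<lambda>k. (t * \<beta>) ^ k * v (\<beta>, l) / fact k) sums (exp (t * \<beta>) * v (\<beta>, l))"
    using sums_mult2[OF exp_converges[of "t * \<beta>"], of "v (\<beta>, l)"]
    by (simp add: scaleR_conv_of_real field_simps)
  ultimately show ?thesis
    by (simp add: exp_a0_def op_exp_def sums_iff)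
qed

lemma twisted_basis_eq:
  assumes "sigma \<circ> g = exp_a0 (- 2 * of_real pi * \<i> * of_real \<alpha>)"
  shows "twisted_basis g = lattice_basis \<alpha>"
proof -
  have "lattice_basis \<gamma> = lattice_basis \<alpha>"
    if "\<forall>v\<in>V_Z. sigma (g v) = exp_a0 (- 2 * of_real pi * \<i> * of_real \<gamma>) v" for \<gamma>
  proof -
    have "evec 1 \<in> V_Z"
      by (auto simp: V_Z_def supp_def evec_def ket_def lattice_basis_def)
    then have "exp_a0 (- 2 * of_real pi * \<i> * of_real \<alpha>) (evec 1) (1, {#})
        = exp_a0 (- 2 * of_real pi * \<i> * of_real \<gamma>) (evec 1) (1, {#})"
      using that assms by (metis comp_apply)
    then have "exp (- 2 * of_real pi * \<i> * of_real \<alpha>) = exp (- 2 * of_real pi * \<i> * of_real \<gamma> :: complex)"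
      by (simp add: exp_a0_apply evec_def ket_def)
    then obtain m :: int where
      "- 2 * of_real pi * \<i> * of_real \<alpha> = - 2 * of_real pi * \<i> * of_real \<gamma> + (of_int (2 * m) * pi) * (\<i> :: complex)"
      unfolding exp_eq by blast
    then have "(2 * of_real pi * \<i>) * (of_real \<gamma> :: complex) = (2 * of_real pi * \<i>) * (of_real \<alpha> + of_int m)"
      by (simp add: algebra_simps)
    then have "(of_real \<gamma> :: complex) = of_real \<alpha> + of_int m"
      by (subst (asm) mult_cancel_left) simp
    then have "z - of_real \<gamma> \<in> \<int> \<longleftrightarrow> z - of_real \<alpha> \<in> \<int>" for z :: complex
      using Ints_add[of "z - of_real \<gamma>" "of_int m"] Ints_diff[of "z - of_real \<alpha>" "of_int m"]
      by (auto simp: algebra_simps)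
    then show ?thesis
      by (simp add: lattice_basis_def)
  qed
  moreover have "\<forall>v\<in>V_Z. sigma (g v) = exp_a0 (- 2 * of_real pi * \<i> * of_real \<alpha>) v"
    using assms by (metis comp_apply)
  ultimately show ?thesis
    unfolding twisted_basis_def by blast
qed

text \<open>
  The operators under the trace in the \<open>n\<close>-point function with insertions \<open>us = [(u\<^sub>1, z\<^sub>1), \<dots>]\<close>
  and \<open>(v\<^sub>1, w)\<close>, \<open>(v\<^sub>2, 0)\<close>; the last vertex operator is taken at \<open>e\<^sup>0 = 1\<close>.
\<close>

definition Z1_ops :: "(state \<Rightarrow> state) \<Rightarrow> complex \<Rightarrow> (state \<times> complex) list \<Rightarrow>
    state \<Rightarrow> complex \<Rightarrow> state \<Rightarrow> (state \<Rightarrow> state) list" where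
  "Z1_ops f \<tau> us v1 w v2 =
     [sigma \<circ> f]
     @ map (\<lambda>(u, z). vop (exp_L0 z u) z) us
     @ [vop (exp_L0 w v1) w, vop v2 0, qtau \<tau>]"

definition Z1_converges :: "(state \<Rightarrow> state) \<Rightarrow> (state \<Rightarrow> state) \<Rightarrow> complex \<Rightarrow>
    (state \<times> complex) list \<Rightarrow> state \<Rightarrow> complex \<Rightarrow> state \<Rightarrow> bool" where
  "Z1_converges f g \<tau> us v1 w v2 \<longleftrightarrow>
     trace_converges (twisted_basis g) (Z1_ops f \<tau> us v1 w v2)"

definition Z1 :: "(state \<Rightarrow> state) \<Rightarrow> (state \<Rightarrow> state) \<Rightarrow> complex \<Rightarrow>
    (state \<times> complex) list \<Rightarrow> state \<Rightarrow> complex \<Rightarrow> state \<Rightarrow> complex" where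
  "Z1 f g \<tau> us v1 w v2 = trace_prod (twisted_basis g) (Z1_ops f \<tau> us v1 w v2)"

definition psi_insertions ::
    "nat \<Rightarrow> (nat \<Rightarrow> complex) \<Rightarrow> (nat \<Rightarrow> complex) \<Rightarrow> (state \<times> complex) list" where
  "psi_insertions n x y = concat (map (\<lambda>i. [(psi_plus, x i), (psi_minus, y i)]) [0..<n])"

text \<open>
  The coefficient of \<open>\<Prod>\<^sub>i dx\<^sub>i\<^sup>1\<^sup>/\<^sup>2 dy\<^sub>i\<^sup>1\<^sup>/\<^sup>2\<close> in the generating form.
\<close>

definition gen_form :: "(state \<Rightarrow> state) \<Rightarrow> (state \<Rightarrow> state) \<Rightarrow> complex \<Rightarrow> real \<Rightarrow> complex \<Rightarrow>
    nat \<Rightarrow> (nat \<Rightarrow> complex) \<Rightarrow> (nat \<Rightarrow> complex) \<Rightarrow> complex" where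
  "gen_form f g \<tau> \<kappa> w n x y =
     Z1 f g \<tau> (psi_insertions n x y) (evec (of_real \<kappa>)) w (evec (- of_real \<kappa>))"


section \<open>Theta functions and the kernel\<close>

definition theta :: "real \<Rightarrow> real \<Rightarrow> complex \<Rightarrow> complex \<Rightarrow> complex" where
  "theta \<alpha> \<beta> z \<tau> = (\<Sum>\<^sub>\<infinity>n\<in>(UNIV :: int set).
     exp (\<i> * of_real pi * (of_int n + of_real \<alpha>)\<^sup>2 * \<tau>
          + (of_int n + of_real \<alpha>) * (z + 2 * of_real pi * \<i> * of_real \<beta>)))"

definition theta1 :: "complex \<Rightarrow> complex \<Rightarrow> complex" where
  "theta1 = theta (1/2) (1/2)"

definition prime_form :: "complex \<Rightarrow> complex \<Rightarrow> complex" where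
  "prime_form z \<tau> = theta1 z \<tau> / deriv (\<lambda>z. theta1 z \<tau>) 0"

text \<open>
  The zeros of \<open>theta1\<close> are the points \<open>2\<pi>i(m + n\<tau>)\<close>, so it has a holomorphic logarithm
  on the following strip, unique up to an additive constant. The arguments \<open>x - w\<close>, \<open>x\<close>,
  \<open>y - w\<close>, \<open>y\<close> of the powers in the kernel lie in the strip when the insertions are ordered as
  the vertex operators require, and the constant cancels in the exponent of the kernel. The
  expansion of the vertex operators uses the logarithm
  \<open>z/2 + Ln (1 - e\<^sup>-\<^sup>z) + \<Sum>\<^bsub>n>0\<^esub> (Ln (1 - q\<^sup>n e\<^sup>z) + Ln (1 - q\<^sup>n e\<^sup>-\<^sup>z)) + const\<close>,
  which is of this kind.
\<close>

definition theta1_strip :: "complex \<Rightarrow> complex set" where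
  "theta1_strip \<tau> = {z. 0 < Re z \<and> Re z < 2 * pi * Im \<tau>}"

definition log_theta1 :: "complex \<Rightarrow> complex \<Rightarrow> complex" where
  "log_theta1 \<tau> = (SOME l. l holomorphic_on theta1_strip \<tau> \<and>
     (\<forall>z\<in>theta1_strip \<tau>. exp (l z) = theta1 z \<tau>))"

text \<open>The coefficient of \<open>dx\<^sup>1\<^sup>/\<^sup>2 dy\<^sup>1\<^sup>/\<^sup>2\<close> in \<open>S\<^sub>\<kappa>(x, y)\<close>.\<close>

definition S_kernel :: "real \<Rightarrow> real \<Rightarrow> real \<Rightarrow> complex \<Rightarrow> complex \<Rightarrow> complex \<Rightarrow> complex \<Rightarrow> complex" where
  "S_kernel \<alpha> \<beta> \<kappa> w \<tau> x y =
     exp (of_real \<kappa> * (log_theta1 \<tau> (x - w) + log_theta1 \<tau> y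
                       - log_theta1 \<tau> x - log_theta1 \<tau> (y - w)))
     * (theta \<alpha> \<beta> (x - y + of_real \<kappa> * w) \<tau>
        / (theta \<alpha> \<beta> (of_real \<kappa> * w) \<tau> * prime_form (x - y) \<tau>))"

definition S_matrix :: "nat \<Rightarrow> real \<Rightarrow> real \<Rightarrow> real \<Rightarrow> complex \<Rightarrow> complex \<Rightarrow>
    (nat \<Rightarrow> complex) \<Rightarrow> (nat \<Rightarrow> complex) \<Rightarrow> complex Matrix.mat" where
  "S_matrix n \<alpha> \<beta> \<kappa> w \<tau> x y = Matrix.mat n n (\<lambda>(i, j). S_kernel \<alpha> \<beta> \<kappa> w \<tau> (x i) (y j))"

text \<open>
  The domain \<open>|q\<^sub>x\<^sub>1| > |q\<^sub>y\<^sub>1| > \<dots> > |q\<^sub>x\<^sub>n| > |q\<^sub>y\<^sub>n| > |q\<^sub>w| > 1 > |q q\<^sub>x\<^sub>1|\<close> of convergence of the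
  trace (insertions numbered from 0).
\<close>

definition ordered_insertions ::
    "complex \<Rightarrow> nat \<Rightarrow> (nat \<Rightarrow> complex) \<Rightarrow> (nat \<Rightarrow> complex) \<Rightarrow> complex \<Rightarrow> bool" where
  "ordered_insertions \<tau> n x y w \<longleftrightarrow>
     Re (x 0) < 2 * pi * Im \<tau> \<and>
     (\<forall>i<n. Re (y i) < Re (x i)) \<and>
     (\<forall>i. Suc i < n \<longrightarrow> Re (x (Suc i)) < Re (y i)) \<and>
     (\<forall>i<n. Re w < Re (y i)) \<and>
     0 < Re w"

end

theory Submission
  imports Defs "HOL-Complex_Analysis.Complex_Analysis"
begin

text \<open>
  Mode by mode, the vertex operator of \<open>e\<^sup>\<alpha>\<close> is a normally ordered exponential
  \<open>exp (a c\<^sup>*) exp (b c)\<close>, and a product of such operators is again one, up to a scalar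
  contraction factor for every pair. Hence the sum over closed paths collapses to the trace of one
  normally ordered exponential times a lattice sum. Replacing all matrix entries by the ones for the
  moduli of the parameters gives sums of the same kind, which proves absolute convergence.

  The result is the free boson formula: the lattice sum is a theta function of
  \<open>\<Sum> (x\<^sub>i - y\<^sub>i) + \<kappa> w\<close>, and the contractions add up to
  \<open>\<Sum> \<alpha>\<^sub>i \<alpha>\<^sub>j log \<theta>\<^sub>1(z\<^sub>i - z\<^sub>j)\<close> by the Jacobi triple product. The powers with
  exponent \<open>\<plusminus>\<kappa>\<close> factor through rows and columns of the kernel matrix, and what remains is
  Frobenius' determinant. That follows from Fay's trisecant identity, which makes the Schur complement
  of the first entry a matrix of the same shape with \<open>t\<close> replaced by \<open>t + x\<^sub>0 - y\<^sub>0\<close>.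
\<close>

section \<open>Sums over occupation numbers\<close>

text \<open>The trace runs over arbitrary intermediate basis vectors, so nothing may be regrouped
  before absolute convergence is known. A majorant of the same kind exists because every oscillator
  matrix element is a polynomial with nonnegative coefficients in its parameters, and because the
  convergence conditions involve only norms. For a pair at distance u, radial ordering contributes
  log (1 - exp (- u)), that is \<open>euler_log q\<close> at exp (- u) minus its value at q exp (-
  u); the trace adds the values at q exp u and q exp (- u). What remains, with u / 2 from the zero
  modes and neutrality, is a logarithm of theta_1 up to a constant. Self contractions give one
  \<open>euler_log q q\<close> per unit of squared charge. A fermion pair has squared charge 2, and
  this becomes theta_1'(0), the normalisation of the prime form. The constant term of the triple
  product is never evaluated: it sits in \<open>theta_const\<close>, which enters both sides to the
  same power.\<close>

lemma prod_count_has_sum_bounded: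
  fixes g :: "nat \<Rightarrow> nat \<Rightarrow> 'a :: {real_normed_field, banach}"
  assumes g: "\<And>k. (g k has_sum G k) UNIV"
    and g_abs: "\<And>k. (\<lambda>c. norm (g k c)) summable_on UNIV"
  shows "(\<lambda>m. norm (\<Prod>k<K. g k (count m k))) summable_on {m. set_mset m \<subseteq> {..<K}} \<and>
    ((\<lambda>m. \<Prod>k<K. g k (count m k)) has_sum (\<Prod>k<K. G k)) {m. set_mset m \<subseteq> {..<K}}"
proof (induction K)
  case 0
  have "{m. set_mset m \<subseteq> {..<0::nat}} = {{#}}" by auto
  then show ?case by (auto intro: has_sum_finiteI)
next
  case (Suc K)
  define U where "U K = {m. set_mset m \<subseteq> {..<K}}" for K :: nat
  define f where "f = (\<lambda>m. \<Prod>k<K. g k (count m k))"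
  \<comment> \<open>A multiset over \<open>Suc K\<close> modes is one over \<open>K\<close> modes
    together with the multiplicity of the mode \<open>K\<close>, so the induction step is Fubini for
    two absolutely convergent series.\<close>
  define h where "h = (\<lambda>(m, c). m + replicate_mset c K)"
  have IH: "(\<lambda>m. norm (f m)) summable_on U K" "(f has_sum (\<Prod>k<K. G k)) (U K)"
    using Suc by (auto simp: f_def U_def)
  have bij: "bij_betw h (U K \<times> UNIV) (U (Suc K))"
  proof (rule bij_betw_byWitness[where f' = "\<lambda>m. (filter_mset (\<lambda>k. k \<noteq> K) m, count m K)"])
    show "\<forall>a\<in>U K \<times> UNIV. (filter_mset (\<lambda>k. k \<noteq> K) (h a), count (h a) K) = a"
    proof
      fix a assume a: "a \<in> U K \<times> (UNIV :: nat set)"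
      obtain m c where mc: "a = (m, c)" by force
      have "K \<notin># m" using a mc by (auto simp: U_def)
      then show "(filter_mset (\<lambda>k. k \<noteq> K) (h a), count (h a) K) = a"
        by (auto simp: mc h_def not_in_iff intro!: multiset_eqI)
    qed
    show "\<forall>m\<in>U (Suc K). h (filter_mset (\<lambda>k. k \<noteq> K) m, count m K) = m"
      by (auto simp: h_def intro!: multiset_eqI)
    show "h ` (U K \<times> UNIV) \<subseteq> U (Suc K)"
      by (fastforce simp: h_def U_def)
    show "(\<lambda>m. (filter_mset (\<lambda>k. k \<noteq> K) m, count m K)) ` U (Suc K) \<subseteq> U K \<times> UNIV"
      by (fastforce simp: U_def less_Suc_eq)
  qed
  have val: "(\<Prod>k<Suc K. g k (count (h p) k)) = f (fst p) * g K (snd p)" if "p \<in> U K \<times> UNIV" for p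
  proof -
    obtain m c where p: "p = (m, c)" by force
    have "K \<notin># m" using that p by (auto simp: U_def)
    then show ?thesis by (simp add: p f_def h_def not_in_iff)
  qed
  have abs: "(\<lambda>p. norm (f (fst p) * g K (snd p))) summable_on U K \<times> UNIV"
  proof -
    have "(\<lambda>p. norm (f (fst p)) * norm (g K (snd p))) summable_on U K \<times> UNIV"
    proof (rule summable_on_SigmaI)
      show "((\<lambda>c. norm (f (fst (m, c))) * norm (g K (snd (m, c)))) has_sum
          norm (f m) * (\<Sum>\<^sub>\<infinity>c. norm (g K c))) UNIV" for m
        using g_abs[of K] by (auto intro!: has_sum_cmult_right)
      show "(\<lambda>m. norm (f m) * (\<Sum>\<^sub>\<infinity>c. norm (g K c))) summable_on U K"
        using IH(1) by (intro summable_on_cmult_left)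
    qed auto
    then show ?thesis by (simp add: norm_mult)
  qed
  have "((\<lambda>p. f (fst p) * g K (snd p)) has_sum (\<Prod>k<K. G k) * G K) (U K \<times> UNIV)"
  proof (rule has_sum_SigmaI)
    show "((\<lambda>c. f (fst (m, c)) * g K (snd (m, c))) has_sum f m * G K) UNIV" for m
      using g[of K] by (auto intro!: has_sum_cmult_right)
    show "((\<lambda>m. f m * G K) has_sum (\<Prod>k<K. G k) * G K) (U K)"
      using IH(2) by (intro has_sum_cmult_left)
    show "(\<lambda>p. f (fst p) * g K (snd p)) summable_on U K \<times> UNIV"
      by (rule abs_summable_summable[OF abs])
  qed
  then have "((\<lambda>p. \<Prod>k<Suc K. g k (count (h p) k)) has_sum (\<Prod>k<Suc K. G k)) (U K \<times> UNIV)"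
    by (subst has_sum_cong[OF val]) auto
  moreover have "(\<lambda>p. norm (\<Prod>k<Suc K. g k (count (h p) k))) summable_on (U K \<times> UNIV)"
    by (subst summable_on_cong[where g = "\<lambda>p. norm (f (fst p) * g K (snd p))"]) (simp_all only: val abs)
  ultimately show ?case
    unfolding U_def[symmetric] has_sum_reindex_bij_betw[OF bij, of "\<lambda>m. \<Prod>k<Suc K. g k (count m k)"]
      summable_on_reindex_bij_betw[OF bij, of "\<lambda>m. norm (\<Prod>k<Suc K. g k (count m k))"]
    by (rule conjI[rotated])
qed

lemma finite_mset_set_bound:
  assumes "finite (X :: nat multiset set)"
  obtains K where "K \<ge> K0" "\<And>K' m. K' \<ge> K \<Longrightarrow> m \<in> X \<Longrightarrow> set_mset m \<subseteq> {..<K'}"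
proof -
  have "finite (\<Union>m\<in>X. set_mset m)" using assms by auto
  then obtain K where "\<forall>k\<in>(\<Union>m\<in>X. set_mset m). k < K"
    using finite_nat_set_iff_bounded by blast
  then show ?thesis by (intro that[of "max K K0"]) force+
qed

text \<open>Every finite family of multisets lies over finitely many modes, so the bound
  \<open>C\<close> on finite partial products controls all finite sums of norms. The threshold
  \<open>K0\<close> is there because a matrix element between two given states factorises only over
  sets of modes that contain all modes occupied in these states.\<close>

proposition prod_count_has_sum:
  fixes g :: "nat \<Rightarrow> nat \<Rightarrow> 'a :: {real_normed_field, banach}"
  assumes g: "\<And>k. (g k has_sum G k) UNIV"
    and h: "\<And>k. (h k has_sum H k) UNIV"
    and le: "\<And>k c. norm (g k c) \<le> h k c"
    and bound: "\<And>K. (\<Prod>k<K. H k) \<le> C"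
    and lim: "(\<lambda>K. \<Prod>k<K. G k) \<longlonglongrightarrow> L"
    and F: "\<And>K m. K \<ge> K0 \<Longrightarrow> set_mset m \<subseteq> {..<K} \<Longrightarrow> F m = (\<Prod>k<K. g k (count m k))"
  shows "(\<lambda>m. norm (F m)) summable_on UNIV" "(F has_sum L) UNIV"
proof -
  define U where "U K = {m. set_mset m \<subseteq> {..<K}}" for K :: nat
  have h_nonneg: "h k c \<ge> 0" for k c using le[of k c] norm_ge_zero order_trans by blast
  have g_abs: "(\<lambda>c. norm (g k c)) summable_on UNIV" for k
    by (rule Infinite_Sum.abs_summable_on_comparison_test'[OF has_sum_imp_summable[OF h[of k]]]) (use le in auto)
  have h_abs: "(\<lambda>c. norm (h k c)) summable_on UNIV" for k
    using has_sum_imp_summable[OF h[of k]] h_nonneg by simp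
  have hK: "((\<lambda>m. \<Prod>k<K. h k (count m k)) has_sum (\<Prod>k<K. H k)) (U K)" for K
    using conjunct2[OF prod_count_has_sum_bounded[of h H K, OF h h_abs]] unfolding U_def .
  show abs: "(\<lambda>m. norm (F m)) summable_on UNIV"
  proof (rule nonneg_bounded_partial_sums_imp_summable_on[where C = C])
    show "\<forall>\<^sub>F X in finite_subsets_at_top UNIV. (\<Sum>m\<in>X. norm (F m)) \<le> C"
    proof (rule eventually_finite_subsets_at_top_weakI)
      fix X :: "nat multiset set" assume "finite X"
      then obtain K where K: "K \<ge> K0" "\<And>m. m \<in> X \<Longrightarrow> set_mset m \<subseteq> {..<K}"
        using finite_mset_set_bound[of X K0] by (metis order_refl)
      have "(\<Sum>m\<in>X. norm (F m)) \<le> (\<Sum>m\<in>X. \<Prod>k<K. h k (count m k))"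
      proof (rule sum_mono)
        fix m assume "m \<in> X"
        then have "norm (F m) = (\<Prod>k<K. norm (g k (count m k)))"
          using K by (simp only: F prod_norm)
        also have "\<dots> \<le> (\<Prod>k<K. h k (count m k))"
          by (intro prod_mono conjI le norm_ge_zero)
        finally show "norm (F m) \<le> (\<Prod>k<K. h k (count m k))" .
      qed
      also have "\<dots> \<le> (\<Prod>k<K. H k)"
        using K(2) by (intro finite_sum_le_has_sum[OF hK] \<open>finite X\<close>)
          (auto simp: U_def intro!: prod_nonneg h_nonneg)
      finally show "(\<Sum>m\<in>X. norm (F m)) \<le> C" using bound[of K] by linarith
    qed
  qed auto
  define S where "S = infsum F UNIV"
  have S: "(F has_sum S) UNIV"
    unfolding S_def by (rule has_sum_infsum[OF abs_summable_summable[OF abs]])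
  have "(\<lambda>K. \<Prod>k<K. G k) \<longlonglongrightarrow> S"
  proof (rule metric_LIMSEQ_I)
    fix e :: real assume "e > 0"
    then have "\<forall>\<^sub>F X in finite_subsets_at_top UNIV. dist (sum F X) S < e / 2"
      using S unfolding has_sum_def tendsto_iff by (meson half_gt_zero)
    then obtain X where X: "finite X" "\<And>Y. finite Y \<Longrightarrow> X \<subseteq> Y \<Longrightarrow> dist (sum F Y) S < e / 2"
      unfolding eventually_finite_subsets_at_top by (metis subset_UNIV)
    obtain K where K: "K \<ge> K0" "\<And>K' m. K' \<ge> K \<Longrightarrow> m \<in> X \<Longrightarrow> set_mset m \<subseteq> {..<K'}"
      by (rule finite_mset_set_bound[OF X(1), of K0]) blast
    have "dist (\<Prod>k<K'. G k) S < e" if "K' \<ge> K" for K'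
    proof -
      have "((\<lambda>m. \<Prod>k<K'. g k (count m k)) has_sum (\<Prod>k<K'. G k)) (U K')"
        using conjunct2[OF prod_count_has_sum_bounded[of g G K', OF g g_abs]] unfolding U_def .
      then have "(F has_sum (\<Prod>k<K'. G k)) (U K')"
        by (rule has_sum_cong[THEN iffD1, rotated]) (use K(1) that in \<open>simp add: U_def F[of K']\<close>)
      then have "((\<lambda>Y. dist (sum F Y) S) \<longlongrightarrow> dist (\<Prod>k<K'. G k) S) (finite_subsets_at_top (U K'))"
        unfolding has_sum_def by (intro tendsto_intros)
      \<comment> \<open>Once \<open>K'\<close> is so large that \<open>X\<close> consists of
        multisets over \<open>K'\<close> modes, all finite sets between \<open>X\<close> and
        \<open>U K'\<close> give sums within \<open>e / 2\<close> of \<open>S\<close>; their limit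
        is the partial product.\<close>
      moreover have "\<forall>\<^sub>F Y in finite_subsets_at_top (U K'). dist (sum F Y) S \<le> e / 2"
        unfolding eventually_finite_subsets_at_top
        using X K(2)[OF that] by (intro exI[of _ X]) (force simp: U_def less_imp_le)
      ultimately have "dist (\<Prod>k<K'. G k) S \<le> e / 2"
        by (rule tendsto_upperbound) simp
      then show ?thesis using \<open>e > 0\<close> by simp
    qed
    then show "\<exists>N. \<forall>K\<ge>N. dist (\<Prod>k<K. G k) S < e" by blast
  qed
  then have "S = L" using lim LIMSEQ_unique by blast
  with S show "(F has_sum L) UNIV" by simp
qed

section \<open>Normally ordered exponentials of a single mode\<close>

definition mode_kernel :: "'a \<Rightarrow> 'a \<Rightarrow> nat \<Rightarrow> nat \<Rightarrow> 'a :: real_normed_field" where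
  "mode_kernel a b l m = (\<Sum>j\<le>l. a ^ (l - j) / fact (l - j) * (of_nat (m choose j) * b ^ (m - j)))"

lemma mode_kernel_0_0 [simp]: "mode_kernel a b 0 0 = 1"
  by (simp add: mode_kernel_def)

lemma mode_kernel_zero_params: "mode_kernel 0 0 l m = (if l = m then 1 else 0)"
proof -
  have "mode_kernel 0 0 l m =
      (\<Sum>j\<le>l. if j = l then of_nat (m choose l) * 0 ^ (m - l) else (0 :: 'a))"
    unfolding mode_kernel_def by (intro sum.cong) (auto simp: power_0_left)
  also have "\<dots> = of_nat (m choose l) * 0 ^ (m - l)" by simp
  also have "\<dots> = (if l = m then 1 else 0)"
    by (cases l m rule: linorder_cases) (auto simp: power_0_left binomial_eq_0)
  finally show ?thesis .
qed

lemma mode_kernel_nonneg: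
  assumes "a \<ge> 0" "b \<ge> (0 :: real)"
  shows "mode_kernel a b l m \<ge> 0"
  unfolding mode_kernel_def using assms by (intro sum_nonneg) auto

lemma norm_mode_kernel_le: "norm (mode_kernel a b l m) \<le> mode_kernel (norm a) (norm b) l m"
  unfolding mode_kernel_def
  by (rule order_trans[OF norm_sum]) (simp add: norm_mult norm_divide norm_power)

lemma has_sum_sum:
  fixes f :: "'a \<Rightarrow> 'b \<Rightarrow> 'c :: topological_comm_monoid_add"
  assumes "\<And>i. i \<in> I \<Longrightarrow> (f i has_sum S i) A"
  shows "((\<lambda>x. \<Sum>i\<in>I. f i x) has_sum (\<Sum>i\<in>I. S i)) A"
  using assms by (induction I rule: infinite_finite_induct) (auto intro!: has_sum_add)

lemma exp_series_has_sum:
  fixes x :: "'a :: {real_normed_field, banach}"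
  shows "((\<lambda>n. x ^ n / fact n) has_sum exp x) UNIV"
proof (rule norm_summable_imp_has_sum)
  show "(\<lambda>n. x ^ n / fact n) sums exp x"
    using exp_converges[of x] by (simp add: scaleR_conv_of_real field_simps)
  show "summable (\<lambda>n. norm (x ^ n / fact n))"
    using summable_norm_exp[of x] by (simp add: scaleR_conv_of_real norm_divide norm_mult field_simps)
qed

lemma binomial_exp_has_sum:
  fixes a b :: "'a :: {real_normed_field, banach}"
  shows "((\<lambda>d. of_nat (d choose s) * a ^ d * b ^ (d - s) / fact d) has_sum a ^ s / fact s * exp (a * b)) UNIV"
proof -
  let ?f = "\<lambda>d. of_nat (d choose s) * a ^ d * b ^ (d - s) / fact d"
  have "((\<lambda>e. a ^ s / fact s * ((a * b) ^ e / fact e)) has_sum a ^ s / fact s * exp (a * b)) UNIV"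
    by (intro has_sum_cmult_right exp_series_has_sum)
  also have "(\<lambda>e. a ^ s / fact s * ((a * b) ^ e / fact e)) = ?f \<circ> (\<lambda>e. s + e)"
  proof
    fix e
    have "of_nat (s + e choose s) * (fact s * fact e) = (fact (s + e) :: 'a)"
      by (metis binomial_fact_lemma diff_add_inverse le_add1 mult.commute of_nat_fact of_nat_mult)
    then show "a ^ s / fact s * ((a * b) ^ e / fact e) = (?f \<circ> (\<lambda>e. s + e)) e"
      by (simp add: field_simps power_add power_mult_distrib)
  qed
  finally have "(?f has_sum a ^ s / fact s * exp (a * b)) ((\<lambda>e. s + e) ` UNIV)"
    by (simp only: has_sum_reindex[OF inj_on_add])
  then show ?thesis
  proof (rule has_sum_cong_neutral[THEN iffD1, rotated -1])
    fix d assume "d \<in> UNIV - range ((+) s)"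
    then have "d < s" by (metis DiffD2 le_Suc_ex not_le rangeI)
    then show "?f d = 0" by (simp add: binomial_eq_0)
  qed auto
qed

text \<open>Matrix form of the relation that moves an annihilation exponential to the right of a
  creation exponential at the price of the scalar exp (b a). With c = i + d, Vandermonde's identity
  splits the j surviving quanta into r of the i incoming ones and j - r of the d created
  ones.\<close>

lemma annihilation_creation_has_sum:
  fixes a b :: "'a :: {real_normed_field, banach}"
  shows "((\<lambda>c. (of_nat (c choose j) * b ^ (c - j)) * (if i \<le> c then a ^ (c - i) / fact (c - i) else 0))
    has_sum exp (b * a) * (\<Sum>r\<le>j. a ^ (j - r) / fact (j - r) * (of_nat (i choose r) * b ^ (i - r)))) UNIV"
    (is "(?f has_sum ?S) _")
proof -
  have "((\<lambda>d. \<Sum>r\<le>j. of_nat (i choose r) * b ^ (i - r) *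
        (of_nat (d choose (j - r)) * a ^ d * b ^ (d - (j - r)) / fact d)) has_sum
      (\<Sum>r\<le>j. of_nat (i choose r) * b ^ (i - r) * (a ^ (j - r) / fact (j - r) * exp (a * b)))) UNIV"
    by (intro has_sum_sum has_sum_cmult_right binomial_exp_has_sum)
  also have "(\<Sum>r\<le>j. of_nat (i choose r) * b ^ (i - r) * (a ^ (j - r) / fact (j - r) * exp (a * b))) = ?S"
    by (simp add: sum_distrib_left algebra_simps)
  also have "(\<lambda>d. \<Sum>r\<le>j. of_nat (i choose r) * b ^ (i - r) *
        (of_nat (d choose (j - r)) * a ^ d * b ^ (d - (j - r)) / fact d)) = ?f \<circ> (\<lambda>d. i + d)"
  proof
    fix d
    have "of_nat (i choose r) * b ^ (i - r) * (of_nat (d choose (j - r)) * a ^ d * b ^ (d - (j - r)) / fact d)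
        = of_nat ((i choose r) * (d choose (j - r))) * (b ^ (i + d - j) * a ^ d / fact d)"
      if "r \<le> j" for r
    proof (cases "r \<le> i \<and> j - r \<le> d")
      case True
      then have "i + d - j = (i - r) + (d - (j - r))" using that by linarith
      then show ?thesis by (simp add: power_add)
    next
      case False
      then have "(i choose r) * (d choose (j - r)) = 0" by (auto simp: binomial_eq_0 not_le)
      then show ?thesis by auto
    qed
    then have "(\<Sum>r\<le>j. of_nat (i choose r) * b ^ (i - r) *
        (of_nat (d choose (j - r)) * a ^ d * b ^ (d - (j - r)) / fact d)) =
      of_nat (\<Sum>r\<le>j. (i choose r) * (d choose (j - r))) * (b ^ (i + d - j) * a ^ d / fact d)"
      unfolding of_nat_sum sum_distrib_right by (intro sum.cong) auto
    also have "\<dots> = (?f \<circ> (\<lambda>d. i + d)) d"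
      unfolding vandermonde by simp
    finally show "(\<Sum>r\<le>j. of_nat (i choose r) * b ^ (i - r) *
        (of_nat (d choose (j - r)) * a ^ d * b ^ (d - (j - r)) / fact d)) = (?f \<circ> (\<lambda>d. i + d)) d" .
  qed
  finally have "(?f has_sum ?S) ((\<lambda>d. i + d) ` UNIV)"
    by (simp only: has_sum_reindex[OF inj_on_add])
  then show ?thesis
  proof (rule has_sum_cong_neutral[THEN iffD1, rotated -1])
    fix c assume "c \<in> UNIV - range ((+) i)"
    then have "c < i" by (metis DiffD2 le_Suc_ex not_le rangeI)
    then show "?f c = 0" by simp
  qed auto
qed

lemma creation_mult:
  fixes a a' :: "'a :: {real_normed_field, banach}"
  assumes "r \<le> l"
  shows "(\<Sum>j\<in>{r..l}. a ^ (l - j) / fact (l - j) * (a' ^ (j - r) / fact (j - r))) = (a + a') ^ (l - r) / fact (l - r)"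
proof -
  have "(\<Sum>j\<in>{r..l}. a ^ (l - j) / fact (l - j) * (a' ^ (j - r) / fact (j - r))) =
      (\<Sum>k\<le>l - r. a ^ (l - r - k) / fact (l - r - k) * (a' ^ k / fact k))"
    using assms by (intro sum.reindex_bij_witness[of _ "\<lambda>k. k + r" "\<lambda>j. j - r"]) auto
  also have "\<dots> = (\<Sum>k\<le>l - r. of_nat (l - r choose k) * a' ^ k * a ^ (l - r - k) / fact (l - r))"
    by (intro sum.cong) (auto simp: binomial_fact field_simps)
  also have "\<dots> = (a' + a) ^ (l - r) / fact (l - r)"
    by (simp add: binomial_ring sum_divide_distrib)
  finally show ?thesis by (simp add: add.commute)
qed

lemma annihilation_mult:
  fixes b b' :: "'a :: {real_normed_field, banach}"
  shows "(\<Sum>i\<le>m. (of_nat (i choose r) * b ^ (i - r)) * (of_nat (m choose i) * b' ^ (m - i)))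
    = of_nat (m choose r) * (b + b') ^ (m - r)"
proof (cases "r \<le> m")
  case True
  have "(\<Sum>i\<le>m. (of_nat (i choose r) * b ^ (i - r)) * (of_nat (m choose i) * b' ^ (m - i))) =
      (\<Sum>i\<in>{r..m}. (of_nat (i choose r) * b ^ (i - r)) * (of_nat (m choose i) * b' ^ (m - i)))"
    by (rule sum.mono_neutral_right) (auto simp: binomial_eq_0)
  also have "\<dots> = (\<Sum>k\<le>m - r. of_nat (m choose r) * (of_nat (m - r choose k) * b ^ k * b' ^ (m - r - k)))"
  proof (rule sum.reindex_bij_witness[of _ "\<lambda>k. k + r" "\<lambda>j. j - r"], goal_cases)
    case (5 i)
    then have "(m choose i) * (i choose r) = (m choose r) * (m - r choose (i - r))"
      by (intro choose_mult) auto
    then have "of_nat (m choose i) * of_nat (i choose r) = (of_nat (m choose r) * of_nat (m - r choose (i - r)) :: 'a)"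
      by (metis of_nat_mult)
    moreover have "m - r - (i - r) = m - i" using 5 by auto
    ultimately show ?case by (simp add: algebra_simps)
  qed (use True in auto)
  also have "\<dots> = of_nat (m choose r) * (b + b') ^ (m - r)"
    by (simp add: binomial_ring sum_distrib_left)
  finally show ?thesis .
next
  case False
  then show ?thesis by (auto intro!: sum.neutral simp: binomial_eq_0 not_le)
qed

text \<open>In the single mode Fock space \<open>mode_kernel a b\<close> is the matrix of the normally ordered
  exponential \<open>exp (a c\<^sup>*) exp (b c)\<close> with \<open>[c, c\<^sup>*] = 1\<close>.\<close>

lemma mode_kernel_compose:
  fixes a b a' b' :: "'a :: {real_normed_field, banach}"
  shows "((\<lambda>c. mode_kernel a b l c * mode_kernel a' b' c m) has_sum
    exp (b * a') * mode_kernel (a + a') (b + b') l m) UNIV"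
proof -
  let ?E = "\<lambda>a l j. a ^ (l - j) / (fact (l - j) :: 'a)"
  let ?F = "\<lambda>b j m. of_nat (m choose j) * b ^ (m - j) :: 'a"
  let ?E' = "\<lambda>a l j. if j \<le> l then ?E a l j else 0"
  \<comment> \<open>The summation bound is moved from c to m, where the binomial coefficients cut
    the sum off anyway, so that the finite sums can be interchanged with the series over c.\<close>
  have K: "mode_kernel a' b' c m = (\<Sum>i\<le>m. ?E' a' c i * ?F b' i m)" for c
  proof -
    have "mode_kernel a' b' c m = (\<Sum>i\<le>c. ?E' a' c i * ?F b' i m)"
      unfolding mode_kernel_def by (intro sum.cong) auto
    also have "\<dots> = (\<Sum>i\<le>max c m. ?E' a' c i * ?F b' i m)"
      by (rule sum.mono_neutral_left) auto
    also have "\<dots> = (\<Sum>i\<le>m. ?E' a' c i * ?F b' i m)"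
      by (rule sum.mono_neutral_right) (auto simp: binomial_eq_0)
    finally show ?thesis .
  qed
  have "((\<lambda>c. \<Sum>j\<le>l. \<Sum>i\<le>m. ?E a l j * ?F b' i m * (?F b j c * ?E' a' c i)) has_sum
      (\<Sum>j\<le>l. \<Sum>i\<le>m. ?E a l j * ?F b' i m * (exp (b * a') * (\<Sum>r\<le>j. ?E a' j r * ?F b r i)))) UNIV"
    by (intro has_sum_sum has_sum_cmult_right annihilation_creation_has_sum)
  moreover have "(\<Sum>j\<le>l. \<Sum>i\<le>m. ?E a l j * ?F b' i m * (?F b j c * ?E' a' c i))
      = mode_kernel a b l c * mode_kernel a' b' c m" for c
    unfolding K unfolding mode_kernel_def sum_product
    by (intro sum.cong refl) (simp only: mult_ac)
  moreover have "(\<Sum>j\<le>l. \<Sum>i\<le>m. ?E a l j * ?F b' i m * (exp (b * a') * (\<Sum>r\<le>j. ?E a' j r * ?F b r i)))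
      = exp (b * a') * mode_kernel (a + a') (b + b') l m"
  proof -
    have "(\<Sum>j\<le>l. \<Sum>i\<le>m. ?E a l j * ?F b' i m * (exp (b * a') * (\<Sum>r\<le>j. ?E a' j r * ?F b r i)))
       = exp (b * a') * (\<Sum>j\<le>l. \<Sum>r\<le>j. ?E a l j * ?E a' j r * (\<Sum>i\<le>m. ?F b r i * ?F b' i m))"
    proof -
      have "(\<Sum>i\<le>m. ?E a l j * ?F b' i m * (exp (b * a') * (\<Sum>r\<le>j. ?E a' j r * ?F b r i)))
         = exp (b * a') * (\<Sum>r\<le>j. ?E a l j * ?E a' j r * (\<Sum>i\<le>m. ?F b r i * ?F b' i m))" for j
        unfolding sum_distrib_left by (subst sum.swap) (simp only: mult_ac)
      then show ?thesis by (simp only: sum_distrib_left)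
    qed
    also have "(\<Sum>j\<le>l. \<Sum>r\<le>j. ?E a l j * ?E a' j r * (\<Sum>i\<le>m. ?F b r i * ?F b' i m))
       = (\<Sum>j\<le>l. \<Sum>r\<le>j. ?E a l j * ?E a' j r * ?F (b + b') r m)"
      by (simp only: annihilation_mult)
    also have "\<dots> = (\<Sum>r\<le>l. \<Sum>j\<in>{r..l}. ?E a l j * ?E a' j r * ?F (b + b') r m)"
      by (subst (1 2) sum.Sigma, simp, simp, simp, simp)
        (rule sum.reindex_bij_witness[of _ "\<lambda>(r, j). (j, r)" "\<lambda>(j, r). (r, j)"], auto)
    also have "\<dots> = mode_kernel (a + a') (b + b') l m"
      unfolding mode_kernel_def sum_distrib_right[symmetric]
      by (intro sum.cong refl) (subst creation_mult, auto)
    finally show ?thesis .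
  qed
  ultimately show ?thesis by simp
qed

lemma negative_binomial_sums:
  fixes q :: "'a :: {real_normed_field, banach}"
  assumes "norm q < 1"
  shows "(\<lambda>j. of_nat (d + j choose j) * q ^ j) sums (1 / (1 - q) ^ Suc d)"
    and "summable (\<lambda>j. norm (of_nat (d + j choose j) * q ^ j))"
proof -
  \<comment> \<open>Absolute convergence is derived from convergence for the same d, so that it is
    available inside the induction, where the Cauchy product with the geometric series requires
    it.\<close>
  have norm: "summable (\<lambda>j. norm (of_nat (d + j choose j) * q ^ j))"
    if sums: "\<And>x :: 'a. norm x < 1 \<Longrightarrow> (\<lambda>j. of_nat (d + j choose j) * x ^ j) sums (1 / (1 - x) ^ Suc d)"
      and q: "norm q < 1" for d and q :: 'a
  proof -
    \<comment> \<open>Any radius strictly between the norm of q and 1 would do: convergence at r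
      gives absolute convergence at q.\<close>
    define r :: real where "r = (norm q + 1) / 2"
    have r: "norm q < r" "r < 1" "0 \<le> r" using q norm_ge_zero[of q] by (simp_all add: r_def)
    have "summable (\<lambda>j. of_nat (d + j choose j) * of_real r ^ j :: 'a)"
      using r by (intro sums_summable[OF sums]) simp
    then show ?thesis using r by (intro powser_insidea[where x = "of_real r"]) auto
  qed
  have "\<And>x :: 'a. norm x < 1 \<Longrightarrow> (\<lambda>j. of_nat (d + j choose j) * x ^ j) sums (1 / (1 - x) ^ Suc d)"
  proof (induction d)
    case 0
    then show ?case using geometric_sums by simp
  next
    case (Suc d)
    have "(\<lambda>n. \<Sum>j\<le>n. (of_nat (d + j choose j) * x ^ j) * x ^ (n - j)) sums
        ((\<Sum>j. of_nat (d + j choose j) * x ^ j) * (\<Sum>j. x ^ j))"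
      using Suc.prems norm[OF Suc.IH Suc.prems] by (intro Cauchy_product_sums) (auto simp: norm_power)
    also have "(\<Sum>j. of_nat (d + j choose j) * x ^ j) * (\<Sum>j. x ^ j) = 1 / (1 - x) ^ Suc (Suc d)"
      using sums_unique[OF Suc.IH, symmetric] suminf_geometric[of x] Suc.prems by simp
    also have "(\<lambda>n. \<Sum>j\<le>n. (of_nat (d + j choose j) * x ^ j) * x ^ (n - j)) =
        (\<lambda>n. of_nat (\<Sum>j\<le>n. d + j choose j) * x ^ n)"
      unfolding of_nat_sum sum_distrib_right
      by (intro ext sum.cong refl) (simp add: mult.assoc flip: power_add)
    finally show ?case by (simp add: sum_choose_lower)
  qed
  then show "(\<lambda>j. of_nat (d + j choose j) * q ^ j) sums (1 / (1 - q) ^ Suc d)"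
    and "summable (\<lambda>j. norm (of_nat (d + j choose j) * q ^ j))"
    using assms norm by blast+
qed

lemma negative_binomial_has_sum:
  fixes q :: "'a :: {real_normed_field, banach}"
  assumes "norm q < 1"
  shows "((\<lambda>j. of_nat (d + j choose j) * q ^ j) has_sum (1 / (1 - q) ^ Suc d)) UNIV"
  by (intro norm_summable_imp_has_sum negative_binomial_sums assms)

text \<open>With d = c - j the diagonal sum becomes a double series: over j it is a negative
  binomial series with value 1 / (1 - q)^(d + 1), and the remaining series over d is
  exponential.\<close>

lemma mode_kernel_trace:
  fixes a b q :: "'a :: {real_normed_field, banach}"
  assumes "norm q < 1"
  shows "((\<lambda>c. q ^ c * mode_kernel a b c c) has_sum exp (a * b * q / (1 - q)) / (1 - q)) UNIV"
proof -
  let ?t = "\<lambda>a b (q :: 'b :: {real_normed_field, banach}) (d, j). ((a * b * q) ^ d / fact d) * (of_nat (d + j choose j) * q ^ j)"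
  have inner: "((\<lambda>j. ?t a b q (d, j)) has_sum ((a * b * q) ^ d / fact d) * (1 / (1 - q) ^ Suc d)) UNIV"
    if "norm q < 1" for a b q :: "'b :: {real_normed_field, banach}" and d
    using has_sum_cmult_right[OF negative_binomial_has_sum[OF that, of d], of "(a * b * q) ^ d / fact d"]
    by simp
  have outer: "((\<lambda>d. ((a * b * q) ^ d / fact d) * (1 / (1 - q) ^ Suc d)) has_sum
      exp (a * b * q / (1 - q)) / (1 - q)) UNIV"
    if "norm q < 1" for a b q :: "'b :: {real_normed_field, banach}"
    using has_sum_cmult_left[OF exp_series_has_sum[of "a * b * q / (1 - q)"], of "1 / (1 - q)"]
    by (simp add: power_divide field_simps)
  have "(\<lambda>p. norm (?t a b q p)) summable_on UNIV \<times> UNIV"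
  proof -
    have "?t (norm a) (norm b) (norm q) summable_on UNIV \<times> UNIV"
    proof (rule summable_on_SigmaI)
      show "((\<lambda>j. ?t (norm a) (norm b) (norm q) (d, j)) has_sum
         ((norm a * norm b * norm q) ^ d / fact d) * (1 / (1 - norm q) ^ Suc d)) UNIV" for d
        using assms by (intro inner) auto
      show "(\<lambda>d. ((norm a * norm b * norm q) ^ d / fact d) * (1 / (1 - norm q) ^ Suc d)) summable_on UNIV"
        using assms by (intro has_sum_imp_summable[OF outer]) auto
    qed auto
    also have "?t (norm a) (norm b) (norm q) = (\<lambda>p. norm (?t a b q p))"
      by (auto simp: norm_mult norm_divide norm_power)
    finally show ?thesis .
  qed
  then have "(?t a b q has_sum exp (a * b * q / (1 - q)) / (1 - q)) (UNIV \<times> UNIV)"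
    by (rule has_sum_SigmaI[OF inner[OF assms] outer[OF assms] abs_summable_summable])
  moreover have bij: "bij_betw (\<lambda>(c, j). (c - j, j)) (Sigma UNIV (\<lambda>c. {..c})) (UNIV \<times> (UNIV :: nat set))"
    by (rule bij_betw_byWitness[where f' = "\<lambda>(d, j). (d + j, j)"]) auto
  ultimately have "((\<lambda>p. ?t a b q (case p of (c, j) \<Rightarrow> (c - j, j))) has_sum exp (a * b * q / (1 - q)) / (1 - q))
      (Sigma UNIV (\<lambda>c. {..c}))"
    using has_sum_reindex_bij_betw[OF bij, of "?t a b q"] by blast
  then show ?thesis
  proof (rule has_sum_SigmaD)
    fix c :: nat
    have "(\<Sum>j\<le>c. ?t a b q (c - j, j)) = q ^ c * mode_kernel a b c c"
      unfolding mode_kernel_def sum_distrib_left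
    proof (intro sum.cong refl, goal_cases)
      case (1 j)
      then have "q ^ c = q ^ (c - j) * q ^ j" by (simp flip: power_add)
      moreover have "c - j + j choose j = c choose j" using 1 by simp
      ultimately show ?case by (simp add: power_mult_distrib)
    qed
    then show "((\<lambda>j. ?t a b q (case (c, j) of (c, j) \<Rightarrow> (c - j, j))) has_sum q ^ c * mode_kernel a b c c) {..c}"
      by (auto intro!: has_sum_finiteI)
  qed
qed

section \<open>The full Fock space as a product over all modes\<close>

definition fock_kernel :: "(nat \<Rightarrow> 'a) \<Rightarrow> (nat \<Rightarrow> 'a) \<Rightarrow> nat multiset \<Rightarrow> nat multiset \<Rightarrow> 'a :: real_normed_field" where
  "fock_kernel A B l m = (\<Prod>k\<in>set_mset l \<union> set_mset m. mode_kernel (A k) (B k) (count l k) (count m k))"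

text \<open>A mode that is empty on both sides contributes 1. This lets several kernels be compared
  over one common finite set of modes.\<close>

lemma fock_kernel_eq_prod:
  assumes "finite F" "set_mset l \<subseteq> F" "set_mset m \<subseteq> F"
  shows "fock_kernel A B l m = (\<Prod>k\<in>F. mode_kernel (A k) (B k) (count l k) (count m k))"
  unfolding fock_kernel_def using assms
  by (intro prod.mono_neutral_left) (auto simp: not_in_iff)

lemma fock_kernel_zero_params: "fock_kernel (\<lambda>_. 0) (\<lambda>_. 0) l m = (if l = m then 1 else 0)"
proof (cases "l = m")
  case False
  then obtain k where "count l k \<noteq> count m k" by (metis multiset_eqI)
  then show ?thesis using False
    by (auto simp: fock_kernel_def mode_kernel_zero_params not_in_iff intro!: bexI[of _ k])
qed (simp add: fock_kernel_def mode_kernel_zero_params)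

lemma norm_fock_kernel_le:
  "norm (fock_kernel A B l m) \<le> fock_kernel (\<lambda>k. norm (A k)) (\<lambda>k. norm (B k)) l m"
  unfolding fock_kernel_def prod_norm[symmetric]
  by (intro prod_mono) (auto intro: norm_mode_kernel_le)

lemma fock_kernel_nonneg:
  assumes "\<And>k. A k \<ge> 0" "\<And>k. B k \<ge> (0 :: real)"
  shows "fock_kernel A B l m \<ge> 0"
  unfolding fock_kernel_def using assms by (intro prod_nonneg) (auto intro: mode_kernel_nonneg)

lemma mset_bound: obtains K where "set_mset l \<subseteq> {..<K}" "set_mset m \<subseteq> {..<(K :: nat)}"
proof -
  have "finite (set_mset l \<union> set_mset m)" by simp
  then obtain K where "\<forall>k\<in>set_mset l \<union> set_mset m. k < K"
    using finite_nat_set_iff_bounded by blast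
  then show ?thesis by (intro that[of K]) auto
qed

lemma tendsto_bound_prod:
  assumes "(\<lambda>K. \<Prod>k<K. H k) \<longlonglongrightarrow> (L :: real)"
  shows "\<exists>C. \<forall>K. (\<Prod>k<K. H k) \<le> C"
proof -
  have "Bseq (\<lambda>K. \<Prod>k<K. H k)"
    using assms by (intro convergent_imp_Bseq convergentI)
  then obtain C where "\<And>K. norm (\<Prod>k<K. H k) \<le> C" unfolding Bseq_def by blast
  then show ?thesis by (auto simp: abs_le_iff)
qed

lemma exp_prod_fock_kernel_LIMSEQ:
  fixes x :: "nat \<Rightarrow> 'a :: {real_normed_field, banach}"
  assumes "summable x"
  shows "(\<lambda>K. \<Prod>k<K. exp (x k) * mode_kernel (A k) (B k) (count l k) (count m k)) \<longlonglongrightarrow>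
    exp (\<Sum>k. x k) * fock_kernel A B l m"
proof -
  obtain K0 where K0: "set_mset l \<subseteq> {..<K0}" "set_mset m \<subseteq> {..<K0}" by (rule mset_bound)
  have "(\<lambda>K. exp (\<Sum>k<K. x k) * fock_kernel A B l m) \<longlonglongrightarrow> exp (\<Sum>k. x k) * fock_kernel A B l m"
    by (intro tendsto_intros summable_LIMSEQ assms)
  moreover have "\<forall>\<^sub>F K in sequentially. exp (\<Sum>k<K. x k) * fock_kernel A B l m =
      (\<Prod>k<K. exp (x k) * mode_kernel (A k) (B k) (count l k) (count m k))"
    using eventually_ge_at_top[of K0]
  proof eventually_elim
    case (elim K)
    then have "set_mset l \<subseteq> {..<K}" "set_mset m \<subseteq> {..<K}" using K0 by force+
    then show ?case by (simp add: fock_kernel_eq_prod[of "{..<K}"] prod.distrib exp_sum)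
  qed
  ultimately show ?thesis by (rule Lim_transform_eventually)
qed

text \<open>For given outer states all but finitely many modes contribute only the scalar exp (B_k
  A'_k), and the summability hypothesis makes their infinite product converge. The majorant
  \<open>?H\<close> is the same computation for the norms of the parameters.\<close>

proposition fock_kernel_compose:
  fixes A B A' B' :: "nat \<Rightarrow> 'a :: {real_normed_field, banach}"
  assumes "summable (\<lambda>k. norm (B k * A' k))"
  shows "((\<lambda>c. fock_kernel A B l c * fock_kernel A' B' c m) has_sum
      exp (\<Sum>k. B k * A' k) * fock_kernel (\<lambda>k. A k + A' k) (\<lambda>k. B k + B' k) l m) UNIV"
proof -
  obtain K0 where K0: "set_mset l \<subseteq> {..<K0}" "set_mset m \<subseteq> {..<K0}" by (rule mset_bound)
  let ?H = "\<lambda>k. exp (norm (B k) * norm (A' k)) * mode_kernel (norm (A k) + norm (A' k)) (norm (B k) + norm (B' k))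
    (count l k) (count m k)"
  have sm: "summable (\<lambda>k. norm (B k) * norm (A' k))" using assms by (simp add: norm_mult)
  obtain C where C: "\<And>K. (\<Prod>k<K. ?H k) \<le> C"
    using tendsto_bound_prod[OF exp_prod_fock_kernel_LIMSEQ[OF sm, of "\<lambda>k. norm (A k) + norm (A' k)"
        "\<lambda>k. norm (B k) + norm (B' k)" l m]] by blast
  show ?thesis
  proof (rule prod_count_has_sum[where C = C and ?K0.0 = K0])
    show "((\<lambda>c. mode_kernel (A k) (B k) (count l k) c * mode_kernel (A' k) (B' k) c (count m k)) has_sum
      exp (B k * A' k) * mode_kernel (A k + A' k) (B k + B' k) (count l k) (count m k)) UNIV" for k
      by (rule mode_kernel_compose)
    show "((\<lambda>c. mode_kernel (norm (A k)) (norm (B k)) (count l k) c *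
        mode_kernel (norm (A' k)) (norm (B' k)) c (count m k)) has_sum ?H k) UNIV" for k
      by (rule mode_kernel_compose)
    show "norm (mode_kernel (A k) (B k) (count l k) c * mode_kernel (A' k) (B' k) c (count m k))
       \<le> mode_kernel (norm (A k)) (norm (B k)) (count l k) c * mode_kernel (norm (A' k)) (norm (B' k)) c (count m k)" for k c
      unfolding norm_mult by (intro mult_mono norm_mode_kernel_le mode_kernel_nonneg) auto
    show "(\<lambda>K. \<Prod>k<K. exp (B k * A' k) * mode_kernel (A k + A' k) (B k + B' k) (count l k) (count m k)) \<longlonglongrightarrow>
      exp (\<Sum>k. B k * A' k) * fock_kernel (\<lambda>k. A k + A' k) (\<lambda>k. B k + B' k) l m"
      by (intro exp_prod_fock_kernel_LIMSEQ summable_norm_cancel[OF assms])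
  next
    fix K c assume K: "K \<ge> K0" "set_mset c \<subseteq> {..<K}"
    then have "set_mset l \<subseteq> {..<K}" "set_mset m \<subseteq> {..<K}" using K0 by force+
    then show "fock_kernel A B l c * fock_kernel A' B' c m = (\<Prod>k<K. mode_kernel (A k) (B k) (count l k) (count c k) *
        mode_kernel (A' k) (B' k) (count c k) (count m k))"
      using K by (simp add: fock_kernel_eq_prod[of "{..<K}"] prod.distrib)
  qed (use C in auto)
qed

definition energy :: "nat multiset \<Rightarrow> nat" where
  "energy l = (\<Sum>k\<in>#l. Suc k)"

lemma power_energy_eq_prod:
  assumes "finite F" "set_mset l \<subseteq> F"
  shows "(q :: 'a :: comm_monoid_mult) ^ energy l = (\<Prod>k\<in>F. (q ^ Suc k) ^ count l k)"
proof -
  have "q ^ energy l = prod_mset (image_mset (\<lambda>k. q ^ Suc k) l)"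
    unfolding energy_def by (induction l) (auto simp: power_add mult_ac)
  also have "\<dots> = (\<Prod>k\<in>set_mset l. (q ^ Suc k) ^ count l k)"
    by (rule image_prod_mset_multiplicity)
  also have "\<dots> = (\<Prod>k\<in>F. (q ^ Suc k) ^ count l k)"
    using assms by (intro prod.mono_neutral_left) (auto simp: not_in_iff)
  finally show ?thesis .
qed

text \<open>The graded dimension of the Heisenberg Fock space without the factor q^(-1/24): the mode
  of energy k + 1 contributes a geometric series.\<close>

definition partition_fn :: "'a \<Rightarrow> 'a :: {real_normed_field, banach}" where
  "partition_fn q = (\<Prod>k. 1 / (1 - q ^ Suc k))"

lemma one_minus_power_bound:
  assumes "norm (q :: 'a :: real_normed_field) < 1"
  shows "1 - norm q \<le> norm (1 - q ^ Suc k)"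
proof -
  have "norm q ^ Suc k \<le> norm q" using assms power_le_one[of "norm q" k] by (simp add: mult_left_le)
  moreover have "1 - norm (q ^ Suc k) \<le> norm (1 - q ^ Suc k)"
    using norm_triangle_ineq2[of 1 "q ^ Suc k"] by simp
  ultimately show ?thesis by (simp add: norm_mult norm_power)
qed

lemma summable_divide_one_minus_power:
  fixes q :: "'a :: {real_normed_field, banach}"
  assumes "norm q < 1" "summable (\<lambda>k. norm (x k))"
  shows "summable (\<lambda>k. norm (x k / (1 - q ^ Suc k)))"
proof (rule summable_comparison_test')
  show "summable (\<lambda>k. norm (x k) / (1 - norm q))" using assms(2) by (rule summable_divide)
  show "norm (norm (x k / (1 - q ^ Suc k))) \<le> norm (x k) / (1 - norm q)" for k
    using one_minus_power_bound[OF assms(1), of k] assms(1)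
    by (auto simp: norm_divide intro!: divide_left_mono mult_pos_pos)
qed

lemma partition_fn_LIMSEQ:
  fixes q :: "'a :: {real_normed_field, banach}"
  assumes "norm q < 1"
  shows "(\<lambda>K. \<Prod>k<K. 1 / (1 - q ^ Suc k)) \<longlonglongrightarrow> partition_fn q"
proof -
  have "1 / (1 - q ^ Suc k) - 1 = q ^ Suc k / (1 - q ^ Suc k)" for k
  proof -
    have "norm (1 - q ^ Suc k) > 0" using one_minus_power_bound[OF assms, of k] assms by linarith
    then have "1 - q ^ Suc k \<noteq> 0" by (metis norm_zero less_irrefl)
    then show ?thesis by (simp add: field_simps)
  qed
  moreover have "summable (\<lambda>k. norm (q ^ Suc k / (1 - q ^ Suc k)))"
    using assms by (intro summable_divide_one_minus_power) 
      (auto simp: norm_mult norm_power intro!: summable_mult summable_geometric)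
  ultimately have "abs_convergent_prod (\<lambda>k. 1 / (1 - q ^ Suc k))"
    by (subst abs_convergent_prod_conv_summable) simp
  then have "convergent_prod (\<lambda>k. 1 / (1 - q ^ Suc k))"
    by (rule abs_convergent_prod_imp_convergent_prod)
  from convergent_prod_LIMSEQ[OF this] show ?thesis
    unfolding partition_fn_def lessThan_Suc_atMost[symmetric] by (rule filterlim_sequentially_Suc[THEN iffD1])
qed

text \<open>The energy is additive over modes, so this is a product of single mode traces in which
  mode k sees q^(k + 1) in place of q.\<close>

proposition fock_kernel_trace:
  fixes A B :: "nat \<Rightarrow> 'a :: {real_normed_field, banach}"
  assumes q: "norm q < 1" and sm: "summable (\<lambda>k. norm (A k * B k * q ^ Suc k))"
  shows "((\<lambda>l. q ^ energy l * fock_kernel A B l l) has_sum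
      exp (\<Sum>k. A k * B k * q ^ Suc k / (1 - q ^ Suc k)) * partition_fn q) UNIV"
proof -
  have lim: "(\<lambda>K. \<Prod>k<K. exp (A k * B k * q ^ Suc k / (1 - q ^ Suc k)) / (1 - q ^ Suc k)) \<longlonglongrightarrow>
      exp (\<Sum>k. A k * B k * q ^ Suc k / (1 - q ^ Suc k)) * partition_fn q"
    if "norm q < 1" "summable (\<lambda>k. norm (A k * B k * q ^ Suc k))"
    for A B :: "nat \<Rightarrow> 'b :: {real_normed_field, banach}" and q
  proof -
    have "(\<lambda>K. exp (\<Sum>k<K. A k * B k * q ^ Suc k / (1 - q ^ Suc k)) * (\<Prod>k<K. 1 / (1 - q ^ Suc k))) \<longlonglongrightarrow>
      exp (\<Sum>k. A k * B k * q ^ Suc k / (1 - q ^ Suc k)) * partition_fn q"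
      by (intro tendsto_intros summable_LIMSEQ summable_norm_cancel[OF summable_divide_one_minus_power]
          partition_fn_LIMSEQ that)
    also have "(\<lambda>K. exp (\<Sum>k<K. A k * B k * q ^ Suc k / (1 - q ^ Suc k)) * (\<Prod>k<K. 1 / (1 - q ^ Suc k)))
      = (\<lambda>K. \<Prod>k<K. exp (A k * B k * q ^ Suc k / (1 - q ^ Suc k)) / (1 - q ^ Suc k))"
      by (simp add: exp_sum flip: prod.distrib)
    finally show ?thesis .
  qed
  have nq: "norm (q ^ Suc k) < 1" for k
    using q power_Suc_less_one[of "norm q" k] by (cases "q = 0") (simp_all add: norm_power norm_mult)
  let ?H = "\<lambda>k. exp (norm (A k) * norm (B k) * norm q ^ Suc k / (1 - norm q ^ Suc k)) / (1 - norm q ^ Suc k)"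
  have sm': "summable (\<lambda>k. norm (norm (A k) * norm (B k) * norm q ^ Suc k))"
    using sm by (simp add: norm_mult norm_power)
  obtain C where C: "\<And>K. (\<Prod>k<K. ?H k) \<le> C"
    using tendsto_bound_prod[OF lim[OF _ sm']] q by (auto simp del: power_Suc)
  show ?thesis
  proof (rule prod_count_has_sum[where C = C and ?K0.0 = 0])
    show "((\<lambda>c. (q ^ Suc k) ^ c * mode_kernel (A k) (B k) c c) has_sum
      exp (A k * B k * q ^ Suc k / (1 - q ^ Suc k)) / (1 - q ^ Suc k)) UNIV" for k
      by (rule mode_kernel_trace[OF nq])
    show "((\<lambda>c. (norm q ^ Suc k) ^ c * mode_kernel (norm (A k)) (norm (B k)) c c) has_sum ?H k) UNIV" for k
      using nq[of k] by (intro mode_kernel_trace) (simp add: norm_power norm_mult)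
    show "norm ((q ^ Suc k) ^ c * mode_kernel (A k) (B k) c c) \<le>
        (norm q ^ Suc k) ^ c * mode_kernel (norm (A k)) (norm (B k)) c c" for k c
      unfolding norm_mult norm_power by (intro mult_left_mono norm_mode_kernel_le) auto
    show "(\<lambda>K. \<Prod>k<K. exp (A k * B k * q ^ Suc k / (1 - q ^ Suc k)) / (1 - q ^ Suc k)) \<longlonglongrightarrow>
      exp (\<Sum>k. A k * B k * q ^ Suc k / (1 - q ^ Suc k)) * partition_fn q"
      by (rule lim[OF q sm])
  next
    fix K and m :: "nat multiset" assume "set_mset m \<subseteq> {..<K}"
    then show "q ^ energy m * fock_kernel A B m m =
        (\<Prod>k<K. (q ^ Suc k) ^ count m k * mode_kernel (A k) (B k) (count m k) (count m k))"
      by (simp add: fock_kernel_eq_prod[of "{..<K}"] power_energy_eq_prod[of "{..<K}"] prod.distrib del: power_Suc)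
  qed (use C in auto)
qed

section \<open>Matrix elements of vertex operators\<close>

definition create_coeff :: "complex \<Rightarrow> complex \<Rightarrow> nat \<Rightarrow> complex" where
  "create_coeff \<alpha> \<zeta> k = \<alpha> * exp (of_nat (Suc k) * \<zeta>) / of_nat (Suc k)"

text \<open>There is no division by k + 1 as in \<open>create_coeff\<close>: in the basis
  \<open>ket\<close> the mode a(n) is n times the elementary annihilation operator, which cancels
  the 1/n of \<open>Y_plus\<close>, while a(-n) is the elementary creation operator.\<close>

definition annih_coeff :: "complex \<Rightarrow> complex \<Rightarrow> nat \<Rightarrow> complex" where
  "annih_coeff \<alpha> \<zeta> k = - \<alpha> * exp (- of_nat (Suc k) * \<zeta>)"

definition annih_elt :: "(nat \<Rightarrow> complex) \<Rightarrow> nat multiset \<Rightarrow> nat multiset \<Rightarrow> complex" where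
  "annih_elt B l m = (\<Prod>k\<in>set_mset l \<union> set_mset m. of_nat (count m k choose count l k) * B k ^ (count m k - count l k))"

text \<open>The matrix of an exponential of creation operators from \<open>j\<close> to
  \<open>l\<close>, but only for \<open>j\<close> contained in \<open>l\<close>. Elsewhere truncated
  subtraction gives values that need not be 0, so sums over \<open>j\<close> are restricted
  explicitly; \<open>annih_elt\<close> vanishes by itself through its binomial coefficients.\<close>

definition create_elt :: "(nat \<Rightarrow> complex) \<Rightarrow> nat multiset \<Rightarrow> nat multiset \<Rightarrow> complex" where
  "create_elt A l j = (\<Prod>k\<in>set_mset l \<union> set_mset j. A k ^ (count l k - count j k) / fact (count l k - count j k))"

lemma annih_elt_eq_prod:
  assumes "finite F" "set_mset l \<subseteq> F" "set_mset m \<subseteq> F"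
  shows "annih_elt B l m = (\<Prod>k\<in>F. of_nat (count m k choose count l k) * B k ^ (count m k - count l k))"
  unfolding annih_elt_def using assms
  by (intro prod.mono_neutral_left) (auto simp: not_in_iff)

lemma create_elt_eq_prod:
  assumes "finite F" "set_mset l \<subseteq> F" "set_mset j \<subseteq> F"
  shows "create_elt A l j = (\<Prod>k\<in>F. A k ^ (count l k - count j k) / fact (count l k - count j k))"
  unfolding create_elt_def using assms
  by (intro prod.mono_neutral_left) (auto simp: not_in_iff)

lemma annih_elt_eq_0: "\<not> l \<subseteq># m \<Longrightarrow> annih_elt B l m = 0"
proof -
  assume "\<not> l \<subseteq># m"
  then obtain k where k: "count m k < count l k" by (auto simp: subseteq_mset_def not_le)
  then have "k \<in># l" by (metis count_eq_zero_iff not_less0)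
  then show ?thesis unfolding annih_elt_def using k
    by (intro prod_zero) (auto intro!: bexI[of _ k] simp: binomial_eq_0)
qed

lemma annih_elt_self: "annih_elt B m m = 1"
  by (simp add: annih_elt_def)

lemma create_elt_self: "create_elt B m m = 1"
  by (simp add: create_elt_def)

text \<open>Summed over n, the differences on the right add up to size m - size l when l is
  contained in m. This produces the factorial in the powers of the exponent of
  \<open>Y_plus\<close>.\<close>

lemma annih_elt_step:
  "of_nat (Suc (count l n)) * (B n * annih_elt B (add_mset n l) m) = of_nat (count m n - count l n) * annih_elt B l m"
proof -
  let ?F = "insert n (set_mset l \<union> set_mset m)"
  let ?f = "\<lambda>l k. of_nat (count m k choose count l k) * B k ^ (count m k - count l k)"
  have "annih_elt B (add_mset n l) m = ?f (add_mset n l) n * (\<Prod>k\<in>?F - {n}. ?f (add_mset n l) k)"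
    by (subst annih_elt_eq_prod[of ?F]) (auto simp: prod.remove[of ?F n])
  also have "(\<Prod>k\<in>?F - {n}. ?f (add_mset n l) k) = (\<Prod>k\<in>?F - {n}. ?f l k)"
    by (intro prod.cong) auto
  finally have 1: "annih_elt B (add_mset n l) m = ?f (add_mset n l) n * (\<Prod>k\<in>?F - {n}. ?f l k)" .
  have 2: "annih_elt B l m = ?f l n * (\<Prod>k\<in>?F - {n}. ?f l k)"
    by (subst annih_elt_eq_prod[of ?F]) (auto simp: prod.remove[of ?F n])
  have "Suc (count l n) * (count m n choose Suc (count l n)) = (count m n - count l n) * (count m n choose count l n)"
    by (metis binomial_absorb_comp binomial_absorption mult.commute)
  then have *: "of_nat (Suc (count l n)) * of_nat (count m n choose Suc (count l n))
      = (of_nat (count m n - count l n) * of_nat (count m n choose count l n) :: complex)"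
    by (metis of_nat_mult)
  have 3: "of_nat (Suc (count l n)) * (B n * ?f (add_mset n l) n) = of_nat (count m n - count l n) * ?f l n"
  proof (cases "count l n < count m n")
    case True
    then have "count m n - count l n = Suc (count m n - Suc (count l n))" by simp
    then show ?thesis using * by (simp add: algebra_simps del: of_nat_Suc)
  next
    case False
    then show ?thesis by (simp add: binomial_eq_0)
  qed
  then show ?thesis unfolding 1 2 using 3 by (simp only: mult.assoc[symmetric])
qed

lemma create_elt_step:
  assumes "count j n < count l n"
  shows "A n * create_elt A (l - {#n#}) j = of_nat (count l n - count j n) * create_elt A l j"
proof -
  let ?F = "insert n (set_mset l \<union> set_mset j)"
  let ?f = "\<lambda>l k. A k ^ (count l k - count j k) / fact (count l k - count j k)"
  have "create_elt A (l - {#n#}) j = ?f (l - {#n#}) n * (\<Prod>k\<in>?F - {n}. ?f (l - {#n#}) k)"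
    by (subst create_elt_eq_prod[of ?F]) (auto simp: prod.remove[of ?F n] dest: in_diffD)
  also have "(\<Prod>k\<in>?F - {n}. ?f (l - {#n#}) k) = (\<Prod>k\<in>?F - {n}. ?f l k)"
    by (intro prod.cong) auto
  finally have 1: "create_elt A (l - {#n#}) j = ?f (l - {#n#}) n * (\<Prod>k\<in>?F - {n}. ?f l k)" .
  have 2: "create_elt A l j = ?f l n * (\<Prod>k\<in>?F - {n}. ?f l k)"
    by (subst create_elt_eq_prod[of ?F]) (auto simp: prod.remove[of ?F n])
  obtain d where d: "count l n = count j n + Suc d" using assms less_iff_Suc_add by auto
  have 3: "A n * ?f (l - {#n#}) n = of_nat (count l n - count j n) * ?f l n"
    unfolding d by (simp add: d fact_Suc field_simps del: of_nat_Suc)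
  then show ?thesis unfolding 1 2 using 3 by (simp only: mult.assoc[symmetric])
qed

lemma heis_pos: "heis (int (Suc n)) v (\<beta>, l) = of_nat (Suc n) * of_nat (Suc (count l n)) * v (\<beta>, add_mset n l)"
proof -
  have "nat (1 + int n) - Suc 0 = n" by simp
  then show ?thesis by simp
qed

lemma heis_neg: "heis (- int (Suc n)) v (\<beta>, l) = (if n \<in># l then v (\<beta>, l - {#n#}) else 0)"
proof -
  have "nat (1 + int n) - Suc 0 = n" "nat (int n + 1) - Suc 0 = n" by simp_all
  then show ?thesis by simp
qed

lemma sum_count_diff: "(\<Sum>n\<in>set_mset m. count m n - count l n) = size (m - l)"
proof -
  have "(\<Sum>n\<in>set_mset m. count m n - count l n) = (\<Sum>n\<in>set_mset (m - l). count (m - l) n)"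
    by (rule sum.mono_neutral_cong_right) (auto simp: in_diff_count dest: in_diffD)
  then show ?thesis by (simp only: size_multiset_overloaded_eq)
qed

text \<open>Each application of the exponent removes exactly one quantum, so a given entry is
  reached by a single term of the exponential series. The scalar \<open>c\<close> takes up the
  eigenvalue of \<open>exp_a0\<close>, which acts before.\<close>

lemma Y_plus_ket:
  "Y_plus \<alpha> \<zeta> (\<lambda>b. c * ket (\<beta>, m) b) (\<beta>', l) =
    (if \<beta>' = \<beta> then c * annih_elt (annih_coeff \<alpha> \<zeta>) l m else 0)"
proof -
  let ?B = "annih_coeff \<alpha> \<zeta>"
  define A where "A = (\<lambda>v b. - \<alpha> * (\<Sum>n. heis (int (Suc n)) v b / of_nat (Suc n) * exp (- of_nat (Suc n) * \<zeta>)))"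
  \<comment> \<open>Closed form of the k-th power of the exponent; its k! cancels the factorial in
    \<open>op_exp\<close>.\<close>
  define R where "R = (\<lambda>k (\<beta>', l). if \<beta>' = \<beta> \<and> size m = size l + k then c * fact k * annih_elt ?B l m else 0)"
  have R: "R k (\<beta>', l) = (if \<beta>' = \<beta> \<and> size m = size l + k then c * fact k * annih_elt ?B l m else 0)" for k \<beta>' l
    by (simp add: R_def)
  have pow: "(A ^^ k) (\<lambda>b. c * ket (\<beta>, m) b) = R k" for k
  proof (induction k)
    case 0
    have "annih_elt ?B l m = (if l = m then 1 else 0)" if "size m = size l" for l
      using that annih_elt_eq_0[of l m] annih_elt_self
      by (metis mset_subset_size order_less_irrefl subset_mset.le_imp_less_or_eq)
    then show ?case by (auto simp: ket_def R_def)
  next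
    case (Suc k)
    have *: "A (R k) (\<beta>', l) = R (Suc k) (\<beta>', l)" for \<beta>' l
    proof (cases "\<beta>' = \<beta> \<and> size m = size l + Suc k")
      case True
      let ?u = "\<lambda>n. of_nat (Suc (count l n)) * (c * fact k * annih_elt ?B (add_mset n l) m) * exp (- of_nat (Suc n) * \<zeta>)"
      have "(\<Sum>n. heis (int (Suc n)) (R k) (\<beta>', l) / of_nat (Suc n) * exp (- of_nat (Suc n) * \<zeta>))
          = (\<Sum>n. ?u n)"
        unfolding heis_pos R using True by (intro suminf_cong) (simp del: of_nat_Suc)
      also have "\<dots> = (\<Sum>n\<in>set_mset m. ?u n)"
      proof (rule suminf_finite)
        fix n assume "n \<notin> set_mset m"
        then have "\<not> add_mset n l \<subseteq># m" by (meson mset_subset_eqD union_single_eq_member)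
        then show "?u n = 0" by (simp add: annih_elt_eq_0)
      qed auto
      finally have "A (R k) (\<beta>', l) = (\<Sum>n\<in>set_mset m. c * fact k *
          (of_nat (Suc (count l n)) * (?B n * annih_elt ?B (add_mset n l) m)))"
        unfolding A_def by (simp add: annih_coeff_def sum_distrib_left mult_ac del: of_nat_Suc heis.simps)
      also have "\<dots> = c * fact k * (of_nat (\<Sum>n\<in>set_mset m. count m n - count l n) * annih_elt ?B l m)"
        by (simp only: annih_elt_step sum_distrib_left sum_distrib_right of_nat_sum)
      also have "\<dots> = R (Suc k) (\<beta>', l)"
      proof (cases "l \<subseteq># m")
        case sub: True
        have "(\<Sum>n\<in>set_mset m. count m n - count l n) = size m - size l"
          unfolding sum_count_diff using sub by (rule size_Diff_submset)
        then show ?thesis using True by (simp add: R algebra_simps del: of_nat_sum)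
      qed (simp add: R annih_elt_eq_0)
      finally show ?thesis .
    next
      case False
      then have "heis (int (Suc n)) (R k) (\<beta>', l) = 0" for n unfolding heis_pos R by auto
      then show ?thesis using False by (auto simp: A_def R simp del: heis.simps)
    qed
    have "A (R k) = R (Suc k)" by (rule ext) (metis * surj_pair)
    then show ?case by (simp only: funpow.simps comp_apply Suc)
  qed
  have "Y_plus \<alpha> \<zeta> (\<lambda>b. c * ket (\<beta>, m) b) (\<beta>', l) = (\<Sum>k. R k (\<beta>', l) / fact k)"
    unfolding Y_plus_def op_exp_def pow[symmetric] A_def ..
  also have "\<dots> = (\<Sum>k\<in>{size m - size l}. R k (\<beta>', l) / fact k)"
    by (rule suminf_finite) (auto simp: R)
  also have "\<dots> = (if \<beta>' = \<beta> then c * annih_elt ?B l m else 0)"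
  proof (cases "l \<subseteq># m")
    case True
    then show ?thesis using size_mset_mono[OF True] by (auto simp: R)
  qed (auto simp: R annih_elt_eq_0)
  finally show ?thesis .
qed

lemma finite_submultisets: "finite {j. j \<subseteq># (l :: 'a multiset)}"
proof (induction l)
  case (add x l)
  have "{j. j \<subseteq># add_mset x l} \<subseteq> {j. j \<subseteq># l} \<union> add_mset x ` {j. j \<subseteq># l}"
  proof
    fix j assume "j \<in> {j. j \<subseteq># add_mset x l}"
    then have j: "j \<subseteq># add_mset x l" by simp
    show "j \<in> {j. j \<subseteq># l} \<union> add_mset x ` {j. j \<subseteq># l}"
    proof (cases "x \<in># j")
      case True
      then obtain j' where "j = add_mset x j'" by (metis insert_DiffM)
      then show ?thesis using j by auto
    next
      case False
      have "count j k \<le> count l k" for k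
        using False j by (cases "k = x") (auto simp: subseteq_mset_def not_in_iff dest: spec[of _ k])
      then have "j \<subseteq># l" by (simp add: subseteq_mset_def)
      then show ?thesis by auto
    qed
  qed
  then show ?case using add finite_subset by blast
qed simp

text \<open>Creation operators reach \<open>l\<close> only from its finitely many sub-multisets, so
  an arbitrary state \<open>v\<close> can be treated directly, whereas the annihilation part is
  evaluated on basis vectors.\<close>

lemma Y_minus_apply:
  "Y_minus \<alpha> \<zeta> v (\<beta>, l) = (\<Sum>j | j \<subseteq># l. create_elt (create_coeff \<alpha> \<zeta>) l j * v (\<beta>, j))"
proof -
  let ?C = "create_coeff \<alpha> \<zeta>"
  define A where "A = (\<lambda>v b. \<alpha> * (\<Sum>n. heis (- int (Suc n)) v b / of_nat (Suc n) * exp (of_nat (Suc n) * \<zeta>)))"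
  define R where "R = (\<lambda>k (\<beta>, l). fact k * (\<Sum>j | j \<subseteq># l \<and> size l = size j + k. create_elt ?C l j * v (\<beta>, j)))"
  have R: "R k (\<beta>, l) = fact k * (\<Sum>j | j \<subseteq># l \<and> size l = size j + k. create_elt ?C l j * v (\<beta>, j))" for k \<beta> l
    by (simp add: R_def)
  have fin: "finite {j. j \<subseteq># l \<and> P j}" for l :: "nat multiset" and P
    using finite_submultisets[of l] by auto
  have A_apply: "A u (\<beta>, l) = (\<Sum>n\<in>set_mset l. ?C n * u (\<beta>, l - {#n#}))" for u \<beta> l
  proof -
    have "(\<Sum>n. heis (- int (Suc n)) u (\<beta>, l) / of_nat (Suc n) * exp (of_nat (Suc n) * \<zeta>))
       = (\<Sum>n\<in>set_mset l. heis (- int (Suc n)) u (\<beta>, l) / of_nat (Suc n) * exp (of_nat (Suc n) * \<zeta>))"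
      by (rule suminf_finite) (auto simp only: heis_neg if_False div_0 mult_zero_left finite_set_mset)
    then show ?thesis
      unfolding A_def heis_neg
      by (auto intro!: sum.cong simp: create_coeff_def sum_distrib_left mult_ac simp del: of_nat_Suc)
  qed
  have pow: "(A ^^ k) v = R k" for k
  proof (induction k)
    case 0
    have "{j. j \<subseteq># l \<and> size l = size j} = {l}" for l :: "nat multiset"
      by (auto dest: mset_subset_size simp: subset_mset.le_less)
    then show ?case by (auto simp: create_elt_self R_def)
  next
    case (Suc k)
    have *: "A (R k) (\<beta>, l) = R (Suc k) (\<beta>, l)" for \<beta> l
    proof -
      let ?t = "\<lambda>n j. fact k * (of_nat (count l n - count j n) * create_elt ?C l j * v (\<beta>, j))"
      let ?J = "{j. j \<subseteq># l \<and> size l = size j + Suc k}"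
      have "A (R k) (\<beta>, l) = (\<Sum>n\<in>set_mset l. \<Sum>j\<in>?J. if count j n < count l n
          then ?t n j else 0)"
        unfolding A_apply
      proof (rule sum.cong[OF refl])
        fix n assume n: "n \<in># l"
        have "?C n * R k (\<beta>, l - {#n#}) = (\<Sum>j | j \<subseteq># l - {#n#} \<and> size (l - {#n#}) = size j + k.
            fact k * (?C n * create_elt ?C (l - {#n#}) j * v (\<beta>, j)))"
          by (simp add: R sum_distrib_left mult_ac)
        also have "\<dots> = (\<Sum>j | j \<in> ?J \<and> count j n < count l n.
            ?t n j)"
        proof (rule sum.cong)
          \<comment> \<open>Membership below l with one n removed means a spare n, which is the
            condition under which \<open>create_elt_step\<close> holds.\<close>
          have sub: "j \<subseteq># l - {#n#} \<longleftrightarrow> j \<subseteq># l \<and> count j n < count l n" for j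
          proof -
            have "j \<subseteq># l - {#n#} \<longleftrightarrow> add_mset n j \<subseteq># l"
              using n by (simp add: insert_subset_eq_iff)
            also have "\<dots> \<longleftrightarrow> j \<subseteq># l \<and> count j n < count l n"
              unfolding subseteq_mset_def by (auto simp: Suc_le_eq split: if_splits intro: order.strict_implies_order)
            finally show ?thesis .
          qed
          have sz: "size (l - {#n#}) = i + k \<longleftrightarrow> size l = i + Suc k" for i
            using n size_Suc_Diff1[OF n] by linarith
          show "{j. j \<subseteq># l - {#n#} \<and> size (l - {#n#}) = size j + k} = {j. j \<in> ?J \<and> count j n < count l n}"
            unfolding sub sz by blast
        next
          fix j assume "j \<in> {j. j \<in> ?J \<and> count j n < count l n}"
          then show "fact k * (?C n * create_elt ?C (l - {#n#}) j * v (\<beta>, j)) =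
              ?t n j"
            by (subst create_elt_step) auto
        qed
        also have "\<dots> = (\<Sum>j\<in>?J. if count j n < count l n
          then ?t n j else 0)"
          using fin by (subst sum.inter_filter[symmetric]) (auto intro!: sum.cong)
        finally show "?C n * R k (\<beta>, l - {#n#}) = (\<Sum>j\<in>?J. if count j n < count l n
          then ?t n j else 0)" .
      qed
      also have "\<dots> = (\<Sum>j\<in>?J. \<Sum>n\<in>set_mset l. ?t n j)"
        by (subst sum.swap) (intro sum.cong, auto)
      also have "\<dots> = (\<Sum>j\<in>?J. fact k * (of_nat (\<Sum>n\<in>set_mset l. count l n - count j n) * create_elt ?C l j * v (\<beta>, j)))"
        by (simp only: sum_distrib_left sum_distrib_right of_nat_sum)
      also have "\<dots> = (\<Sum>j\<in>?J. fact k * (of_nat (Suc k) * create_elt ?C l j * v (\<beta>, j)))"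
      proof (rule sum.cong[OF refl])
        fix j assume j: "j \<in> ?J"
        have "(\<Sum>n\<in>set_mset l. count l n - count j n) = Suc k"
          unfolding sum_count_diff using j by (simp add: size_Diff_submset)
        then show "fact k * (of_nat (\<Sum>n\<in>set_mset l. count l n - count j n) * create_elt ?C l j * v (\<beta>, j))
           = fact k * (of_nat (Suc k) * create_elt ?C l j * v (\<beta>, j))" by simp
      qed
      also have "\<dots> = R (Suc k) (\<beta>, l)" by (simp add: R sum_distrib_left algebra_simps)
      finally show ?thesis .
    qed
    have "A (R k) = R (Suc k)" by (rule ext) (metis * surj_pair)
    then show ?case by (simp only: funpow.simps comp_apply Suc)
  qed
  have "Y_minus \<alpha> \<zeta> v (\<beta>, l) = (\<Sum>k. R k (\<beta>, l) / fact k)"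
    unfolding Y_minus_def op_exp_def pow[symmetric] A_def ..
  also have "\<dots> = (\<Sum>k\<le>size l. R k (\<beta>, l) / fact k)"
  proof (rule suminf_finite)
    fix k assume "k \<notin> {..size l}"
    then have "{j. j \<subseteq># l \<and> size l = size j + k} = {}" by auto
    then show "R k (\<beta>, l) / fact k = 0" unfolding R by (simp only: sum.empty mult_zero_right div_0)
  qed auto
  \<comment> \<open>Each j occurs for exactly one power k, the difference in size, so grouping by k
    exhausts all sub-multisets once.\<close>
  also have "\<dots> = (\<Sum>k\<le>size l. \<Sum>j | j \<in> {j. j \<subseteq># l} \<and> size l - size j = k. create_elt ?C l j * v (\<beta>, j))"
  proof (intro sum.cong refl)
    fix k assume "k \<in> {..size l}"
    have "{j. j \<subseteq># l \<and> size l = size j + k} = {j. j \<in> {j. j \<subseteq># l} \<and> size l - size j = k}"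
      by (auto dest: size_mset_mono)
    then show "R k (\<beta>, l) / fact k = (\<Sum>j | j \<in> {j. j \<subseteq># l} \<and> size l - size j = k. create_elt ?C l j * v (\<beta>, j))"
      by (simp add: R)
  qed
  also have "\<dots> = (\<Sum>j | j \<subseteq># l. create_elt ?C l j * v (\<beta>, j))"
    by (rule sum.group) (auto intro: finite_submultisets)
  finally show ?thesis .
qed

text \<open>The sum over the intermediate state factorises over modes into the sums defining
  \<open>mode_kernel\<close>. The cut-off in \<open>?g\<close> encodes that j is contained in l,
  because \<open>create_elt\<close> need not vanish elsewhere.\<close>

lemma create_annih_sum: "(\<Sum>j | j \<subseteq># l. create_elt A l j * annih_elt B j m) = fock_kernel A B l m"
proof -
  let ?g = "\<lambda>k c. if c \<le> count l k then A k ^ (count l k - c) / fact (count l k - c) *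
      (of_nat (count m k choose c) * B k ^ (count m k - c)) else 0"
  obtain K where K: "set_mset l \<subseteq> {..<K}" "set_mset m \<subseteq> {..<K}" by (rule mset_bound)
  have g: "(?g k has_sum mode_kernel (A k) (B k) (count l k) (count m k)) UNIV" for k
    unfolding mode_kernel_def by (rule has_sum_finite_neutralI[of "{..count l k}"]) auto
  have g_abs: "(\<lambda>c. norm (?g k c)) summable_on UNIV" for k
    by (rule finite_nonzero_values_imp_summable_on) (auto intro: finite_subset[of _ "{..count l k}"])
  have "((\<lambda>j. \<Prod>k<K. ?g k (count j k)) has_sum (\<Prod>k<K. mode_kernel (A k) (B k) (count l k) (count m k)))
      {j. set_mset j \<subseteq> {..<K}}"
    using conjunct2[OF prod_count_has_sum_bounded[of ?g "\<lambda>k. mode_kernel (A k) (B k) (count l k) (count m k)" K, OF g g_abs]] .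
  moreover have "((\<lambda>j. \<Prod>k<K. ?g k (count j k)) has_sum (\<Sum>j | j \<subseteq># l. create_elt A l j * annih_elt B j m))
      {j. set_mset j \<subseteq> {..<K}}"
  proof (rule has_sum_finite_neutralI[of "{j. j \<subseteq># l}"])
    show "{j. j \<subseteq># l} \<subseteq> {j. set_mset j \<subseteq> {..<K}}" using K(1) set_mset_mono by fastforce
    fix j assume j: "j \<in> {j. set_mset j \<subseteq> {..<K}} - {j. j \<subseteq># l}"
    then obtain k where "\<not> count j k \<le> count l k" by (auto simp: subseteq_mset_def)
    moreover from this have "k \<in># j" by (metis count_greater_zero_iff le0 not_le order_le_less_trans)
    ultimately show "(\<Prod>k<K. ?g k (count j k)) = 0" using j by (intro prod_zero) auto
  next
    have "create_elt A l j * annih_elt B j m = (\<Prod>k<K. ?g k (count j k))" if "j \<subseteq># l" for j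
    proof -
      have "set_mset j \<subseteq> {..<K}" using K(1) set_mset_mono[OF that] by blast
      then show ?thesis using K that
        by (simp add: create_elt_eq_prod[of "{..<K}"] annih_elt_eq_prod[of "{..<K}"] subseteq_mset_def flip: prod.distrib)
    qed
    then show "(\<Sum>j | j \<subseteq># l. create_elt A l j * annih_elt B j m) = (\<Sum>j | j \<subseteq># l. \<Prod>k<K. ?g k (count j k))"
      by (intro sum.cong) auto
  qed (rule finite_submultisets)
  ultimately have "(\<Sum>j | j \<subseteq># l. create_elt A l j * annih_elt B j m) =
      (\<Prod>k<K. mode_kernel (A k) (B k) (count l k) (count m k))"
    using has_sum_unique by blast
  also have "\<dots> = fock_kernel A B l m"
    by (rule fock_kernel_eq_prod[OF _ K, symmetric]) simp
  finally show ?thesis .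
qed

lemma L0_apply: "L0 v (\<beta>, l) = (\<beta>\<^sup>2 / 2 + of_nat (energy l)) * v (\<beta>, l)"
  unfolding L0_coeff energy_def ..

lemma exp_L0_apply: "exp_L0 t v (\<beta>, l) = exp (t * (\<beta>\<^sup>2 / 2 + of_nat (energy l))) * v (\<beta>, l)"
proof -
  let ?e = "\<beta>\<^sup>2 / 2 + of_nat (energy l)"
  have "((\<lambda>v b. t * L0 v b) ^^ k) v (\<beta>, l) = (t * ?e) ^ k * v (\<beta>, l)" for k
    by (induction k) (simp_all add: L0_apply algebra_simps)
  moreover have "(\<lambda>k. (t * ?e) ^ k * v (\<beta>, l) / fact k) sums (exp (t * ?e) * v (\<beta>, l))"
    using sums_mult2[OF exp_converges[of "t * ?e"], of "v (\<beta>, l)"]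
    by (simp add: scaleR_conv_of_real field_simps)
  ultimately show ?thesis by (simp add: exp_L0_def op_exp_def sums_iff)
qed

lemma qtau_apply:
  "qtau \<tau> v (\<beta>, l) = exp (2 * of_real pi * \<i> * \<tau> * (\<beta>\<^sup>2 / 2 + of_nat (energy l) - 1 / 24)) * v (\<beta>, l)"
proof -
  let ?c = "2 * of_real pi * \<i> * \<tau>" and ?e = "\<beta>\<^sup>2 / 2 + of_nat (energy l) - 1 / 24"
  have "((\<lambda>v b. ?c * (L0 v b - v b / 24)) ^^ k) v (\<beta>, l) = (?c * ?e) ^ k * v (\<beta>, l)" for k
    by (induction k) (simp_all add: L0_apply algebra_simps)
  moreover have "(\<lambda>k. (?c * ?e) ^ k * v (\<beta>, l) / fact k) sums (exp (?c * ?e) * v (\<beta>, l))"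
    using sums_mult2[OF exp_converges[of "?c * ?e"], of "v (\<beta>, l)"]
    by (simp add: scaleR_conv_of_real field_simps)
  ultimately show ?thesis by (simp add: qtau_def op_exp_def sums_iff)
qed

text \<open>The exponent collects \<alpha>^2 / 2, the L(0)-weight of the inserted vector, and
  \<alpha> \<beta>', the eigenvalue of \<alpha> a(0) on the incoming charge.\<close>

proposition vop_matrix:
  "vop (exp_L0 \<zeta> (evec \<alpha>)) \<zeta> (ket (\<beta>', m)) (\<beta>, l) =
    (if \<beta> = \<beta>' + \<alpha> then exp (\<zeta> * \<alpha>\<^sup>2 / 2 + \<zeta> * \<alpha> * \<beta>') *
      fock_kernel (create_coeff \<alpha> \<zeta>) (annih_coeff \<alpha> \<zeta>) l m else 0)"
proof -
  have u: "exp_L0 \<zeta> (evec \<alpha>) = (\<lambda>b. exp (\<zeta> * \<alpha>\<^sup>2 / 2) * evec \<alpha> b)"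
    by (auto simp: fun_eq_iff exp_L0_apply evec_def ket_def energy_def)
  then have supp: "supp (exp_L0 \<zeta> (evec \<alpha>)) = {(\<alpha>, {#})}"
    by (auto simp: supp_def evec_def ket_def)
  have ev: "evec \<alpha> (\<alpha>, {#}) = 1" by (simp add: evec_def ket_def)
  have e: "exp_a0 (\<zeta> * \<alpha>) (ket (\<beta>', m)) = (\<lambda>b. exp (\<zeta> * \<alpha> * \<beta>') * ket (\<beta>', m) b)"
    by (auto simp: fun_eq_iff exp_a0_apply ket_def)
  have "vop (exp_L0 \<zeta> (evec \<alpha>)) \<zeta> (ket (\<beta>', m)) (\<beta>, l) = exp (\<zeta> * \<alpha>\<^sup>2 / 2) *
      (\<Sum>j | j \<subseteq># l. create_elt (create_coeff \<alpha> \<zeta>) l j *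
        (if \<beta> - \<alpha> = \<beta>' then exp (\<zeta> * \<alpha> * \<beta>') * annih_elt (annih_coeff \<alpha> \<zeta>) j m else 0))"
    unfolding vop_def supp unfolding u by (simp add: ev e shift_charge_def Y_minus_apply Y_plus_ket)
  also have "\<dots> = (if \<beta> = \<beta>' + \<alpha> then exp (\<zeta> * \<alpha>\<^sup>2 / 2) * exp (\<zeta> * \<alpha> * \<beta>') *
      (\<Sum>j | j \<subseteq># l. create_elt (create_coeff \<alpha> \<zeta>) l j * annih_elt (annih_coeff \<alpha> \<zeta>) j m) else 0)"
    by (auto simp: sum_distrib_left algebra_simps)
  finally show ?thesis by (simp add: create_annih_sum exp_add)
qed

section \<open>Sums over closed paths\<close>

definition path_prod :: "('b \<Rightarrow> 'b \<Rightarrow> 'a :: comm_monoid_mult) list \<Rightarrow> 'b list \<Rightarrow> 'a" where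
  "path_prod Ks p = (\<Prod>i<length Ks. (Ks ! i) (p ! i) (p ! Suc i))"

definition paths :: "nat \<Rightarrow> 'b \<Rightarrow> 'b \<Rightarrow> 'b list set" where
  "paths N b b' = {p. length p = Suc N \<and> p ! 0 = b \<and> p ! N = b'}"

lemma path_prod_Cons: "path_prod (K # Ks) (b # p) = K b (p ! 0) * path_prod Ks p"
  unfolding path_prod_def by (simp only: length_Cons prod.lessThan_Suc_shift) simp

lemma bij_betw_paths_Suc:
  "bij_betw (\<lambda>(b', p). b # p) (Sigma UNIV (\<lambda>b'. paths N b' b'')) (paths (Suc N) b b'')"
proof (rule bij_betw_byWitness[where f' = "\<lambda>p. (p ! 1, tl p)"])
  show "(\<lambda>p. (p ! 1, tl p)) ` paths (Suc N) b b'' \<subseteq> Sigma UNIV (\<lambda>b'. paths N b' b'')"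
    by (auto simp: paths_def nth_tl)
  show "\<forall>p\<in>paths (Suc N) b b''. (case (p ! 1, tl p) of (b', p) \<Rightarrow> b # p) = p"
    by (auto simp: paths_def length_Suc_conv)
qed (auto simp: paths_def)

lemma path_prod_has_sum_first:
  fixes Ks :: "('b \<Rightarrow> 'b \<Rightarrow> 'a :: real_normed_field) list"
  assumes "(path_prod Ks has_sum R) (paths N b' b'')"
  shows "((\<lambda>p. path_prod (K # Ks) (case (b', p) of (b', p) \<Rightarrow> b # p)) has_sum K b b' * R) (paths N b' b'')"
  by (rule has_sum_cong[THEN iffD1, OF _ has_sum_cmult_right[OF assms]]) (auto simp: path_prod_Cons paths_def)

text \<open>Fubini with the first intermediate vector summed last. For complex kernels iterated sums
  do not yield summability over all paths, hence the hypothesis \<open>sm\<close>; for nonnegative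
  kernels the next lemma derives it.\<close>

lemma path_prod_has_sum_Cons:
  fixes Ks :: "('b \<Rightarrow> 'b \<Rightarrow> 'a :: {real_normed_field, banach}) list"
  assumes R: "\<And>b'. (path_prod Ks has_sum R b') (paths N b' b'')"
    and S: "((\<lambda>b'. K b b' * R b') has_sum S) UNIV"
    and sm: "path_prod (K # Ks) summable_on paths (Suc N) b b''"
  shows "(path_prod (K # Ks) has_sum S) (paths (Suc N) b b'')"
proof -
  let ?f = "\<lambda>q. path_prod (K # Ks) (case q of (b', p) \<Rightarrow> b # p)"
  have "(?f has_sum S) (Sigma UNIV (\<lambda>b'. paths N b' b''))"
  proof (rule has_sum_SigmaI[OF _ S])
    show "((\<lambda>p. ?f (b', p)) has_sum K b b' * R b') (paths N b' b'')" for b'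
      by (rule path_prod_has_sum_first[OF R])
    show "?f summable_on Sigma UNIV (\<lambda>b'. paths N b' b'')"
      using sm unfolding summable_on_reindex_bij_betw[OF bij_betw_paths_Suc, of "path_prod (K # Ks)"] .
  qed
  then show ?thesis
    unfolding has_sum_reindex_bij_betw[OF bij_betw_paths_Suc, of "path_prod (K # Ks)"] .
qed

lemma path_prod_has_sum_Cons_nonneg:
  fixes Ks :: "('b \<Rightarrow> 'b \<Rightarrow> real) list"
  assumes R: "\<And>b'. (path_prod Ks has_sum R b') (paths N b' b'')"
    and S: "((\<lambda>b'. K b b' * R b') has_sum S) UNIV"
    and nn: "\<And>p. path_prod Ks p \<ge> 0" "\<And>b'. K b b' \<ge> 0"
  shows "(path_prod (K # Ks) has_sum S) (paths (Suc N) b b'')"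
proof (rule path_prod_has_sum_Cons[where R = R])
  let ?f = "\<lambda>q. path_prod (K # Ks) (case q of (b', p) \<Rightarrow> b # p)"
  have "?f summable_on Sigma UNIV (\<lambda>b'. paths N b' b'')"
  proof (rule summable_on_SigmaI)
    show "((\<lambda>p. ?f (b', p)) has_sum K b b' * R b') (paths N b' b'')" for b'
      by (rule path_prod_has_sum_first[OF R])
    show "(\<lambda>b'. K b b' * R b') summable_on UNIV" by (rule has_sum_imp_summable[OF S])
  qed (auto simp: path_prod_Cons nn)
  then show "path_prod (K # Ks) summable_on paths (Suc N) b b''"
    unfolding summable_on_reindex_bij_betw[OF bij_betw_paths_Suc, of "path_prod (K # Ks)"] .
qed (use R S in auto)

section \<open>Composition of charged normally ordered exponentials\<close>

datatype (plugins del: size) 'a vertex = Vertex (charge: complex) (zmode: "complex \<Rightarrow> 'a") (cre: "nat \<Rightarrow> 'a") (ann: "nat \<Rightarrow> 'a")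

definition vertex_kernel :: "'a vertex \<Rightarrow> fock_index \<Rightarrow> fock_index \<Rightarrow> 'a :: real_normed_field" where
  "vertex_kernel v = (\<lambda>(\<beta>, l) (\<beta>', m). if \<beta> = \<beta>' + charge v then zmode v \<beta>' * fock_kernel (cre v) (ann v) l m else 0)"

text \<open>The last factor of the scalar is the contraction, the cost of moving the annihilation
  part of \<open>v\<close> past the creation part of \<open>v'\<close>. \<open>zmode v\<close> sees
  the charge already raised by \<open>v'\<close>.\<close>

definition vcomp2 :: "'a vertex \<Rightarrow> 'a vertex \<Rightarrow> 'a :: {real_normed_field, banach} vertex" where
  "vcomp2 v v' = Vertex (charge v + charge v')
     (\<lambda>\<beta>. zmode v (\<beta> + charge v') * zmode v' \<beta> * exp (\<Sum>k. ann v k * cre v' k))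
     (\<lambda>k. cre v k + cre v' k) (\<lambda>k. ann v k + ann v' k)"

fun vcomp :: "'a vertex list \<Rightarrow> 'a :: {real_normed_field, banach} vertex" where
  "vcomp [] = Vertex 0 (\<lambda>_. 1) (\<lambda>_. 0) (\<lambda>_. 0)"
| "vcomp (v # vs) = vcomp2 v (vcomp vs)"

text \<open>Convergence of the contraction, as a condition on norms only so that it passes to the
  majorants \<open>norm_vertex\<close>.\<close>

definition contractive :: "('a :: real_normed_field) vertex \<Rightarrow> 'a vertex \<Rightarrow> bool" where
  "contractive v v' \<longleftrightarrow> summable (\<lambda>k. norm (ann v k) * norm (cre v' k))"

text \<open>The majorant is a real vertex that keeps the complex charges; for its sake the scalar
  type of \<open>vertex\<close> is left open.\<close>

definition norm_vertex :: "('a :: real_normed_field) vertex \<Rightarrow> real vertex" where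
  "norm_vertex v = Vertex (charge v) (\<lambda>\<beta>. norm (zmode v \<beta>)) (\<lambda>k. norm (cre v k)) (\<lambda>k. norm (ann v k))"

lemma norm_vertex_sel [simp]:
  "charge (norm_vertex v) = charge v" "zmode (norm_vertex v) \<beta> = norm (zmode v \<beta>)"
  "cre (norm_vertex v) k = norm (cre v k)" "ann (norm_vertex v) k = norm (ann v k)"
  by (simp_all add: norm_vertex_def)

text \<open>Conservation of charge leaves a single intermediate charge, so only the sum over
  multisets in \<open>fock_kernel_compose\<close> remains.\<close>

lemma vertex_compose:
  fixes v v' :: "'a :: {real_normed_field, banach} vertex"
  assumes "contractive v v'"
  shows "((\<lambda>b'. vertex_kernel v b b' * vertex_kernel v' b' b'') has_sum vertex_kernel (vcomp2 v v') b b'') UNIV"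
proof -
  obtain \<beta> l where b: "b = (\<beta>, l)" by force
  obtain \<beta>'' m where b'': "b'' = (\<beta>'', m)" by force
  let ?f = "\<lambda>b'. vertex_kernel v b b' * vertex_kernel v' b' b''"
  let ?S = "exp (\<Sum>k. ann v k * cre v' k) *
    fock_kernel (\<lambda>k. cre v k + cre v' k) (\<lambda>k. ann v k + ann v' k) l m"
  have sm: "summable (\<lambda>k. norm (ann v k * cre v' k))"
    using assms by (simp add: contractive_def norm_mult)
  have inj: "inj (Pair (\<beta>'' + charge v') :: nat multiset \<Rightarrow> fock_index)"
    by (auto intro: inj_onI)
  show ?thesis
  proof (cases "\<beta> = \<beta>'' + charge v' + charge v")
    case True
    have "((\<lambda>c. zmode v (\<beta>'' + charge v') * zmode v' \<beta>'' * (fock_kernel (cre v) (ann v) l c * fock_kernel (cre v') (ann v') c m))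
        has_sum zmode v (\<beta>'' + charge v') * zmode v' \<beta>'' * ?S) UNIV"
      by (intro has_sum_cmult_right fock_kernel_compose sm)
    also have "(\<lambda>c. zmode v (\<beta>'' + charge v') * zmode v' \<beta>'' * (fock_kernel (cre v) (ann v) l c * fock_kernel (cre v') (ann v') c m))
        = ?f \<circ> Pair (\<beta>'' + charge v')"
      using True by (auto simp: vertex_kernel_def b b'')
    finally have "(?f has_sum zmode v (\<beta>'' + charge v') * zmode v' \<beta>'' * ?S) (range (Pair (\<beta>'' + charge v')))"
      by (simp only: has_sum_reindex[OF inj])
    then have "(?f has_sum zmode v (\<beta>'' + charge v') * zmode v' \<beta>'' * ?S) UNIV"
      by (rule has_sum_cong_neutral[THEN iffD1, rotated -1]) (auto simp: vertex_kernel_def b b'' image_iff)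
    then show ?thesis using True by (simp add: vertex_kernel_def vcomp2_def b b'' algebra_simps)
  next
    case False
    then have "?f = (\<lambda>_. 0)" "vertex_kernel (vcomp2 v v') b b'' = 0"
      by (auto simp: vertex_kernel_def vcomp2_def b b'' fun_eq_iff algebra_simps)
    then show ?thesis by simp
  qed
qed

lemma charge_vcomp: "charge (vcomp vs) = (\<Sum>v\<leftarrow>vs. charge v)"
  by (induction vs) (auto simp: vcomp2_def)

lemma cre_vcomp: "cre (vcomp vs) k = (\<Sum>v\<leftarrow>vs. cre v k)"
  by (induction vs) (auto simp: vcomp2_def)

lemma ann_vcomp: "ann (vcomp vs) k = (\<Sum>v\<leftarrow>vs. ann v k)"
  by (induction vs) (auto simp: vcomp2_def)

lemma norm_sum_list_le: "norm (\<Sum>x\<leftarrow>xs. f x) \<le> (\<Sum>x\<leftarrow>xs. norm (f x))"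
  by (induction xs) (auto intro: order_trans[OF norm_triangle_ineq])

lemma summable_sum_list:
  fixes f :: "'b \<Rightarrow> nat \<Rightarrow> 'a :: real_normed_vector"
  assumes "\<And>x. x \<in> set xs \<Longrightarrow> summable (f x)"
  shows "summable (\<lambda>k. \<Sum>x\<leftarrow>xs. f x k)"
  using assms by (induction xs) (auto intro: summable_add)

lemma contractive_vcomp:
  fixes v :: "'a :: {real_normed_field, banach} vertex"
  assumes "\<And>v'. v' \<in> set vs \<Longrightarrow> contractive v v'"
  shows "contractive v (vcomp vs)"
  unfolding contractive_def
proof (rule summable_comparison_test')
  show "summable (\<lambda>k. \<Sum>v'\<leftarrow>vs. norm (ann v k) * norm (cre v' k))"
    using assms by (intro summable_sum_list) (auto simp: contractive_def)
  show "norm (norm (ann v k) * norm (cre (vcomp vs) k)) \<le> (\<Sum>v'\<leftarrow>vs. norm (ann v k) * norm (cre v' k))" for k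
    by (simp add: cre_vcomp sum_list_const_mult mult_left_mono norm_sum_list_le)
qed

lemma vertex_compose_vcomp:
  fixes v :: "'a :: {real_normed_field, banach} vertex"
  assumes "sorted_wrt contractive (v # vs)"
  shows "((\<lambda>b''. vertex_kernel v b b'' * (vertex_kernel (vcomp vs) b'' b' * d)) has_sum
    vertex_kernel (vcomp (v # vs)) b b' * d) UNIV"
  unfolding mult.assoc[symmetric] vcomp.simps using assms
  by (intro has_sum_cmult_left vertex_compose contractive_vcomp) auto

definition diag_kernel :: "('b \<Rightarrow> 'a) \<Rightarrow> 'b \<Rightarrow> 'b \<Rightarrow> 'a :: zero" where
  "diag_kernel d b b' = (if b = b' then d b' else 0)"

lemma paths_1: "paths (Suc 0) b b' = {[b, b']}"
  by (auto simp: paths_def length_Suc_conv)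

lemma vertex_kernel_vcomp_Nil: "vertex_kernel (vcomp []) b b' = (if b = b' then 1 else 0)"
  by (auto simp: vertex_kernel_def fock_kernel_zero_params split: prod.splits)

lemma diag_path_has_sum:
  "(path_prod [diag_kernel d] has_sum vertex_kernel (vcomp []) b b' * d b') (paths (Suc 0) b b')"
  by (rule has_sum_finiteI) (auto simp: paths_1 path_prod_def diag_kernel_def vertex_kernel_vcomp_Nil simp del: vcomp.simps)

lemma vertex_path_has_sum_nonneg:
  fixes vs :: "real vertex list"
  assumes "sorted_wrt contractive vs" "\<And>v b b'. v \<in> set vs \<Longrightarrow> vertex_kernel v b b' \<ge> 0" "\<And>b. d b \<ge> 0"
  shows "(path_prod (map vertex_kernel vs @ [diag_kernel d]) has_sum vertex_kernel (vcomp vs) b b' * d b')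
    (paths (Suc (length vs)) b b')"
  using assms(1,2)
proof (induction vs arbitrary: b)
  case Nil
  show ?case using diag_path_has_sum by simp
next
  case (Cons v vs)
  have "(path_prod (vertex_kernel v # map vertex_kernel vs @ [diag_kernel d]) has_sum
      vertex_kernel (vcomp (v # vs)) b b' * d b') (paths (Suc (Suc (length vs))) b b')"
  proof (rule path_prod_has_sum_Cons_nonneg)
    show "(path_prod (map vertex_kernel vs @ [diag_kernel d]) has_sum vertex_kernel (vcomp vs) b'' b' * d b')
       (paths (Suc (length vs)) b'' b')" for b''
      using Cons.prems by (intro Cons.IH) auto
    show "((\<lambda>b''. vertex_kernel v b b'' * (vertex_kernel (vcomp vs) b'' b' * d b')) has_sum
       vertex_kernel (vcomp (v # vs)) b b' * d b') UNIV"
      using Cons.prems by (intro vertex_compose_vcomp) simp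
    show "path_prod (map vertex_kernel vs @ [diag_kernel d]) p \<ge> 0" for p
      unfolding path_prod_def using Cons.prems assms(3)
      by (intro prod_nonneg) (auto simp: nth_append diag_kernel_def)
  qed (use Cons.prems in auto)
  then show ?case by simp
qed

lemma norm_vertex_kernel_le: "norm (vertex_kernel v b b') \<le> vertex_kernel (norm_vertex v) b b'"
  by (auto simp: vertex_kernel_def norm_mult split: prod.splits intro!: mult_left_mono)
    (simp add: norm_vertex_def norm_fock_kernel_le)

lemma norm_vertex_kernel_nonneg: "vertex_kernel (norm_vertex v) b b' \<ge> 0"
  using norm_vertex_kernel_le norm_ge_zero order_trans by blast

lemma norm_path_prod_le:
  fixes d :: "fock_index \<Rightarrow> 'a :: {real_normed_field, banach}"
  shows "norm (path_prod (map vertex_kernel vs @ [diag_kernel d]) p) \<le>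
   path_prod (map vertex_kernel (map norm_vertex vs) @ [diag_kernel (\<lambda>b. norm (d b))]) p"
proof -
  have "norm (path_prod (map vertex_kernel vs @ [diag_kernel d]) p) =
     (\<Prod>i<Suc (length vs). norm (((map vertex_kernel vs @ [diag_kernel d]) ! i) (p ! i) (p ! Suc i)))"
    by (simp add: path_prod_def prod_norm del: prod.lessThan_Suc)
  also have "\<dots> \<le> (\<Prod>i<Suc (length vs).
     ((map vertex_kernel (map norm_vertex vs) @ [diag_kernel (\<lambda>b. norm (d b))]) ! i) (p ! i) (p ! Suc i))"
    by (intro prod_mono) (auto simp: nth_append diag_kernel_def norm_vertex_kernel_le)
  finally show ?thesis by (simp add: path_prod_def del: prod.lessThan_Suc)
qed

lemma contractive_norm_vertex [simp]: "contractive (norm_vertex v) (norm_vertex v') \<longleftrightarrow> contractive v v'"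
  by (simp add: contractive_def)

lemma norm_vertex_path_has_sum:
  fixes vs :: "'a :: {real_normed_field, banach} vertex list"
  assumes "sorted_wrt contractive vs"
  shows "(path_prod (map vertex_kernel (map norm_vertex vs) @ [diag_kernel (\<lambda>b. norm (d b))]) has_sum
     vertex_kernel (vcomp (map norm_vertex vs)) b b' * norm (d b')) (paths (Suc (length vs)) b b')"
proof -
  have "vertex_kernel v b b' \<ge> 0" if "v \<in> set (map norm_vertex vs)" for v b b'
    using that by (auto simp: norm_vertex_kernel_nonneg)
  then show ?thesis
    using vertex_path_has_sum_nonneg[of "map norm_vertex vs" "\<lambda>b. norm (d b)" b b'] assms
    by (simp add: sorted_wrt_map)
qed

text \<open>The recursion is that of the nonnegative case, but summability over paths is inherited
  at each stage from the path sum of the majorants.\<close>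

lemma vertex_path_has_sum:
  fixes vs :: "'a :: {real_normed_field, banach} vertex list"
  assumes "sorted_wrt contractive vs"
  shows "(path_prod (map vertex_kernel vs @ [diag_kernel d]) has_sum vertex_kernel (vcomp vs) b b' * d b')
    (paths (Suc (length vs)) b b')"
  using assms
proof (induction vs arbitrary: b)
  case Nil
  show ?case using diag_path_has_sum by simp
next
  case (Cons v vs)
  have "(path_prod (vertex_kernel v # map vertex_kernel vs @ [diag_kernel d]) has_sum
      vertex_kernel (vcomp (v # vs)) b b' * d b') (paths (Suc (Suc (length vs))) b b')"
  proof (rule path_prod_has_sum_Cons)
    show "(path_prod (map vertex_kernel vs @ [diag_kernel d]) has_sum vertex_kernel (vcomp vs) b'' b' * d b')
       (paths (Suc (length vs)) b'' b')" for b''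
      using Cons.prems by (intro Cons.IH) auto
    show "((\<lambda>b''. vertex_kernel v b b'' * (vertex_kernel (vcomp vs) b'' b' * d b')) has_sum
       vertex_kernel (vcomp (v # vs)) b b' * d b') UNIV"
      using Cons.prems by (intro vertex_compose_vcomp) simp
    have "(\<lambda>p. norm (path_prod (map vertex_kernel (v # vs) @ [diag_kernel d]) p)) summable_on
        paths (Suc (length (v # vs))) b b'"
      by (rule Infinite_Sum.abs_summable_on_comparison_test'[OF has_sum_imp_summable[OF norm_vertex_path_has_sum[OF Cons.prems]]])
        (rule norm_path_prod_le)
    then show "path_prod (vertex_kernel v # map vertex_kernel vs @ [diag_kernel d]) summable_on
        paths (Suc (Suc (length vs))) b b'"
      using abs_summable_summable by simp
  qed
  then show ?case by simp
qed

lemma bij_betw_closed_paths: "bij_betw snd (Sigma S (\<lambda>b. paths N b b)) (closed_paths S N)"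
  by (rule bij_betw_byWitness[where f' = "\<lambda>p. (p ! 0, p)"]) (auto simp: paths_def closed_paths_def)

text \<open>The contractions in \<open>vcomp2\<close> do not depend on the charge. Passing to norms
  therefore changes the zero mode factor by a constant only, and the lattice sum of the majorant
  converges as soon as the original one does.\<close>

lemma zmode_norm_vcomp:
  fixes vs :: "'a :: {real_normed_field, banach} vertex list"
  shows "\<exists>C. \<forall>\<beta>. zmode (vcomp (map norm_vertex vs)) \<beta> = C * norm (zmode (vcomp vs) \<beta>)"
proof (induction vs)
  case (Cons v vs)
  then obtain C where C: "\<And>\<beta>. zmode (vcomp (map norm_vertex vs)) \<beta> = C * norm (zmode (vcomp vs) \<beta>)" by blast
  have ch: "charge (vcomp (map norm_vertex vs)) = charge (vcomp vs)"
    by (simp add: charge_vcomp comp_def)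
  let ?n = "norm (exp (\<Sum>k. ann v k * cre (vcomp vs) k))"
  show ?case
    by (rule exI[of _ "C * exp (\<Sum>k. norm (ann v k) * cre (vcomp (map norm_vertex vs)) k) / ?n"])
      (simp add: vcomp2_def C ch norm_mult)
qed simp

text \<open>Three nested sums: over paths with a fixed base point, over its occupation numbers, and
  over its charge. Neutrality lets a path return to its initial charge; \<open>tr\<close> makes the
  contractions across the trace converge.\<close>

lemma closed_vertex_path_has_sum:
  fixes vs :: "complex vertex list"
  assumes ctr: "sorted_wrt contractive vs"
    and charge: "(\<Sum>v\<leftarrow>vs. charge v) = 0"
    and q: "norm q < 1"
    and tr: "\<And>v v'. v \<in> set vs \<Longrightarrow> v' \<in> set vs \<Longrightarrow> summable (\<lambda>k. norm (cre v k) * norm (ann v' k) * norm q ^ Suc k)"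
    and \<Theta>: "((\<lambda>\<beta>. zmode (vcomp vs) \<beta> * g \<beta>) has_sum \<Theta>) S"
  shows "(path_prod (map vertex_kernel vs @ [diag_kernel (\<lambda>(\<beta>, l). g \<beta> * q ^ energy l)]) has_sum
      \<Theta> * (exp (\<Sum>k. cre (vcomp vs) k * ann (vcomp vs) k * q ^ Suc k / (1 - q ^ Suc k)) * partition_fn q))
      (closed_paths (S \<times> UNIV) (Suc (length vs)))"
proof -
  let ?d = "\<lambda>(\<beta>, l). g \<beta> * q ^ energy l"
  let ?Ks = "map vertex_kernel vs @ [diag_kernel ?d]"
  let ?nKs = "map vertex_kernel (map norm_vertex vs) @ [diag_kernel (\<lambda>b. norm (?d b))]"
  let ?nvs = "map norm_vertex vs"
  let ?N = "Suc (length vs)"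
  let ?P = "Sigma (S \<times> UNIV) (\<lambda>b. paths ?N b b)"
  let ?T = "exp (\<Sum>k. cre (vcomp vs) k * ann (vcomp vs) k * q ^ Suc k / (1 - q ^ Suc k)) * partition_fn q"
  let ?nT = "exp (\<Sum>k. cre (vcomp ?nvs) k * ann (vcomp ?nvs) k * norm q ^ Suc k / (1 - norm q ^ Suc k)) * partition_fn (norm q)"
  have ch: "charge (vcomp vs) = 0" "charge (vcomp ?nvs) = 0"
    using charge by (simp_all add: charge_vcomp comp_def)
  have smn: "summable (\<lambda>k. norm (cre (vcomp ?nvs) k * ann (vcomp ?nvs) k * norm q ^ Suc k))"
  proof -
    have "summable (\<lambda>k. \<Sum>v\<leftarrow>vs. \<Sum>v'\<leftarrow>vs. norm (cre v k) * norm (ann v' k) * norm q ^ Suc k)"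
      by (intro summable_sum_list tr)
    moreover have "cre (vcomp ?nvs) k * ann (vcomp ?nvs) k * norm q ^ Suc k =
       (\<Sum>v\<leftarrow>vs. \<Sum>v'\<leftarrow>vs. norm (cre v k) * norm (ann v' k) * norm q ^ Suc k)" for k
      by (simp only: cre_vcomp ann_vcomp map_map comp_def norm_vertex_sel sum_list_const_mult sum_list_mult_const)
    moreover have "cre (vcomp ?nvs) k \<ge> 0" "ann (vcomp ?nvs) k \<ge> 0" for k
      unfolding cre_vcomp ann_vcomp by (auto intro!: sum_list_nonneg)
    then have "norm (cre (vcomp ?nvs) k * ann (vcomp ?nvs) k * norm q ^ Suc k) =
       cre (vcomp ?nvs) k * ann (vcomp ?nvs) k * norm q ^ Suc k" for k
      by (simp add: abs_mult)
    ultimately show ?thesis by presburger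
  qed
  have sm: "summable (\<lambda>k. norm (cre (vcomp vs) k * ann (vcomp vs) k * q ^ Suc k))"
  proof (rule summable_comparison_test'[OF smn])
    fix k
    have "norm (cre (vcomp vs) k) \<le> cre (vcomp ?nvs) k" "norm (ann (vcomp vs) k) \<le> ann (vcomp ?nvs) k"
      unfolding cre_vcomp ann_vcomp map_map comp_def norm_vertex_sel by (rule norm_sum_list_le)+
    then have "norm (cre (vcomp vs) k) \<le> \<bar>cre (vcomp ?nvs) k\<bar>" "norm (ann (vcomp vs) k) \<le> \<bar>ann (vcomp ?nvs) k\<bar>"
      by linarith+
    then show "norm (norm (cre (vcomp vs) k * ann (vcomp vs) k * q ^ Suc k)) \<le>
       norm (cre (vcomp ?nvs) k * ann (vcomp ?nvs) k * norm q ^ Suc k)"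
      unfolding norm_mult norm_power real_norm_def abs_mult power_abs abs_norm_cancel by (intro mult_mono) auto
  qed
  obtain C where C: "\<And>\<beta>. zmode (vcomp ?nvs) \<beta> = C * norm (zmode (vcomp vs) \<beta>)"
    using zmode_norm_vcomp by blast
  have nS: "(\<lambda>\<beta>. zmode (vcomp ?nvs) \<beta> * norm (g \<beta>)) summable_on S"
  proof -
    have "(\<lambda>\<beta>. norm (zmode (vcomp vs) \<beta> * g \<beta>)) summable_on S"
      by (rule summable_on_iff_abs_summable_on_complex[THEN iffD1, OF has_sum_imp_summable[OF \<Theta>]])
    then have "(\<lambda>\<beta>. C * norm (zmode (vcomp vs) \<beta> * g \<beta>)) summable_on S"
      by (rule summable_on_cmult_right)
    then show ?thesis by (simp add: C norm_mult mult.assoc)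
  qed
  have nn: "vertex_kernel (vcomp ?nvs) b b * norm (?d b) \<ge> 0" for b
  proof -
    have "zmode (vcomp ?nvs) \<beta> \<ge> 0" for \<beta>
      by (induction vs arbitrary: \<beta>) (auto simp: vcomp2_def)
    then show ?thesis
      by (auto simp: vertex_kernel_def cre_vcomp ann_vcomp split: prod.splits
        intro!: mult_nonneg_nonneg fock_kernel_nonneg sum_list_nonneg)
  qed
  have nb: "(\<lambda>b. vertex_kernel (vcomp ?nvs) b b * norm (?d b)) summable_on S \<times> UNIV"
  proof (rule summable_on_SigmaI)
    show "((\<lambda>l. vertex_kernel (vcomp ?nvs) (\<beta>, l) (\<beta>, l) * norm (?d (\<beta>, l))) has_sum
       zmode (vcomp ?nvs) \<beta> * norm (g \<beta>) * ?nT) UNIV" for \<beta>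
      using has_sum_cmult_right[OF fock_kernel_trace[OF _ smn], of "zmode (vcomp ?nvs) \<beta> * norm (g \<beta>)"] q
      by (simp add: vertex_kernel_def ch norm_mult norm_power mult_ac)
    show "(\<lambda>\<beta>. zmode (vcomp ?nvs) \<beta> * norm (g \<beta>) * ?nT) summable_on S"
      by (rule summable_on_cmult_left[OF nS])
  qed (use nn in auto)
  have paths: "((\<lambda>p. (path_prod ?Ks \<circ> snd) (b, p)) has_sum vertex_kernel (vcomp vs) b b * ?d b) (paths ?N b b)" for b
    using vertex_path_has_sum[OF ctr, of ?d b b] by simp
  \<comment> \<open>For the majorant all terms are nonnegative, so iterated summation gives
    summability over all closed paths at once, and the complex terms are dominated by it.\<close>
  have sm_paths: "(path_prod ?Ks \<circ> snd) summable_on ?P"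
  proof -
    have "(path_prod ?nKs \<circ> snd) summable_on ?P"
    proof (rule summable_on_SigmaI[OF _ nb])
      show "((\<lambda>p. (path_prod ?nKs \<circ> snd) (b, p)) has_sum vertex_kernel (vcomp ?nvs) b b * norm (?d b)) (paths ?N b b)" for b
        using norm_vertex_path_has_sum[OF ctr, of ?d b b] by simp
      show "(path_prod ?nKs \<circ> snd) (b, p) \<ge> 0" for b p
        using order_trans[OF norm_ge_zero norm_path_prod_le[of vs ?d p]] by simp
    qed
    then have "(\<lambda>x. norm ((path_prod ?Ks \<circ> snd) x)) summable_on ?P"
      by (rule Infinite_Sum.abs_summable_on_comparison_test') (simp only: comp_apply norm_path_prod_le)
    then show ?thesis by (rule abs_summable_summable)
  qed
  have b: "((\<lambda>b. vertex_kernel (vcomp vs) b b * ?d b) has_sum \<Theta> * ?T) (S \<times> UNIV)"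
  proof (rule has_sum_SigmaI)
    show "((\<lambda>l. vertex_kernel (vcomp vs) (\<beta>, l) (\<beta>, l) * ?d (\<beta>, l)) has_sum
       zmode (vcomp vs) \<beta> * g \<beta> * ?T) UNIV" for \<beta>
      using has_sum_cmult_right[OF fock_kernel_trace[OF q sm], of "zmode (vcomp vs) \<beta> * g \<beta>"]
      by (simp add: vertex_kernel_def ch mult_ac)
    show "((\<lambda>\<beta>. zmode (vcomp vs) \<beta> * g \<beta> * ?T) has_sum \<Theta> * ?T) S"
      by (rule has_sum_cmult_left[OF \<Theta>])
    \<comment> \<open>Summability over the base points is read off backwards from summability over
      all closed paths.\<close>
    show "(\<lambda>b. vertex_kernel (vcomp vs) b b * ?d b) summable_on S \<times> UNIV"
      by (rule has_sum_imp_summable[OF has_sum_SigmaD[OF has_sum_infsum[OF sm_paths] paths]])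
  qed
  have "(path_prod ?Ks \<circ> snd has_sum \<Theta> * ?T) ?P"
    by (rule has_sum_SigmaI[OF paths b sm_paths])
  then show ?thesis
    using has_sum_reindex_bij_betw[OF bij_betw_closed_paths, of "path_prod ?Ks"] by (simp add: comp_def)
qed

section \<open>The Jacobi theta function\<close>

lemma has_sum_diff:
  fixes f g :: "'b \<Rightarrow> complex"
  assumes "(f has_sum F) A" "(g has_sum G) A"
  shows "((\<lambda>x. f x - g x) has_sum F - G) A"
  using has_sum_add[OF assms(1) has_sum_uminusI[OF assms(2)]] by simp

lemma has_sum_times:
  fixes f :: "'b \<Rightarrow> complex" and g :: "'c \<Rightarrow> complex"
  assumes "(f has_sum F) A" "(g has_sum G) B"
  shows "((\<lambda>(x, y). f x * g y) has_sum F * G) (A \<times> B)"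
proof (rule has_sum_SigmaI)
  show "((\<lambda>y. case (x, y) of (x, y) \<Rightarrow> f x * g y) has_sum f x * G) B" for x
    using has_sum_cmult_right[OF assms(2)] by simp
  show "((\<lambda>x. f x * G) has_sum F * G) A" by (rule has_sum_cmult_left[OF assms(1)])
  have nf: "(\<lambda>x. norm (f x)) summable_on A" and ng: "(\<lambda>y. norm (g y)) summable_on B"
    by (rule summable_on_iff_abs_summable_on_complex[THEN iffD1, OF has_sum_imp_summable[OF assms(1)]])
      (rule summable_on_iff_abs_summable_on_complex[THEN iffD1, OF has_sum_imp_summable[OF assms(2)]])
  have "(\<lambda>(x, y). norm (f x) * norm (g y)) summable_on A \<times> B"
  proof (rule summable_on_SigmaI)
    show "((\<lambda>y. case (x, y) of (x, y) \<Rightarrow> norm (f x) * norm (g y)) has_sum norm (f x) * (\<Sum>\<^sub>\<infinity>y\<in>B. norm (g y))) B" for x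
      using has_sum_cmult_right[OF has_sum_infsum[OF ng]] by simp
    show "(\<lambda>x. norm (f x) * (\<Sum>\<^sub>\<infinity>y\<in>B. norm (g y))) summable_on A"
      by (rule summable_on_cmult_left[OF nf])
  qed auto
  then have "(\<lambda>p. norm (case p of (x, y) \<Rightarrow> f x * g y)) summable_on A \<times> B"
    by (rule summable_on_cong[THEN iffD1, rotated]) (auto simp: norm_mult)
  then show "(\<lambda>(x, y). f x * g y) summable_on A \<times> B" by (rule abs_summable_summable)
qed

text \<open>The coefficients (-1)^k q^(k(k-1)/2) / ((1 - q) ... (1 - q^k)), given by the recursion
  behind the functional equation.\<close>

fun euler_coeff :: "complex \<Rightarrow> nat \<Rightarrow> complex" where
  "euler_coeff q 0 = 1"
| "euler_coeff q (Suc k) = - (q ^ k) / (1 - q ^ Suc k) * euler_coeff q k"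

text \<open>By Euler's identity (not needed here) this is \<open>\<Prod>\<^bsub>n\<ge>0\<^esub> (1 - u q\<^sup>n)\<close>.\<close>

definition euler_fn :: "complex \<Rightarrow> complex \<Rightarrow> complex" where
  "euler_fn q u = (\<Sum>k. euler_coeff q k * u ^ k)"

text \<open>The sum of log (1 - u q^n) over n, with each logarithm expanded and the geometric series
  in n summed. The denominators 1 - q^(k+1) are those of \<open>fock_kernel_trace\<close>.\<close>

definition euler_log :: "complex \<Rightarrow> complex \<Rightarrow> complex" where
  "euler_log q u = - (\<Sum>k. u ^ Suc k / (of_nat (Suc k) * (1 - q ^ Suc k)))"

section \<open>Euler's product and its logarithm\<close>

locale nome =
  fixes q :: complex
  assumes q_norm: "norm q < 1" and q_nz: "q \<noteq> 0"
begin

lemma one_minus_q_power: "1 - norm q \<le> norm (1 - q ^ Suc k)" "1 - q ^ Suc k \<noteq> 0"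
proof -
  have "norm q ^ Suc k \<le> norm q" using q_norm power_le_one[of "norm q" k] by (simp add: mult_left_le)
  moreover have "1 - norm (q ^ Suc k) \<le> norm (1 - q ^ Suc k)"
    using norm_triangle_ineq2[of 1 "q ^ Suc k"] by simp
  ultimately show *: "1 - norm q \<le> norm (1 - q ^ Suc k)" by (simp add: norm_mult norm_power)
  then have "norm (1 - q ^ Suc k) > 0" using q_norm by linarith
  then show "1 - q ^ Suc k \<noteq> 0" by (rule zero_less_norm_iff[THEN iffD1])
qed

text \<open>The ratio of consecutive terms tends to 0 like q^k, so the series converges for every
  u.\<close>

lemma summable_euler: "summable (\<lambda>k. norm (euler_coeff q k * u ^ k))"
proof -
  have "(\<lambda>k. norm q ^ k * (norm u / (1 - norm q))) \<longlonglongrightarrow> 0 * (norm u / (1 - norm q))"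
    by (intro tendsto_intros LIMSEQ_power_zero) (simp add: q_norm)
  then have "\<forall>\<^sub>F k in sequentially. norm q ^ k * (norm u / (1 - norm q)) < 1 / 2"
    by (intro order_tendstoD) auto
  then obtain N where N: "\<And>k. k \<ge> N \<Longrightarrow> norm q ^ k * (norm u / (1 - norm q)) < 1 / 2"
    by (auto simp: eventually_sequentially)
  show ?thesis
  proof (rule summable_ratio_test[of "1 / 2" N])
    fix k assume "k \<ge> N"
    have "norm (euler_coeff q (Suc k) * u ^ Suc k)
        = (norm q ^ k * norm u / norm (1 - q ^ Suc k)) * norm (euler_coeff q k * u ^ k)"
      by (simp add: norm_mult norm_divide norm_power field_simps)
    also have "\<dots> \<le> (norm q ^ k * norm u / (1 - norm q)) * norm (euler_coeff q k * u ^ k)"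
      using q_norm one_minus_q_power(1)[of k]
      by (intro mult_right_mono divide_left_mono mult_pos_pos) auto
    also have "\<dots> \<le> 1 / 2 * norm (euler_coeff q k * u ^ k)"
      using N[OF \<open>k \<ge> N\<close>] by (intro mult_right_mono) auto
    finally show "norm (norm (euler_coeff q (Suc k) * u ^ Suc k)) \<le> 1 / 2 * norm (norm (euler_coeff q k * u ^ k))"
      by simp
  qed simp
qed

lemma euler_fn_has_sum: "((\<lambda>k. euler_coeff q k * u ^ k) has_sum euler_fn q u) UNIV"
  unfolding euler_fn_def
  by (rule norm_summable_imp_has_sum[OF summable_euler summable_sums[OF summable_norm_cancel[OF summable_euler]]])

lemma euler_fn_sums: "(\<lambda>k. euler_coeff q k * u ^ k) sums euler_fn q u"
  by (rule has_sum_imp_sums[OF euler_fn_has_sum])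

lemma euler_fn_0 [simp]: "euler_fn q 0 = 1"
  by (simp add: euler_fn_def powser_zero)

text \<open>Comparison of coefficients: the recursion says that a_k = a_k q^k - a_(k-1)
  q^(k-1).\<close>

lemma euler_fn_functional: "euler_fn q u = (1 - u) * euler_fn q (q * u)"
proof -
  let ?a = "euler_coeff q"
  have 1: "(\<lambda>k. ?a k * (q * u) ^ k) sums euler_fn q (q * u)" by (rule euler_fn_sums)
  have 2: "(\<lambda>k. case k of 0 \<Rightarrow> 0 | Suc k \<Rightarrow> u * (?a k * (q * u) ^ k)) sums (u * euler_fn q (q * u))"
    using sums_Suc[of "\<lambda>k. case k of 0 \<Rightarrow> 0 | Suc k \<Rightarrow> u * (?a k * (q * u) ^ k)"] sums_mult[OF 1, of u] by simp
  have "(\<lambda>k. ?a k * (q * u) ^ k - (case k of 0 \<Rightarrow> 0 | Suc k \<Rightarrow> u * (?a k * (q * u) ^ k))) sums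
      (euler_fn q (q * u) - u * euler_fn q (q * u))"
    by (rule sums_diff[OF 1 2])
  also have "(\<lambda>k. ?a k * (q * u) ^ k - (case k of 0 \<Rightarrow> 0 | Suc k \<Rightarrow> u * (?a k * (q * u) ^ k))) = (\<lambda>k. ?a k * u ^ k)"
  proof
    fix k
    show "?a k * (q * u) ^ k - (case k of 0 \<Rightarrow> 0 | Suc k \<Rightarrow> u * (?a k * (q * u) ^ k)) = ?a k * u ^ k"
    proof (cases k)
      case (Suc j)
      have "?a (Suc j) * (1 - q ^ Suc j) = - (q ^ j) * ?a j" using one_minus_q_power(2)[of j] by simp
      then have "?a (Suc j) * q ^ Suc j - q ^ j * ?a j = ?a (Suc j)"
        by (simp add: algebra_simps del: power_Suc euler_coeff.simps)
      then have "(?a (Suc j) * q ^ Suc j - q ^ j * ?a j) * u ^ Suc j = ?a (Suc j) * u ^ Suc j" by simp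
      then show ?thesis unfolding Suc by (simp add: power_mult_distrib algebra_simps del: euler_coeff.simps)
    qed simp
  qed
  finally have "(\<lambda>k. ?a k * u ^ k) sums (euler_fn q (q * u) - u * euler_fn q (q * u))" .
  then show ?thesis using sums_unique2[OF euler_fn_sums] by (simp add: algebra_simps)
qed

lemma euler_fn_holomorphic: "euler_fn q holomorphic_on UNIV"
proof -
  have "(euler_fn q has_field_derivative (\<Sum>k. diffs (euler_coeff q) k * u ^ k)) (at u)" for u
    unfolding euler_fn_def
    by (rule termdiffs_strong_converges_everywhere) (rule summable_norm_cancel[OF summable_euler])
  then show ?thesis by (auto simp: holomorphic_on_open)
qed

lemma isCont_euler_fn: "isCont (euler_fn q) u"
  using euler_fn_holomorphic
  by (metis UNIV_I continuous_on_eq_continuous_at holomorphic_on_imp_continuous_on open_UNIV)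

abbreviation log_term :: "complex \<Rightarrow> nat \<Rightarrow> complex" where
  "log_term u k \<equiv> u ^ Suc k / (of_nat (Suc k) * (1 - q ^ Suc k))"

lemma summable_euler_log:
  assumes "norm u < 1"
  shows "summable (\<lambda>k. norm (log_term u k))"
proof (rule summable_comparison_test')
  show "summable (\<lambda>k. norm u ^ k / (1 - norm q))"
    using assms by (intro summable_divide summable_geometric) auto
  fix k
  have "norm (log_term u k) = norm u ^ k * norm u / (real (Suc k) * norm (1 - q ^ Suc k))"
    by (simp add: norm_mult norm_divide norm_power mult.commute del: of_nat_Suc)
  also have "\<dots> \<le> norm u ^ k * 1 / (1 * (1 - norm q))"
    using assms q_norm one_minus_q_power(1)[of k]
    by (intro frac_le mult_mono mult_nonneg_nonneg mult_pos_pos) auto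
  finally show "norm (norm (log_term u k)) \<le> norm u ^ k / (1 - norm q)" by simp
qed

lemma euler_log_0 [simp]: "euler_log q 0 = 0"
  by (simp add: euler_log_def)

lemma euler_log_eq_powser: "euler_log q u = - (\<Sum>k. (if k = 0 then 0 else 1 / (of_nat k * (1 - q ^ k))) * u ^ k)"
  if "norm u < 1"
proof -
  let ?f = "\<lambda>k. (if k = 0 then 0 else 1 / (of_nat k * (1 - q ^ k))) * u ^ k"
  have "(\<lambda>k. ?f (Suc k)) = log_term u" by auto
  then have "summable (\<lambda>k. ?f (Suc k))" using summable_norm_cancel[OF summable_euler_log[OF that]] by simp
  then have "suminf (\<lambda>k. ?f (Suc k)) = suminf ?f" using suminf_split_head[of ?f] summable_Suc_iff[of ?f] by simp
  then show ?thesis unfolding euler_log_def by simp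
qed

lemma euler_log_holomorphic: "euler_log q holomorphic_on ball 0 1"
proof -
  let ?c = "\<lambda>k. if k = 0 then 0 else 1 / (of_nat k * (1 - q ^ k))"
  have "(\<lambda>u. \<Sum>k. ?c k * u ^ k) holomorphic_on ball 0 1"
  proof (rule power_series_holomorphic)
    fix u :: complex assume "u \<in> ball 0 1"
    then have u: "norm u < 1" by simp
    have "(\<lambda>k. ?c (Suc k) * u ^ Suc k) = log_term u" by auto
    then have "summable (\<lambda>k. ?c (Suc k) * u ^ Suc k)" using summable_norm_cancel[OF summable_euler_log[OF u]] by simp
    then have "summable (\<lambda>k. ?c k * u ^ k)" using summable_Suc_iff[of "\<lambda>k. ?c k * u ^ k"] by simp
    then show "(\<lambda>k. ?c k * (u - 0) ^ k) sums (\<Sum>k. ?c k * u ^ k)" unfolding diff_zero by (rule summable_sums)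
  qed
  then have "(\<lambda>u. - (\<Sum>k. ?c k * u ^ k)) holomorphic_on ball 0 1"
    by (rule holomorphic_on_minus)
  then show ?thesis
    by (rule holomorphic_transform) (simp add: euler_log_eq_powser)
qed

lemma euler_log_sums:
  assumes "norm u < 1"
  shows "log_term u sums (- euler_log q u)"
  unfolding euler_log_def minus_minus by (rule summable_sums[OF summable_norm_cancel[OF summable_euler_log[OF assms]]])

text \<open>The factor 1 - q^(k+1) cancels in the difference and the series of - log (1 - u)
  remains. In this form the contractions of radially ordered vertex operators appear.\<close>

lemma euler_log_diff_sums:
  assumes "norm u < 1"
  shows "(\<lambda>k. u ^ Suc k / of_nat (Suc k)) sums (euler_log q (q * u) - euler_log q u)"
proof -
  have nqu: "norm (q * u) < 1"
    unfolding norm_mult using assms q_norm mult_left_le_one_le[of "norm u" "norm q"] by simp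
  note 1 = euler_log_sums[OF assms] and 2 = euler_log_sums[OF nqu]
  have "(\<lambda>k. log_term u k - log_term (q * u) k)
     sums (- euler_log q u - - euler_log q (q * u))"
    by (rule sums_diff[OF 1 2])
  also have "(\<lambda>k. log_term u k - log_term (q * u) k)
     = (\<lambda>k. u ^ Suc k / of_nat (Suc k))"
  proof
    fix k
    have "log_term u k - log_term (q * u) k
       = (u ^ Suc k * (1 - q ^ Suc k)) / (of_nat (Suc k) * (1 - q ^ Suc k))"
      by (simp add: power_mult_distrib algebra_simps diff_divide_distrib del: of_nat_Suc)
    then show "log_term u k - log_term (q * u) k
       = u ^ Suc k / of_nat (Suc k)"
      using one_minus_q_power(2)[of k] by (simp del: of_nat_Suc power_Suc)
  qed
  finally show ?thesis by simp
qed

lemma exp_euler_log_functional: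
  assumes "norm u < 1"
  shows "exp (euler_log q u) = (1 - u) * exp (euler_log q (q * u))"
proof -
  have "(\<lambda>n. - ((- (- u)) ^ n) / of_nat n) sums ln (1 + - u)"
    using assms by (intro Ln_series') simp
  then have "(\<lambda>n. - (u ^ n) / of_nat n) sums ln (1 - u)" by simp
  then have "(\<lambda>n. - (u ^ Suc n) / of_nat (Suc n)) sums ln (1 - u)"
    by (subst sums_Suc_iff) simp
  then have "(\<lambda>k. - (- (u ^ Suc k) / of_nat (Suc k))) sums (- ln (1 - u))"
    by (rule sums_minus)
  then have "(\<lambda>k. u ^ Suc k / of_nat (Suc k)) sums (- ln (1 - u))" by (simp del: of_nat_Suc power_Suc)
  then have "euler_log q (q * u) - euler_log q u = - ln (1 - u)" using euler_log_diff_sums[OF assms] sums_unique2 by blast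
  then have "euler_log q u = ln (1 - u) + euler_log q (q * u)" by (simp add: algebra_simps)
  moreover have "1 - u \<noteq> 0" using assms by auto
  ultimately show ?thesis by (simp add: exp_add)
qed

text \<open>The quotient of the two sides is unchanged under u -> q u, continuous at 0 and equal to
  1 there; iteration pushes u to 0.\<close>

lemma euler_fn_eq_exp:
  assumes "norm u < 1"
  shows "euler_fn q u = exp (euler_log q u)"
proof -
  let ?R = "\<lambda>u. euler_fn q u * exp (- euler_log q u)"
  have step: "?R u = ?R (q * u)" if "norm u < 1" for u
  proof -
    have "1 - u \<noteq> 0" using that by auto
    then show ?thesis
      unfolding exp_minus euler_fn_functional[of u] exp_euler_log_functional[OF that] by (simp add: field_simps)
  qed
  have le: "norm (q ^ n * u) < 1" for n
  proof -
    have "norm (q ^ n * u) \<le> norm u"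
      unfolding norm_mult norm_power using q_norm by (intro mult_left_le_one_le power_le_one) auto
    then show ?thesis using assms by linarith
  qed
  have const: "?R (q ^ n * u) = ?R u" for n
    by (induction n) (use step[OF le] in \<open>simp_all add: mult.assoc\<close>)
  have "(\<lambda>n. q ^ n * u) \<longlonglongrightarrow> 0 * u"
    by (intro tendsto_intros LIMSEQ_power_zero q_norm)
  moreover have "isCont ?R 0"
  proof -
    have "isCont (euler_log q) 0"
      using holomorphic_on_imp_continuous_on[OF euler_log_holomorphic]
      by (simp add: continuous_on_eq_continuous_at)
    then show ?thesis using isCont_euler_fn by (intro continuous_intros) auto
  qed
  ultimately have "(\<lambda>n. ?R (q ^ n * u)) \<longlonglongrightarrow> ?R 0"
    by (intro isCont_tendsto_compose[where g = ?R]) auto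
  then have "?R u = ?R 0" unfolding const using LIMSEQ_unique tendsto_const by blast
  then show ?thesis by (simp add: exp_minus field_simps)
qed

lemma euler_fn_nonzero: "norm u < 1 \<Longrightarrow> euler_fn q u \<noteq> 0"
  by (simp add: euler_fn_eq_exp)

section \<open>The Jacobi triple product\<close>

abbreviation euler_coeff_int :: "int \<Rightarrow> complex" where
  "euler_coeff_int m \<equiv> if m < 0 then 0 else euler_coeff q (nat m)"

text \<open>The coefficient of u^n in \<open>euler_fn q u * euler_fn q (q / u)\<close>: the power n
  + k of u meets the power k of q / u. Extending \<open>euler_coeff\<close> by zero lets k run
  freely for every integer n.\<close>

definition jacobi_coeff :: "int \<Rightarrow> complex" where
  "jacobi_coeff n = (\<Sum>\<^sub>\<infinity>k. euler_coeff_int (n + int k) * euler_coeff q k * q ^ k)"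

lemma jacobi_product_has_sum:
  assumes "u \<noteq> 0"
  shows "((\<lambda>n. jacobi_coeff n * u powi n) has_sum euler_fn q u * euler_fn q (q / u)) UNIV"
    and "(\<lambda>k. euler_coeff_int (n + int k) * euler_coeff q k * q ^ k) summable_on UNIV"
proof -
  let ?f = "\<lambda>u (n, k). euler_coeff_int (n + int k) * euler_coeff q k * q ^ k * u powi n"
  have sum: "(?f u has_sum euler_fn q u * euler_fn q (q / u)) (UNIV \<times> UNIV)" if "u \<noteq> 0" for u
  proof -
    let ?g = "\<lambda>(j, k). (euler_coeff q j * u ^ j) * (euler_coeff q k * (q / u) ^ k)"
    have g: "(?g has_sum euler_fn q u * euler_fn q (q / u)) (UNIV \<times> UNIV)"
      by (intro has_sum_times euler_fn_has_sum)
    have bij: "bij_betw (\<lambda>(n, k). (nat (n + int k), k)) {(n, k). n + int k \<ge> 0} (UNIV \<times> UNIV)"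
      by (rule bij_betw_byWitness[where f' = "\<lambda>(j, k). (int j - int k, k)"]) auto
    have "((\<lambda>p. ?g (case p of (n, k) \<Rightarrow> (nat (n + int k), k))) has_sum euler_fn q u * euler_fn q (q / u)) {(n, k). n + int k \<ge> 0}"
      using g unfolding has_sum_reindex_bij_betw[OF bij, of ?g] .
    then show ?thesis
    proof (rule has_sum_cong_neutral[THEN iffD1, rotated -1])
      fix p :: "int \<times> nat" assume p: "p \<in> {(n, k). n + int k \<ge> 0} \<inter> UNIV \<times> UNIV"
      obtain n k where nk: "p = (n, k)" by force
      have nn: "n + int k \<ge> 0" using p nk by simp
      have "u ^ nat (n + int k) * (q / u) ^ k = q ^ k * u powi n"
      proof -
        have "u ^ nat (n + int k) = u powi (n + int k)" using nn by (simp add: power_int_def)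
        also have "\<dots> = u powi n * u ^ k" using that by (simp add: power_int_add)
        finally show ?thesis using that by (simp add: power_divide)
      qed
      then show "?g (case p of (n, k) \<Rightarrow> (nat (n + int k), k)) = ?f u p"
        using nn by (simp add: nk mult_ac)
    qed auto
  qed
  have sm: "(\<lambda>k. euler_coeff_int (n + int k) * euler_coeff q k * q ^ k) summable_on UNIV" for n
  proof -
    \<comment> \<open>At u = 1 the double series is the series of the coefficients
      themselves.\<close>
    have "?f 1 summable_on (UNIV \<times> UNIV)" using sum[of 1] by (intro has_sum_imp_summable) auto
    then have "(\<lambda>k. ?f 1 (n, k)) summable_on UNIV"
      by (intro summable_on_SigmaD1[of "\<lambda>n k. ?f 1 (n, k)" UNIV "\<lambda>_. UNIV" n]) simp_all
    then show ?thesis by simp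
  qed
  then show "(\<lambda>k. euler_coeff_int (n + int k) * euler_coeff q k * q ^ k) summable_on UNIV" .
  show "((\<lambda>n. jacobi_coeff n * u powi n) has_sum euler_fn q u * euler_fn q (q / u)) UNIV"
  proof (rule has_sum_SigmaD[OF sum[OF assms]])
    show "((\<lambda>k. ?f u (n, k)) has_sum jacobi_coeff n * u powi n) UNIV" for n
      using has_sum_cmult_left[OF has_sum_infsum[OF sm[of n]], of "u powi n"]
      by (simp add: jacobi_coeff_def)
  qed
qed

text \<open>The recursion for \<open>euler_coeff\<close> is applied to both factors. The series
  \<open>S\<close>, which carries an extra q^k, enters twice and cancels. Working with coefficients
  dispenses with the uniqueness of Laurent expansions.\<close>

lemma jacobi_coeff_Suc: "jacobi_coeff (n + 1) = - (q powi n) * jacobi_coeff n"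
proof -
  let ?t = "\<lambda>n k. euler_coeff_int (n + int k) * euler_coeff q k * q ^ k"
  have t: "(?t n has_sum jacobi_coeff n) UNIV" for n
    unfolding jacobi_coeff_def by (rule has_sum_infsum[OF jacobi_product_has_sum(2)[of 1]]) simp
  \<comment> \<open>The recursion holds for all integers: at m = -1 it reads 1 = 1, and below that
    all terms vanish.\<close>
  have ai: "euler_coeff_int (m + 1) = q powi (m + 1) * euler_coeff_int (m + 1) - q powi m * euler_coeff_int m" for m
  proof -
    consider "m \<ge> 0" | "m = -1" | "m < -1" by linarith
    then show ?thesis
    proof cases
      case 1
      define j where "j = nat m"
      have m: "m = int j" using 1 by (simp add: j_def)
      have "euler_coeff q (Suc j) * (1 - q ^ Suc j) = - (q ^ j) * euler_coeff q j"
        using one_minus_q_power(2)[of j] by simp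
      moreover have "nat (m + 1) = Suc j" "nat m = j" "q powi (m + 1) = q ^ Suc j" "q powi m = q ^ j"
        by (auto simp: m nat_add_distrib simp flip: power_int_of_nat)
          (metis of_nat_Suc add.commute power_int_of_nat power_Suc)
      ultimately show ?thesis using 1 by (simp add: algebra_simps del: power_Suc euler_coeff.simps)
    qed auto
  qed
  let ?s = "\<lambda>k. euler_coeff_int (n + 1 + int k) * euler_coeff q k * q ^ k * q ^ k"
  have sm: "?s summable_on UNIV"
  proof -
    have "(\<lambda>k. norm (?t (n + 1) k)) summable_on UNIV"
      by (rule summable_on_iff_abs_summable_on_complex[THEN iffD1, OF has_sum_imp_summable[OF t]])
    then have "(\<lambda>k. norm (?s k)) summable_on UNIV"
    proof (rule Infinite_Sum.abs_summable_on_comparison_test')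
      fix k
      have "norm (q ^ k) \<le> 1" using q_norm by (simp add: norm_power power_le_one)
      then show "norm (?s k) \<le> norm (?t (n + 1) k)" unfolding norm_mult by (intro mult_right_le_one_le) auto
    qed
    then show ?thesis by (rule abs_summable_summable)
  qed
  define S where "S = infsum ?s UNIV"
  have S: "(?s has_sum S) UNIV" unfolding S_def by (rule has_sum_infsum[OF sm])
  have 2: "((\<lambda>k. euler_coeff_int (n + int k) * euler_coeff q k * q ^ k * q ^ k) has_sum jacobi_coeff n + q * S) UNIV"
  proof -
    let ?r = "\<lambda>k. case k of 0 \<Rightarrow> 0 | Suc j \<Rightarrow> q * ?s j"
    have "(?r has_sum q * S) (range Suc)"
      unfolding has_sum_reindex[OF inj_Suc] using has_sum_cmult_right[OF S, of q] by (simp add: comp_def)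
    then have "(?r has_sum q * S) UNIV"
      by (rule has_sum_cong_neutral[THEN iffD1, rotated -1]) (auto split: nat.splits simp: image_iff)
    then have "((\<lambda>k. ?t n k + ?r k) has_sum jacobi_coeff n + q * S) UNIV"
      by (rule has_sum_add[OF t])
    moreover have "?t n k + ?r k = euler_coeff_int (n + int k) * euler_coeff q k * q ^ k * q ^ k" for k
    proof (cases k)
      case (Suc j)
      have "euler_coeff q (Suc j) * q ^ Suc j = euler_coeff q (Suc j) + q ^ j * euler_coeff q j"
      proof -
        have "euler_coeff q (Suc j) * (1 - q ^ Suc j) = - (q ^ j) * euler_coeff q j"
          using one_minus_q_power(2)[of j] by simp
        then show ?thesis by (simp add: algebra_simps del: power_Suc euler_coeff.simps)
      qed
      then have "euler_coeff_int (n + int k) * euler_coeff q k * q ^ k * q ^ k =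
          euler_coeff_int (n + int k) * (euler_coeff q (Suc j) + q ^ j * euler_coeff q j) * q ^ k"
        unfolding Suc by (simp only: mult.assoc)
      moreover have "n + 1 + int j = n + int k" by (simp add: Suc)
      ultimately show ?thesis by (simp add: Suc algebra_simps del: euler_coeff.simps)
    qed simp
    ultimately show ?thesis by simp
  qed
  have "((\<lambda>k. q powi (n + 1) * ?s k - q powi n * (euler_coeff_int (n + int k) * euler_coeff q k * q ^ k * q ^ k)) has_sum
     q powi (n + 1) * S - q powi n * (jacobi_coeff n + q * S)) UNIV"
    by (intro has_sum_diff has_sum_cmult_right S 2)
  moreover have "q powi (n + 1) * ?s k - q powi n * (euler_coeff_int (n + int k) * euler_coeff q k * q ^ k * q ^ k) = ?t (n + 1) k" for k
  proof -
    have e: "q powi (n + int k + 1) = q powi (n + 1) * q ^ k" "q powi (n + int k) = q powi n * q ^ k"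
      using q_nz by (simp_all add: power_int_add)
    have "?t (n + 1) k = (q powi (n + int k + 1) * euler_coeff_int (n + int k + 1) - q powi (n + int k) * euler_coeff_int (n + int k)) * euler_coeff q k * q ^ k"
      using ai[of "n + int k"] by (simp add: add_ac del: euler_coeff.simps)
    then show ?thesis unfolding e by (simp add: algebra_simps add_ac del: euler_coeff.simps)
  qed
  ultimately have "jacobi_coeff (n + 1) = q powi (n + 1) * S - q powi n * (jacobi_coeff n + q * S)"
    using t[of "n + 1"] has_sum_unique by simp
  also have "\<dots> = - (q powi n) * jacobi_coeff n"
    using q_nz by (simp add: power_int_add algebra_simps)
  finally show ?thesis .
qed

end

locale upper_half_plane =
  fixes \<tau> :: complex
  assumes Im_tau: "Im \<tau> > 0"
begin

definition q :: complex where "q = exp (2 * of_real pi * \<i> * \<tau>)"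

lemma norm_q: "norm q = exp (- (2 * pi * Im \<tau>))"
  by (simp add: q_def)

sublocale nome q
  by unfold_locales (use Im_tau in \<open>simp_all add: norm_q, simp add: q_def\<close>)

lemma q_powi: "q powi n = exp (2 * of_real pi * \<i> * \<tau> * of_int n)"
  unfolding q_def by (simp add: exp_power_int mult_ac)

lemma exp_2pi_int: "exp (2 * of_real pi * \<i> * of_int n) = 1"
  using exp_integer_2pi[of "of_int n"] by (simp add: mult_ac)

text \<open>This is (-1)^n q^(n(n-1)/2), written as a single exponential so that later identities
  become identities of exponents.\<close>

abbreviation jacobi_exp :: "int \<Rightarrow> complex" where
  "jacobi_exp n \<equiv> exp (of_real pi * \<i> * of_int n + of_real pi * \<i> * \<tau> * of_int (n * (n - 1)))"

lemma jacobi_coeff_eq: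
  "jacobi_coeff n = jacobi_coeff 0 * jacobi_exp n"
proof (induction n rule: int_induct[where k = 0])
  case base
  show ?case by simp
next
  case (step1 i)
  have "jacobi_coeff (i + 1) = jacobi_coeff 0 * (- 1 * exp (2 * of_real pi * \<i> * \<tau> * of_int i) *
     jacobi_exp i)"
    unfolding jacobi_coeff_Suc q_powi step1 by simp
  also have "- 1 * exp (2 * of_real pi * \<i> * \<tau> * of_int i) *
     jacobi_exp i =
     jacobi_exp (i + 1)"
    unfolding exp_pi_i[symmetric] exp_add[symmetric] by (rule arg_cong[where f = exp]) (simp add: algebra_simps)
  finally show ?case .
next
  case (step2 i)
  have "- (exp (2 * of_real pi * \<i> * \<tau> * of_int (i - 1))) * jacobi_coeff (i - 1) =
     jacobi_coeff 0 * jacobi_exp i"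
    using jacobi_coeff_Suc[of "i - 1"] step2 unfolding q_powi by simp
  moreover have "- (exp (2 * of_real pi * \<i> * \<tau> * of_int (i - 1))) *
      jacobi_exp (i - 1) =
      jacobi_exp i"
  proof -
    have "- (exp (2 * of_real pi * \<i> * \<tau> * of_int (i - 1))) = exp (of_real pi * \<i>) * exp (2 * of_real pi * \<i> * \<tau> * of_int (i - 1))"
      by simp
    then show ?thesis
      by (simp only: exp_add[symmetric]) (rule arg_cong[where f = exp], simp add: algebra_simps)
  qed
  ultimately have "- (exp (2 * of_real pi * \<i> * \<tau> * of_int (i - 1))) * jacobi_coeff (i - 1) =
     - (exp (2 * of_real pi * \<i> * \<tau> * of_int (i - 1))) * (jacobi_coeff 0 *
      jacobi_exp (i - 1))"
    by (simp only: mult_ac)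
  then show ?case by (subst (asm) mult_cancel_left) simp
qed

text \<open>Otherwise the whole Laurent series vanishes. At the square root u = exp (\<pi> i \<tau>)
  of q, however, u and q / u coincide and lie in the unit disc, where \<open>euler_fn\<close> has no
  zero.\<close>

lemma jacobi_coeff_0_nonzero: "jacobi_coeff 0 \<noteq> 0"
proof
  assume "jacobi_coeff 0 = 0"
  then have "jacobi_coeff n = 0" for n using jacobi_coeff_eq[of n] by simp
  moreover define u where "u = exp (of_real pi * \<i> * \<tau>)"
  ultimately have "((\<lambda>n :: int. 0) has_sum euler_fn q u * euler_fn q (q / u)) UNIV"
    using jacobi_product_has_sum(1)[of u] by (simp add: u_def)
  then have "euler_fn q u * euler_fn q (q / u) = 0"
    using has_sum_unique has_sum_0 by fastforce
  moreover have "q / u = u"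
    unfolding q_def u_def exp_diff[symmetric] by (rule arg_cong[where f = exp]) simp
  moreover have "norm u < 1" using Im_tau by (simp add: u_def)
  ultimately show False using euler_fn_nonzero by auto
qed

text \<open>This is i q^(1/8) divided by the constant term of the triple product.\<close>

definition theta_const :: complex where
  "theta_const = exp (\<i> * of_real pi * \<tau> / 4 + of_real pi * \<i> / 2) / jacobi_coeff 0"

lemma theta_const_nonzero: "theta_const \<noteq> 0"
  by (simp add: theta_const_def jacobi_coeff_0_nonzero)

abbreviation theta_term :: "complex \<Rightarrow> int \<Rightarrow> complex" where
  "theta_term z n \<equiv> exp (\<i> * of_real pi * (of_int n + 1 / 2)\<^sup>2 * \<tau> + (of_int n + 1 / 2) * (z + of_real pi * \<i>))"

abbreviation theta_product :: "complex \<Rightarrow> complex" where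
  "theta_product z \<equiv> theta_const * (exp (z / 2) * euler_fn q (exp (- z)) * euler_fn q (q * exp z))"

lemma theta_term_has_sum:
  "(theta_term z has_sum theta_product z) UNIV"
proof -
  let ?H = "euler_fn q (exp (- z)) * euler_fn q (q * exp z)"
  have "((\<lambda>n. jacobi_coeff n * exp (- z) powi n) has_sum ?H) UNIV"
    using jacobi_product_has_sum(1)[of "exp (- z)"] by (simp add: exp_minus divide_inverse)
  then have "((\<lambda>n. jacobi_coeff (- n) * exp (- z) powi (- n)) has_sum ?H) UNIV"
    using has_sum_reindex_bij_betw[OF bij_uminus, of "\<lambda>n. jacobi_coeff n * exp (- z) powi n"] by simp
  then have "((\<lambda>n. theta_const * exp (z / 2) * (jacobi_coeff (- n) * exp (- z) powi (- n))) has_sum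
      theta_const * exp (z / 2) * ?H) UNIV"
    by (rule has_sum_cmult_right)
  moreover have "theta_const * exp (z / 2) * (jacobi_coeff (- n) * exp (- z) powi (- n)) = theta_term z n" for n
  proof -
    have "theta_const * exp (z / 2) * (jacobi_coeff (- n) * exp (- z) powi (- n)) =
      exp (\<i> * of_real pi * \<tau> / 4 + of_real pi * \<i> / 2) * exp (z / 2) *
      (jacobi_exp (- n) * exp (of_int (- n) * (- z)))"
      unfolding theta_const_def jacobi_coeff_eq[of "- n"] exp_power_int using jacobi_coeff_0_nonzero by simp
    \<comment> \<open>The signs (-1)^(-n) and (-1)^n have exponents that differ by 2 \<pi> i n; a
      factor 1 is inserted to make them agree.\<close>
    also have "\<dots> = exp (\<i> * of_real pi * \<tau> / 4 + of_real pi * \<i> / 2) * exp (z / 2) *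
      (jacobi_exp (- n) * exp (of_int (- n) * (- z)))
      * exp (2 * of_real pi * \<i> * of_int n)"
      by (simp only: exp_2pi_int mult_1_right)
    also have "\<dots> = theta_term z n"
      unfolding exp_add[symmetric]
      by (rule arg_cong[where f = exp]) (simp add: algebra_simps power2_eq_square)
    finally show ?thesis .
  qed
  ultimately show ?thesis by (simp add: mult.assoc)
qed

lemma theta1_has_sum: "(theta_term z has_sum theta1 z \<tau>) UNIV"
  and theta1_product: "theta1 z \<tau> = theta_product z"
proof -
  have "theta1 z \<tau> = infsum (theta_term z) UNIV"
    unfolding theta1_def theta_def by (intro infsum_cong) simp
  moreover have "infsum (theta_term z) UNIV = theta_product z"
    using theta_term_has_sum by (rule infsumI)
  ultimately show "theta1 z \<tau> = theta_product z"
    and "(theta_term z has_sum theta1 z \<tau>) UNIV"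
    using theta_term_has_sum[of z] by simp_all
qed

section \<open>Characteristics, logarithms and the derivative at 0\<close>

definition theta_prefactor :: "real \<Rightarrow> real \<Rightarrow> complex \<Rightarrow> complex" where
  "theta_prefactor \<alpha> \<beta> z = exp (\<i> * of_real pi * (of_real \<alpha> - 1 / 2)\<^sup>2 * \<tau> + (of_real \<alpha> - 1 / 2) * (z + 2 * of_real pi * \<i> * of_real \<beta>))"

text \<open>Writing n + \<alpha> = (n + 1/2) + (\<alpha> - 1/2) and expanding the square turns any
  characteristic into a translation of the argument of \<open>theta1\<close>, so that the
  determinant concerns \<open>theta1\<close> alone.\<close>

definition theta_offset :: "real \<Rightarrow> real \<Rightarrow> complex" where
  "theta_offset \<alpha> \<beta> = 2 * of_real pi * \<i> * (of_real \<beta> - 1 / 2) + 2 * of_real pi * \<i> * \<tau> * (of_real \<alpha> - 1 / 2)"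

abbreviation theta_char_term :: "real \<Rightarrow> real \<Rightarrow> complex \<Rightarrow> int \<Rightarrow> complex" where
  "theta_char_term \<alpha> \<beta> z n \<equiv> exp (\<i> * of_real pi * (of_int n + of_real \<alpha>)\<^sup>2 * \<tau> + (of_int n + of_real \<alpha>) * (z + 2 * of_real pi * \<i> * of_real \<beta>))"

lemma theta_has_sum_theta1:
  "(theta_char_term \<alpha> \<beta> z has_sum theta_prefactor \<alpha> \<beta> z * theta1 (z + theta_offset \<alpha> \<beta>) \<tau>) UNIV"
proof -
  have "((\<lambda>n. theta_prefactor \<alpha> \<beta> z * theta_term (z + theta_offset \<alpha> \<beta>) n) has_sum
     theta_prefactor \<alpha> \<beta> z * theta1 (z + theta_offset \<alpha> \<beta>) \<tau>) UNIV"
    by (intro has_sum_cmult_right theta1_has_sum)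
  moreover have "theta_prefactor \<alpha> \<beta> z * theta_term (z + theta_offset \<alpha> \<beta>) n = theta_char_term \<alpha> \<beta> z n" for n
  proof -
    have "i * p * d\<^sup>2 * \<tau> + d * (z + 2 * p * i * b) + (i * p * N\<^sup>2 * \<tau> +
        N * (z + (2 * p * i * (b - 1 / 2) + 2 * p * i * \<tau> * d) + p * i)) =
        i * p * (N + d)\<^sup>2 * \<tau> + (N + d) * (z + 2 * p * i * b)" for i p d N b :: complex
      by (simp add: power2_eq_square algebra_simps)
    note this[of \<i> "of_real pi" "of_real \<alpha> - 1 / 2" "of_real \<beta>" "of_int n + 1 / 2"]
    moreover have "of_int n + 1 / 2 + (of_real \<alpha> - 1 / 2) = (of_int n + of_real \<alpha> :: complex)" by simp
    ultimately show ?thesis unfolding theta_prefactor_def theta_offset_def exp_add[symmetric] by simp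
  qed
  ultimately show ?thesis by simp
qed

lemma theta_eq_theta1: "theta \<alpha> \<beta> z \<tau> = theta_prefactor \<alpha> \<beta> z * theta1 (z + theta_offset \<alpha> \<beta>) \<tau>"
  unfolding theta_def by (rule infsumI[OF theta_has_sum_theta1])

lemma theta_has_sum: "(theta_char_term \<alpha> \<beta> z has_sum theta \<alpha> \<beta> z \<tau>) UNIV"
  using theta_has_sum_theta1 unfolding theta_eq_theta1 .

text \<open>The reflection n -> -1 - n changes the sign of n + 1/2; the second characteristic 1/2
  turns this into the factor exp (- \<pi> i (2n + 1)) = -1.\<close>

lemma theta1_minus: "theta1 (- z) \<tau> = - theta1 z \<tau>"
proof -
  have bij: "bij_betw (\<lambda>n :: int. - 1 - n) UNIV UNIV"
    by (rule bij_betw_byWitness[where f' = "\<lambda>n. - 1 - n"]) auto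
  have "((\<lambda>n. theta_term (- z) (- 1 - n)) has_sum theta1 (- z) \<tau>) UNIV"
    using theta1_has_sum[of "- z"] has_sum_reindex_bij_betw[OF bij, of "theta_term (- z)"] by simp
  moreover have "theta_term (- z) (- 1 - n) = - theta_term z n" for n
  proof -
    have "theta_term (- z) (- 1 - n) = theta_term (- z) (- 1 - n) * exp (2 * of_real pi * \<i> * of_int (n + 1))"
      by (simp only: exp_2pi_int mult_1_right)
    also have "\<dots> = exp (of_real pi * \<i>) * theta_term z n"
      unfolding exp_add[symmetric]
      by (rule arg_cong[where f = exp]) (simp add: algebra_simps power2_eq_square)
    finally show ?thesis by simp
  qed
  ultimately have "((\<lambda>n. - theta_term z n) has_sum theta1 (- z) \<tau>) UNIV" by simp
  moreover have "((\<lambda>n. - theta_term z n) has_sum - theta1 z \<tau>) UNIV"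
    by (rule has_sum_uminusI[OF theta1_has_sum])
  ultimately show ?thesis by (rule has_sum_unique)
qed

lemma theta1_holomorphic: "(\<lambda>z. theta1 z \<tau>) holomorphic_on UNIV"
proof -
  have E: "(\<lambda>z. euler_fn q (g z)) holomorphic_on UNIV" if "g holomorphic_on UNIV" for g
    using holomorphic_on_compose_gen[OF that euler_fn_holomorphic] by (simp add: comp_def)
  show ?thesis unfolding theta1_product by (intro holomorphic_intros E) auto
qed

lemma isCont_theta1: "isCont (\<lambda>z. theta1 z \<tau>) z"
  using holomorphic_on_imp_continuous_on[OF theta1_holomorphic]
  by (simp add: continuous_on_eq_continuous_at)

text \<open>Up to a constant, the logarithm given by the expansion of the vertex operators: on
  \<open>theta1_strip\<close> both exp (- z) and q exp z lie in the unit disc, where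
  \<open>euler_log\<close> converges.\<close>

definition strip_log :: "complex \<Rightarrow> complex" where
  "strip_log z = z / 2 + euler_log q (exp (- z)) + euler_log q (q * exp z)"

lemma strip_bounds:
  assumes "z \<in> theta1_strip \<tau>"
  shows "norm (exp (- z)) < 1" "norm (q * exp z) < 1"
  using assms by (simp_all add: theta1_strip_def norm_mult norm_q flip: exp_add)

lemma exp_strip_log:
  assumes "z \<in> theta1_strip \<tau>"
  shows "theta_const * exp (strip_log z) = theta1 z \<tau>"
  unfolding theta1_product strip_log_def exp_add using euler_fn_eq_exp strip_bounds[OF assms] by simp

lemma theta1_nonzero:
  assumes "z \<in> theta1_strip \<tau>"
  shows "theta1 z \<tau> \<noteq> 0"
  using exp_strip_log[OF assms] theta_const_nonzero by force

lemma open_theta1_strip: "open (theta1_strip \<tau>)"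
  unfolding theta1_strip_def by (intro open_Collect_conj open_Collect_less continuous_intros)

lemma convex_theta1_strip: "convex (theta1_strip \<tau>)"
proof -
  have "theta1_strip \<tau> = {z. Re z > 0} \<inter> {z. Re z < 2 * pi * Im \<tau>}" by (auto simp: theta1_strip_def)
  then show ?thesis by (simp add: convex_Int convex_halfspace_Re_gt convex_halfspace_Re_lt)
qed

lemma strip_log_holomorphic: "strip_log holomorphic_on theta1_strip \<tau>"
proof -
  have E: "(\<lambda>z. euler_log q (g z)) holomorphic_on theta1_strip \<tau>"
    if "g holomorphic_on theta1_strip \<tau>" "\<And>z. z \<in> theta1_strip \<tau> \<Longrightarrow> norm (g z) < 1" for g
    using holomorphic_on_compose_gen[OF that(1) euler_log_holomorphic] that(2) by (simp add: comp_def image_subset_iff)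
  show ?thesis unfolding strip_log_def
    by (intro holomorphic_intros E strip_bounds) auto
qed

text \<open>\<open>log_theta1\<close> is an arbitrary choice, but two holomorphic logarithms on a
  convex set differ by a constant. It later cancels because the kernel has two of these logarithms
  with each sign.\<close>

lemma log_theta1_eq: "\<exists>c. \<forall>z\<in>theta1_strip \<tau>. log_theta1 \<tau> z = strip_log z + c"
proof -
  let ?P = "\<lambda>l. l holomorphic_on theta1_strip \<tau> \<and> (\<forall>z\<in>theta1_strip \<tau>. exp (l z) = theta1 z \<tau>)"
  have "?P (\<lambda>z. strip_log z + ln theta_const)"
    using strip_log_holomorphic exp_strip_log theta_const_nonzero
    by (auto intro!: holomorphic_intros simp: exp_add mult.commute)
  then have P: "?P (log_theta1 \<tau>)" unfolding log_theta1_def by (rule someI[of ?P])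
  define d where "d = (\<lambda>z. log_theta1 \<tau> z - strip_log z)"
  have hol: "d holomorphic_on theta1_strip \<tau>"
    unfolding d_def using P strip_log_holomorphic by (intro holomorphic_intros) auto
  have exp_d: "exp (d z) = theta_const" if "z \<in> theta1_strip \<tau>" for z
  proof -
    have "exp (d z) = theta1 z \<tau> / exp (strip_log z)" unfolding d_def exp_diff using P that by auto
    then show ?thesis using exp_strip_log[OF that, symmetric] by simp
  qed
  have "(d has_field_derivative 0) (at z within theta1_strip \<tau>)" if z: "z \<in> theta1_strip \<tau>" for z
  proof -
    have d: "(d has_field_derivative deriv d z) (at z)"
      by (rule holomorphic_derivI[OF hol open_theta1_strip z])
    then have "((\<lambda>z. exp (d z)) has_field_derivative exp (d z) * deriv d z) (at z)"
      by (rule DERIV_fun_exp)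
    moreover have "((\<lambda>z. exp (d z)) has_field_derivative 0) (at z)"
      by (rule has_field_derivative_transform_within_open[OF DERIV_const open_theta1_strip z]) (simp add: exp_d)
    ultimately have "exp (d z) * deriv d z = 0" by (rule DERIV_unique)
    then show ?thesis using d by (auto intro: has_field_derivative_at_within)
  qed
  then obtain c where "\<And>z. z \<in> theta1_strip \<tau> \<Longrightarrow> d z = c"
    using has_field_derivative_zero_constant[OF convex_theta1_strip] by blast
  then show ?thesis unfolding d_def by (intro exI[of _ c]) (auto simp: algebra_simps)
qed

text \<open>The functional equation splits off 1 - exp (- z), which carries the simple zero at 0;
  the derivative is the cofactor \<open>g\<close> at 0.\<close>

lemma deriv_theta1_0: "deriv (\<lambda>z. theta1 z \<tau>) 0 = theta_const * (euler_fn q q)\<^sup>2"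
proof -
  define g where "g = (\<lambda>z. theta_const * (exp (z / 2) * euler_fn q (q * exp (- z)) * euler_fn q (q * exp z)))"
  have "euler_fn q (exp (- z)) = (1 - exp (- z)) * euler_fn q (q * exp (- z))" for z
    by (rule euler_fn_functional)
  then have eq: "(\<lambda>z. theta1 z \<tau>) = (\<lambda>z. (1 - exp (- z)) * g z)"
    unfolding theta1_product g_def by (simp add: mult_ac)
  have E: "(\<lambda>z. euler_fn q (h z)) holomorphic_on UNIV" if "h holomorphic_on UNIV" for h
    using holomorphic_on_compose_gen[OF that euler_fn_holomorphic] by (simp add: comp_def)
  have "g holomorphic_on UNIV" unfolding g_def by (intro holomorphic_intros E) auto
  then have "(g has_field_derivative deriv g 0) (at 0)" by (intro holomorphic_derivI) auto
  then have "((\<lambda>z. (1 - exp (- z)) * g z) has_field_derivative g 0) (at 0)"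
    by (auto intro!: derivative_eq_intros)
  then have "deriv (\<lambda>z. theta1 z \<tau>) 0 = g 0" unfolding eq by (rule DERIV_imp_deriv)
  then show ?thesis by (simp add: g_def power2_eq_square)
qed

section \<open>Addition formula and Fay's trisecant identity\<close>

definition even_theta :: "complex \<Rightarrow> complex" where
  "even_theta x = theta 0 0 (2 * x) (2 * \<tau>)"

text \<open>The names refer to the parity of the summation index of the Gaussian terms, not to a
  symmetry in x.\<close>

definition odd_theta :: "complex \<Rightarrow> complex" where
  "odd_theta x = theta (1 / 2) 0 (2 * x) (2 * \<tau>)"

abbreviation gauss :: "int \<Rightarrow> complex \<Rightarrow> complex" where
  "gauss s x \<equiv> exp (\<i> * of_real pi * \<tau> * (of_int s)\<^sup>2 / 2 + of_int s * x)"

lemma even_odd_theta_has_sum: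
  "((\<lambda>t. gauss (2 * t) x) has_sum even_theta x) UNIV"
  "((\<lambda>t. gauss (2 * t + 1) x) has_sum odd_theta x) UNIV"
proof -
  interpret double: upper_half_plane "2 * \<tau>" by unfold_locales (use Im_tau in simp)
  have "gauss (2 * t) x = exp (\<i> * of_real pi * (of_int t + of_real 0)\<^sup>2 * (2 * \<tau>) + (of_int t + of_real 0) * (2 * x + 2 * of_real pi * \<i> * of_real 0))" for t
    by (rule arg_cong[where f = exp]) (simp add: power2_eq_square)
  then show "((\<lambda>t. gauss (2 * t) x) has_sum even_theta x) UNIV"
    using double.theta_has_sum[of 0 "2 * x" 0] by (simp only: even_theta_def)
  have "gauss (2 * t + 1) x = exp (\<i> * of_real pi * (of_int t + of_real (1 / 2))\<^sup>2 * (2 * \<tau>) + (of_int t + of_real (1 / 2)) * (2 * x + 2 * of_real pi * \<i> * of_real 0))" for t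
    by (rule arg_cong[where f = exp]) (simp add: power2_eq_square field_simps)
  then show "((\<lambda>t. gauss (2 * t + 1) x) has_sum odd_theta x) UNIV"
    using double.theta_has_sum[of "1 / 2" "2 * x" 0] by (simp only: odd_theta_def)
qed

text \<open>Substituting \<open>s = m + n + 1\<close>, \<open>d = m - n\<close> in the double series splits it according to the
  parity of \<open>s\<close>, so the product is a two by two determinant and satisfies a Pluecker relation.\<close>

lemma theta1_mult:
  "theta1 (x + y) \<tau> * theta1 (x - y) \<tau> = even_theta x * odd_theta y - odd_theta x * even_theta y"
proof -
  let ?f = "\<lambda>(m, n). theta_term (x + y) m * theta_term (x - y) n"
  have "(?f has_sum theta1 (x + y) \<tau> * theta1 (x - y) \<tau>) (UNIV \<times> UNIV)"
    by (intro has_sum_times theta1_has_sum)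
  moreover have "(?f has_sum even_theta x * odd_theta y - odd_theta x * even_theta y) (UNIV \<times> UNIV)"
  proof -
    let ?h1 = "\<lambda>(t, r). (t + r, t - r - 1) :: int \<times> int" and ?h2 = "\<lambda>(t, r). (t + r, t - r) :: int \<times> int"
    \<comment> \<open>The indices m + n + 1 and m - n have opposite parity, and the sign is positive
      exactly if the first is even; so the two halves of the double series give the two terms of the
      determinant.\<close>
    have f: "theta_term (x + y) m * theta_term (x - y) n = exp (of_real pi * \<i> * of_int (m + n + 1)) * (gauss (m + n + 1) x * gauss (m - n) y)" for m n
      unfolding exp_add[symmetric]
      by (rule arg_cong[where f = exp]) (simp add: power2_eq_square field_simps)
    have "(?f has_sum even_theta x * odd_theta y) {p. odd (fst p + snd p)}"
    proof -
      have bij: "bij_betw ?h1 (UNIV \<times> UNIV) {p. odd (fst p + snd p)}"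
        by (rule bij_betw_byWitness[where f' = "\<lambda>(m, n). ((m + n + 1) div 2, (m - n - 1) div 2)"])
          (auto elim!: oddE, presburger+)
      have "((\<lambda>(t, r). gauss (2 * t) x * gauss (2 * r + 1) y) has_sum even_theta x * odd_theta y) (UNIV \<times> UNIV)"
        by (intro has_sum_times even_odd_theta_has_sum)
      also have "(\<lambda>(t, r). gauss (2 * t) x * gauss (2 * r + 1) y) = (\<lambda>p. ?f (?h1 p))"
      proof (rule ext)
        fix p :: "int \<times> int"
        obtain t r where p: "p = (t, r)" by force
        have "t + r + (t - r - 1) + 1 = 2 * t" "t + r - (t - r - 1) = 2 * r + 1" by auto
        moreover have "exp (of_real pi * \<i> * of_int (2 * t)) = (1 :: complex)"
          using exp_2pi_int[of t] by (simp add: mult_ac)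
        ultimately show "(case p of (t, r) \<Rightarrow> gauss (2 * t) x * gauss (2 * r + 1) y) = ?f (?h1 p)"
          by (simp only: p f prod.case mult_1_left)
      qed
      finally show ?thesis unfolding has_sum_reindex_bij_betw[OF bij, of ?f] .
    qed
    moreover have "(?f has_sum - (odd_theta x * even_theta y)) {p. even (fst p + snd p)}"
    proof -
      have bij: "bij_betw ?h2 (UNIV \<times> UNIV) {p. even (fst p + snd p)}"
        by (rule bij_betw_byWitness[where f' = "\<lambda>(m, n). ((m + n) div 2, (m - n) div 2)"])
          (auto elim!: evenE, presburger+)
      have "((\<lambda>(t, r). gauss (2 * t + 1) x * gauss (2 * r) y) has_sum odd_theta x * even_theta y) (UNIV \<times> UNIV)"
        by (intro has_sum_times even_odd_theta_has_sum)
      then have "((\<lambda>p. - (case p of (t, r) \<Rightarrow> gauss (2 * t + 1) x * gauss (2 * r) y)) has_sum - (odd_theta x * even_theta y)) (UNIV \<times> UNIV)"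
        by (rule has_sum_uminusI)
      also have "(\<lambda>p. - (case p of (t, r) \<Rightarrow> gauss (2 * t + 1) x * gauss (2 * r) y)) = (\<lambda>p. ?f (?h2 p))"
      proof (rule ext)
        fix p :: "int \<times> int"
        obtain t r where p: "p = (t, r)" by force
        have "t + r + (t - r) + 1 = 2 * t + 1" "t + r - (t - r) = 2 * r" by auto
        moreover have "exp (of_real pi * \<i> * of_int (2 * t + 1)) = (- 1 :: complex)"
          using exp_2pi_int[of t] by (simp add: algebra_simps exp_add)
        ultimately show "- (case p of (t, r) \<Rightarrow> gauss (2 * t + 1) x * gauss (2 * r) y) = ?f (?h2 p)"
          by (simp only: p f prod.case mult_minus1)
      qed
      finally show ?thesis unfolding has_sum_reindex_bij_betw[OF bij, of ?f] .
    qed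
    ultimately have "(?f has_sum even_theta x * odd_theta y + - (odd_theta x * even_theta y))
        ({p. odd (fst p + snd p)} \<union> {p. even (fst p + snd p)})"
      by (rule has_sum_Un_disjoint) auto
    moreover have "{p. odd (fst p + snd p)} \<union> {p. even (fst p + snd p)} = (UNIV \<times> UNIV :: (int \<times> int) set)"
      by auto
    ultimately show ?thesis by simp
  qed
  ultimately show ?thesis by (rule has_sum_unique)
qed

theorem theta1_trisecant:
  "theta1 (t + x1 - y1) \<tau> * theta1 (t + x2 - y2) \<tau> * theta1 (x1 - y2) \<tau> * theta1 (x2 - y1) \<tau>
    - theta1 (t + x1 - y2) \<tau> * theta1 (t + x2 - y1) \<tau> * theta1 (x1 - y1) \<tau> * theta1 (x2 - y2) \<tau>
   = theta1 t \<tau> * theta1 (t + x1 + x2 - y1 - y2) \<tau> * theta1 (x1 - x2) \<tau> * theta1 (y2 - y1) \<tau>"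
proof -
  define W where "W = (\<lambda>x y. even_theta x * odd_theta y - odd_theta x * even_theta y)"
  \<comment> \<open>The four points are chosen so that their pairwise sums and differences are, up
    to sign, the twelve arguments in the statement. What remains is the Pluecker relation for the
    vectors (\<open>even_theta\<close>, \<open>odd_theta\<close>) at these points.\<close>
  define a where "a = (t + 2 * x1 - y1 - y2) / 2"
  define b where "b = t + x1 - y1 - a"
  define c where "c = t + x1 - y2 - a"
  define d where "d = t + x1 + x2 - y1 - y2 - a"
  have W: "theta1 (x + y) \<tau> * theta1 (x - y) \<tau> = W x y" for x y
    unfolding W_def by (rule theta1_mult)
  have ab: "a + b = t + x1 - y1" "a - b = x1 - y2" "c + d = t + x2 - y2" "c - d = - (x2 - y1)"
    "a + c = t + x1 - y2" "a - c = x1 - y1" "b + d = t + x2 - y1" "b - d = - (x2 - y2)"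
    "a + d = t + x1 + x2 - y1 - y2" "a - d = x1 - x2" "b + c = t" "b - c = y2 - y1"
    by (simp_all add: a_def b_def c_def d_def field_simps)
  have "W a b * W c d - W a c * W b d + W a d * W b c = 0"
    unfolding W_def by (simp add: algebra_simps)
  then show ?thesis
    unfolding W[symmetric] ab theta1_minus by (simp add: algebra_simps)
qed

end

section \<open>Frobenius' determinant\<close>

lemma det_mat_sum:
  fixes f :: "nat \<times> nat \<Rightarrow> 'a :: comm_ring_1"
  shows "Determinant.det (Matrix.mat n n f) = (\<Sum>p | p permutes {0..<n}. signof p * (\<Prod>i=0..<n. f (i, p i)))"
  by (subst det_def'[of _ n]) (auto intro!: sum.cong prod.cong dest: permutes_in_image)

lemma det_mat_scale:
  fixes f :: "nat \<times> nat \<Rightarrow> 'a :: comm_ring_1"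
  shows "Determinant.det (Matrix.mat n n (\<lambda>(i, j). r i * s j * f (i, j))) =
    (\<Prod>i<n. r i) * (\<Prod>j<n. s j) * Determinant.det (Matrix.mat n n f)"
proof -
  have "(\<Prod>i=0..<n. s (p i)) = (\<Prod>i=0..<n. s i)" if "p permutes {0..<n}" for p
    using prod.permute[OF that, of s] by (simp add: comp_def)
  then show ?thesis
    unfolding det_mat_sum sum_distrib_left
    by (intro sum.cong refl) (simp add: prod.distrib atLeast0LessThan mult_ac)
qed

lemma det_mat_Schur:
  fixes f :: "nat \<times> nat \<Rightarrow> 'a :: field"
  assumes "f (0, 0) \<noteq> 0"
  shows "Determinant.det (Matrix.mat (Suc n) (Suc n) f) = f (0, 0) *
    Determinant.det (Matrix.mat n n (\<lambda>(i, j). f (Suc i, Suc j) - f (Suc i, 0) * f (0, Suc j) / f (0, 0)))"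
    (is "_ = _ * Determinant.det ?S")
proof -
  let ?A = "Matrix.mat 1 1 f" and ?B = "Matrix.mat 1 n (\<lambda>(i, j). f (0, Suc j))"
    and ?C = "Matrix.mat n 1 (\<lambda>(i, j). f (Suc i, 0))" and ?D = "Matrix.mat n n (\<lambda>(i, j). f (Suc i, Suc j))"
    and ?E = "Matrix.mat n 1 (\<lambda>(i, j). - f (Suc i, 0) / f (0, 0))"
  \<comment> \<open>Left multiplication by this unipotent matrix clears the first column below the
    pivot.\<close>
  let ?L = "four_block_mat (1\<^sub>m 1) (0\<^sub>m 1 n) ?E (1\<^sub>m n)"
  have M: "Matrix.mat (Suc n) (Suc n) f = four_block_mat ?A ?B ?C ?D" (is "?M = _")
    by (rule eq_matI) (auto simp: four_block_mat_def Let_def less_Suc_eq_0_disj)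
  have LM: "?L * four_block_mat ?A ?B ?C ?D = four_block_mat ?A ?B (0\<^sub>m n 1) ?S"
  proof -
    have "?L * four_block_mat ?A ?B ?C ?D = four_block_mat (1\<^sub>m 1 * ?A + 0\<^sub>m 1 n * ?C) (1\<^sub>m 1 * ?B + 0\<^sub>m 1 n * ?D)
       (?E * ?A + 1\<^sub>m n * ?C) (?E * ?B + 1\<^sub>m n * ?D)"
      by (rule mult_four_block_mat) auto
    also have "1\<^sub>m 1 * ?A + 0\<^sub>m 1 n * ?C = ?A" by (auto simp: left_mult_zero_mat[of _ n])
    also have "1\<^sub>m 1 * ?B + 0\<^sub>m 1 n * ?D = ?B" by (auto simp: left_mult_zero_mat[of _ n])
    also have "?E * ?A + 1\<^sub>m n * ?C = 0\<^sub>m n 1"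
      by (rule eq_matI) (use assms in \<open>auto simp: scalar_prod_def\<close>)
    also have "?E * ?B + 1\<^sub>m n * ?D = ?S"
      by (rule eq_matI) (auto simp: scalar_prod_def)
    finally show ?thesis .
  qed
  have "Determinant.det ?L = 1"
    by (subst det_four_block_mat_upper_right_zero) auto
  then have "Determinant.det ?M = Determinant.det (?L * four_block_mat ?A ?B ?C ?D)"
    unfolding M by (subst det_mult[of _ "1 + n"]) auto
  also have "\<dots> = Determinant.det ?A * Determinant.det ?S"
    unfolding LM by (rule det_four_block_mat_lower_left_zero) auto
  also have "Determinant.det ?A = f (0, 0)"
    by (subst det_single) auto
  finally show ?thesis .
qed

lemma tendsto_det_mat:
  fixes f :: "'b \<Rightarrow> nat \<times> nat \<Rightarrow> 'a :: real_normed_field"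
  assumes "\<And>i j. i < n \<Longrightarrow> j < n \<Longrightarrow> ((\<lambda>t. f t (i, j)) \<longlongrightarrow> g (i, j)) F"
  shows "((\<lambda>t. Determinant.det (Matrix.mat n n (f t))) \<longlongrightarrow> Determinant.det (Matrix.mat n n g)) F"
  unfolding det_mat_sum
  by (intro tendsto_intros assms) (auto dest: permutes_in_image)

context upper_half_plane
begin

abbreviation th :: "complex \<Rightarrow> complex" where "th z \<equiv> theta1 z \<tau>"

text \<open>The product of theta_1(x_i - x_j) theta_1(y_j - y_i) over i < j, divided by the product
  of theta_1(x_i - y_j) over all i and j. Peeling off index 0 follows both the Schur complement and
  the list of insertions.\<close>

fun frobenius_factor :: "nat \<Rightarrow> (nat \<Rightarrow> complex) \<Rightarrow> (nat \<Rightarrow> complex) \<Rightarrow> complex" where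
  "frobenius_factor 0 x y = 1"
| "frobenius_factor (Suc n) x y = 1 / th (x 0 - y 0) *
     (\<Prod>i<n. th (x 0 - x (Suc i)) / th (x (Suc i) - y 0)) * (\<Prod>j<n. th (y (Suc j) - y 0) / th (x 0 - y (Suc j)))
     * frobenius_factor n (\<lambda>i. x (Suc i)) (\<lambda>i. y (Suc i))"

text \<open>The partial sums in the second hypothesis are the successive values of t; their theta
  values are the numerators of the pivots. The extra factor \<open>th t\<close> on the left lets the
  formula include n = 0.\<close>

lemma frobenius_det_generic:
  assumes "\<And>i j. i < n \<Longrightarrow> j < n \<Longrightarrow> th (x i - y j) \<noteq> 0"
    and "\<And>m. m \<le> n \<Longrightarrow> th (t + (\<Sum>i<m. x i - y i)) \<noteq> 0"
  shows "Determinant.det (Matrix.mat n n (\<lambda>(i, j). th (t + x i - y j) / th (x i - y j))) * th t =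
    th t ^ n * th (t + (\<Sum>i<n. x i - y i)) * frobenius_factor n x y"
  using assms
proof (induction n arbitrary: x y t)
  case 0
  show ?case by simp
next
  case (Suc n)
  let ?m = "\<lambda>(i, j). th (t + x i - y j) / th (x i - y j)"
  define t1 where "t1 = t + (x 0 - y 0)"
  let ?R = "\<lambda>i. th (x 0 - x (Suc i)) / th (x (Suc i) - y 0)" and ?C = "\<lambda>j. th (y (Suc j) - y 0) / th (x 0 - y (Suc j))"
  let ?D = "Determinant.det (Matrix.mat n n (\<lambda>(i, j). th (t1 + x (Suc i) - y (Suc j)) / th (x (Suc i) - y (Suc j))))"
  have t1: "th t1 \<noteq> 0" using Suc.prems(2)[of 1] by (simp add: t1_def)
  have sh: "t1 + (\<Sum>i<m. x (Suc i) - y (Suc i)) = t + (\<Sum>i<Suc m. x i - y i)" for m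
    unfolding sum.lessThan_Suc_shift t1_def by simp
  have IH: "?D * th t1 = th t1 ^ n * th (t1 + (\<Sum>i<n. x (Suc i) - y (Suc i))) *
     frobenius_factor n (\<lambda>i. x (Suc i)) (\<lambda>i. y (Suc i))"
    by (rule Suc.IH) (use Suc.prems in \<open>auto simp: sh simp del: sum.lessThan_Suc\<close>)
  have nz: "th (x 0 - y 0) \<noteq> 0" using Suc.prems(1)[of 0 0] by simp
  have m00: "?m (0, 0) = th t1 / th (x 0 - y 0)" by (simp add: t1_def add_diff_eq)
  have entry: "?m (Suc i, Suc j) - ?m (Suc i, 0) * ?m (0, Suc j) / ?m (0, 0) =
      (th t / th t1 * ?R i) * ?C j * (th (t1 + x (Suc i) - y (Suc j)) / th (x (Suc i) - y (Suc j)))"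
    if "i < n" "j < n" for i j
  proof -
    have nz': "th (x (Suc i) - y (Suc j)) \<noteq> 0" "th (x (Suc i) - y 0) \<noteq> 0" "th (x 0 - y (Suc j)) \<noteq> 0"
      using Suc.prems(1) that by auto
    have tri: "th t1 * th (t + x (Suc i) - y (Suc j)) * th (x 0 - y (Suc j)) * th (x (Suc i) - y 0)
      - th (t + x 0 - y (Suc j)) * th (t + x (Suc i) - y 0) * th (x 0 - y 0) * th (x (Suc i) - y (Suc j))
      = th t * th (t1 + x (Suc i) - y (Suc j)) * th (x 0 - x (Suc i)) * th (y (Suc j) - y 0)"
      using theta1_trisecant[of t "x 0" "y 0" "x (Suc i)" "y (Suc j)"] by (simp add: t1_def algebra_simps)
    show ?thesis
      unfolding prod.case m00[simplified prod.case] using nz nz' t1 tri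
      by (simp add: field_simps)
  qed
  have "Determinant.det (Matrix.mat (Suc n) (Suc n) ?m) = th t1 / th (x 0 - y 0) *
    Determinant.det (Matrix.mat n n (\<lambda>(i, j). (th t / th t1 * ?R i) * ?C j *
      (\<lambda>(i, j). th (t1 + x (Suc i) - y (Suc j)) / th (x (Suc i) - y (Suc j))) (i, j)))"
  proof -
    have "Matrix.mat n n (\<lambda>(i, j). ?m (Suc i, Suc j) - ?m (Suc i, 0) * ?m (0, Suc j) / ?m (0, 0)) =
      Matrix.mat n n (\<lambda>(i, j). (th t / th t1 * ?R i) * ?C j *
      (\<lambda>(i, j). th (t1 + x (Suc i) - y (Suc j)) / th (x (Suc i) - y (Suc j))) (i, j))"
      by (rule cong_mat) (simp_all only: prod.case entry[unfolded prod.case])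
    moreover have "?m (0, 0) \<noteq> 0" unfolding m00 using t1 nz by simp
    ultimately show ?thesis using det_mat_Schur[of ?m n] unfolding m00 by simp
  qed
  also have "\<dots> = th t1 / th (x 0 - y 0) * ((\<Prod>i<n. th t / th t1 * ?R i) * (\<Prod>j<n. ?C j) * ?D)"
    by (simp only: det_mat_scale[where r = "\<lambda>i. th t / th t1 * ?R i" and s = ?C
        and f = "\<lambda>(i, j). th (t1 + x (Suc i) - y (Suc j)) / th (x (Suc i) - y (Suc j))"])
  also have "\<dots> = 1 / th (x 0 - y 0) * (th t ^ n / th t1 ^ n) * (\<Prod>i<n. ?R i) * (\<Prod>j<n. ?C j) * (?D * th t1)"
    by (simp only: prod.distrib prod_constant card_lessThan power_divide) (simp add: mult_ac)
  also have "\<dots> = th t ^ n * th (t1 + (\<Sum>i<n. x (Suc i) - y (Suc i))) * frobenius_factor (Suc n) x y"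
    unfolding IH using t1 by simp
  finally show ?case unfolding sh by simp
qed

lemma eventually_theta1_nonzero: "\<forall>\<^sub>F e in at 0. th (z + e) \<noteq> 0"
proof -
  \<comment> \<open>The midpoint of the strip is a point where \<open>theta1\<close> does not
    vanish; hence its zeros are isolated.\<close>
  have "of_real (pi * Im \<tau>) \<in> theta1_strip \<tau>" using Im_tau by (simp add: theta1_strip_def)
  then have "th (of_real (pi * Im \<tau>)) \<noteq> 0" by (rule theta1_nonzero)
  then have "\<forall>\<^sub>F w in at z. th w \<noteq> 0 \<and> w \<in> UNIV"
    by (intro non_zero_neighbour_alt[OF theta1_holomorphic]) auto
  then have "\<forall>\<^sub>F e in at 0. th (e + z) \<noteq> 0"
    unfolding at_to_0[of z] eventually_filtermap by simp
  then show ?thesis by (simp add: add.commute)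
qed

text \<open>Both sides are continuous in t, and a small shift of t avoids the zeros at all partial
  sums simultaneously.\<close>

theorem frobenius_det:
  assumes nz: "\<And>i j. i < n \<Longrightarrow> j < n \<Longrightarrow> th (x i - y j) \<noteq> 0"
  shows "Determinant.det (Matrix.mat n n (\<lambda>(i, j). th (t + x i - y j) / th (x i - y j))) * th t =
    th t ^ n * th (t + (\<Sum>i<n. x i - y i)) * frobenius_factor n x y"
proof -
  let ?L = "\<lambda>t. Determinant.det (Matrix.mat n n (\<lambda>(i, j). th (t + x i - y j) / th (x i - y j))) * th t"
  let ?R = "\<lambda>t. th t ^ n * th (t + (\<Sum>i<n. x i - y i)) * frobenius_factor n x y"
  have lim: "((\<lambda>e. th (t + e + z)) \<longlongrightarrow> th (t + z)) (at 0)" for z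
  proof -
    have "isCont (\<lambda>e. th (t + e + z)) 0"
      by (intro isCont_o2[OF _ isCont_theta1] continuous_intros)
    then show ?thesis by (simp add: isCont_def)
  qed
  have "((\<lambda>e. ?L (t + e)) \<longlongrightarrow> ?L t) (at 0)"
  proof (intro tendsto_mult tendsto_det_mat)
    show "((\<lambda>e. th (t + e)) \<longlongrightarrow> th t) (at 0)" using lim[of 0] by simp
    fix i j assume ij: "i < n" "j < n"
    have "((\<lambda>e. th (t + e + x i - y j) / th (x i - y j)) \<longlongrightarrow> th (t + x i - y j) / th (x i - y j)) (at 0)"
      using lim[of "x i - y j"] nz[OF ij] by (intro tendsto_divide tendsto_const) (simp_all add: add_diff_eq)
    then show "((\<lambda>e. case (i, j) of (i, j) \<Rightarrow> th (t + e + x i - y j) / th (x i - y j)) \<longlongrightarrow>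
       (case (i, j) of (i, j) \<Rightarrow> th (t + x i - y j) / th (x i - y j))) (at 0)" by simp
  qed
  moreover have R: "((\<lambda>e. ?R (t + e)) \<longlongrightarrow> ?R t) (at 0)"
    using lim[of 0] lim by (intro tendsto_intros) simp_all
  moreover have "\<forall>\<^sub>F e in at 0. ?L (t + e) = ?R (t + e)"
  proof -
    have "\<forall>\<^sub>F e in at 0. \<forall>m\<in>{..n}. th (t + (\<Sum>i<m. x i - y i) + e) \<noteq> 0"
      by (intro eventually_ball_finite ballI eventually_theta1_nonzero) simp
    then show ?thesis
    proof eventually_elim
      case (elim e)
      then show ?case by (intro frobenius_det_generic nz) (auto simp: add_ac)
    qed
  qed
  then have "((\<lambda>e. ?L (t + e)) \<longlongrightarrow> ?R t) (at 0)"
    by (rule tendsto_cong[THEN iffD2, OF _ R])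
  ultimately show ?thesis
    by (intro tendsto_unique[of "at (0 :: complex)" "\<lambda>e. ?L (t + e)"]) auto
qed

end

section \<open>Traces of charged insertions\<close>

text \<open>Treating the automorphism as a vertex without oscillators lets one composition rule
  cover all operators in front of the weight.\<close>

definition twist_vertex :: "real \<Rightarrow> complex vertex" where
  "twist_vertex \<beta>\<^sub>1 = Vertex 0 (\<lambda>\<beta>. exp (2 * of_real pi * \<i> * of_real \<beta>\<^sub>1 * \<beta>)) (\<lambda>_. 0) (\<lambda>_. 0)"

fun exp_vertex :: "complex \<times> complex \<Rightarrow> complex vertex" where
  "exp_vertex (\<alpha>, z) = Vertex \<alpha> (\<lambda>\<beta>. exp (z * \<alpha>\<^sup>2 / 2 + z * \<alpha> * \<beta>)) (create_coeff \<alpha> z) (annih_coeff \<alpha> z)"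

lemma vop_eq_vertex_kernel:
  "vop (exp_L0 z (evec \<alpha>)) z (ket b') b = vertex_kernel (exp_vertex (\<alpha>, z)) b b'"
  by (cases b; cases b') (simp add: vop_matrix vertex_kernel_def)

lemma exp_a0_eq_vertex_kernel:
  "exp_a0 (2 * of_real pi * \<i> * of_real \<beta>\<^sub>1) (ket b') b = vertex_kernel (twist_vertex \<beta>\<^sub>1) b b'"
  by (cases b; cases b') (auto simp: exp_a0_apply vertex_kernel_def twist_vertex_def fock_kernel_zero_params ket_def)

lemma norm_annih_create:
  "norm (annih_coeff \<alpha> z k) * norm (create_coeff \<alpha>' z' k) =
    norm \<alpha> * norm \<alpha>' * (exp (- (Re z - Re z')) ^ Suc k / real (Suc k))"
proof -
  have "exp (- (Re z - Re z')) ^ Suc k = exp (- (real (Suc k) * Re z)) * exp (real (Suc k) * Re z')"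
    unfolding exp_of_nat_mult[symmetric] exp_add[symmetric] by (rule arg_cong[where f = exp]) (simp add: algebra_simps)
  moreover have "norm (annih_coeff \<alpha> z k) = norm \<alpha> * exp (- (real (Suc k) * Re z))"
    by (simp add: annih_coeff_def norm_mult algebra_simps)
  moreover have "norm (create_coeff \<alpha>' z' k) = norm \<alpha>' * exp (real (Suc k) * Re z') / real (Suc k)"
    by (simp add: create_coeff_def norm_mult norm_divide del: of_nat_Suc)
  ultimately show ?thesis by simp
qed

lemma summable_power_over_Suc:
  assumes "0 \<le> r" "r < (1 :: real)"
  shows "summable (\<lambda>k. r ^ Suc k / real (Suc k))"
proof (rule summable_comparison_test')
  show "summable (\<lambda>k. r ^ k)" using assms by (intro summable_geometric) simp
  fix k
  have "r ^ Suc k / real (Suc k) \<le> r ^ k / 1"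
    using assms by (intro frac_le) (auto simp: mult_left_le_one_le)
  then show "norm (r ^ Suc k / real (Suc k)) \<le> r ^ k" using assms by simp
qed

lemma contractive_exp_vertex:
  assumes "Re z' < Re z"
  shows "contractive (exp_vertex (\<alpha>, z)) (exp_vertex (\<alpha>', z'))"
proof -
  have "summable (\<lambda>k. norm \<alpha> * norm \<alpha>' * (exp (- (Re z - Re z')) ^ Suc k / real (Suc k)))"
    using assms by (intro summable_mult summable_power_over_Suc) auto
  then show ?thesis
    unfolding contractive_def norm_annih_create[symmetric] by simp
qed

definition total_charge :: "(complex \<times> complex) list \<Rightarrow> complex" where
  "total_charge L = (\<Sum>(\<alpha>, z)\<leftarrow>L. \<alpha>)"

definition charge_moment :: "(complex \<times> complex) list \<Rightarrow> complex" where
  "charge_moment L = (\<Sum>(\<alpha>, z)\<leftarrow>L. \<alpha> * z)"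

definition charge_square :: "(complex \<times> complex) list \<Rightarrow> complex" where
  "charge_square L = (\<Sum>(\<alpha>, z)\<leftarrow>L. \<alpha>\<^sup>2)"

definition radially_ordered :: "(complex \<times> complex) list \<Rightarrow> bool" where
  "radially_ordered L \<longleftrightarrow> sorted_wrt (\<lambda>(\<alpha>, z) (\<alpha>', z'). Re z' < Re z) L"

section \<open>Contractions and the exponent of the trace\<close>

context upper_half_plane
begin

definition weight_kernel :: "fock_index \<Rightarrow> fock_index \<Rightarrow> complex" where
  "weight_kernel = diag_kernel (\<lambda>(\<beta>, l). exp (2 * of_real pi * \<i> * \<tau> * (\<beta>\<^sup>2 / 2 - 1 / 24)) * q ^ energy l)"

text \<open>This is q^(-1/24), with the root fixed by \<tau>.\<close>

definition vacuum_factor :: complex where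
  "vacuum_factor = exp (- (2 * of_real pi * \<i> * \<tau> / 24))"

lemma qtau_eq_weight_kernel:
  "qtau \<tau> (ket b') b = weight_kernel b b'"
proof -
  have "exp (2 * of_real pi * \<i> * \<tau> * (\<beta>\<^sup>2 / 2 + of_nat (energy l) - 1 / 24)) =
      exp (2 * of_real pi * \<i> * \<tau> * (\<beta>\<^sup>2 / 2 - 1 / 24)) * q ^ energy l" for \<beta> l
    unfolding q_def exp_of_nat_mult[symmetric] exp_add[symmetric]
    by (rule arg_cong[where f = exp]) (simp add: algebra_simps)
  then show ?thesis
    by (cases b; cases b') (auto simp: qtau_apply weight_kernel_def diag_kernel_def ket_def)
qed

text \<open>The exponential of this is 1 - exp (- u) when Re u > 0. The difference is kept because
  its second term cancels against the trace.\<close>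

abbreviation contraction :: "complex \<Rightarrow> complex" where
  "contraction u \<equiv> euler_log q (exp (- u)) - euler_log q (q * exp (- u))"

lemma contraction_sums:
  assumes "Re z' < Re z"
  shows "(\<lambda>k. annih_coeff \<alpha> z k * create_coeff \<alpha>' z' k) sums
    (\<alpha> * \<alpha>' * contraction (z - z'))"
proof -
  have "norm (exp (- (z - z'))) < 1" using assms by simp
  from sums_mult[OF euler_log_diff_sums[OF this], of "- \<alpha> * \<alpha>'"]
  have "(\<lambda>k. - \<alpha> * \<alpha>' * (exp (- (z - z')) ^ Suc k / of_nat (Suc k))) sums
    (\<alpha> * \<alpha>' * contraction (z - z'))"
    by (simp add: algebra_simps)
  moreover have "exp (- (z - z')) ^ Suc k = exp (- of_nat (Suc k) * z) * exp (of_nat (Suc k) * z')" for k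
    unfolding exp_of_nat_mult[symmetric] exp_add[symmetric] by (rule arg_cong[where f = exp]) (simp add: algebra_simps)
  ultimately show ?thesis by (simp add: annih_coeff_def create_coeff_def mult_ac del: of_nat_Suc power_Suc)
qed

lemma trace_contraction_sums:
  assumes "Re z - Re z' < 2 * pi * Im \<tau>"
  shows "(\<lambda>k. create_coeff \<alpha> z k * annih_coeff \<alpha>' z' k * q ^ Suc k / (1 - q ^ Suc k)) sums
    (\<alpha> * \<alpha>' * euler_log q (q * exp (z - z')))"
proof -
  have "norm (q * exp (z - z')) < 1" using assms by (simp add: norm_mult norm_q flip: exp_add)
  from sums_mult[OF euler_log_sums[OF this], of "- \<alpha> * \<alpha>'"]
  have "(\<lambda>k. - \<alpha> * \<alpha>' * ((q * exp (z - z')) ^ Suc k / (of_nat (Suc k) * (1 - q ^ Suc k)))) sums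
    (\<alpha> * \<alpha>' * euler_log q (q * exp (z - z')))"
    by simp
  moreover have "(q * exp (z - z')) ^ Suc k = q ^ Suc k * (exp (- of_nat (Suc k) * z') * exp (of_nat (Suc k) * z))" for k
    unfolding power_mult_distrib exp_of_nat_mult[symmetric] exp_add[symmetric]
    by (rule arg_cong[where f = "\<lambda>x. _ * exp x"]) (simp add: algebra_simps)
  ultimately show ?thesis by (simp add: annih_coeff_def create_coeff_def mult_ac del: of_nat_Suc power_Suc)
qed

text \<open>The contributions of the first insertion are its L(0)-weight, the power z^(\<alpha>
  a(0)) acting on the charges to its right, and its contractions with them.\<close>

fun ordering_exponent :: "(complex \<times> complex) list \<Rightarrow> complex" where
  "ordering_exponent [] = 0"
| "ordering_exponent ((\<alpha>, z) # L) = z * \<alpha>\<^sup>2 / 2 + z * \<alpha> * total_charge L +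
    (\<Sum>(\<alpha>', z')\<leftarrow>L. \<alpha> * \<alpha>' * contraction (z - z')) + ordering_exponent L"

text \<open>All ordered pairs occur, the diagonal included, since under the trace each creation part
  meets each annihilation part by going around the cycle.\<close>

definition trace_exponent :: "(complex \<times> complex) list \<Rightarrow> complex" where
  "trace_exponent L = (\<Sum>(\<alpha>, z)\<leftarrow>L. \<Sum>(\<alpha>', z')\<leftarrow>L. \<alpha> * \<alpha>' * euler_log q (q * exp (z - z')))"

fun strip_log_sum :: "(complex \<times> complex) list \<Rightarrow> complex" where
  "strip_log_sum [] = 0"
| "strip_log_sum ((\<alpha>, z) # L) = (\<Sum>(\<alpha>', z')\<leftarrow>L. \<alpha> * \<alpha>' * strip_log (z - z')) + strip_log_sum L"

lemma sums_sum_list: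
  fixes f :: "'b \<Rightarrow> nat \<Rightarrow> 'a :: real_normed_vector"
  assumes "\<And>x. x \<in> set xs \<Longrightarrow> f x sums S x"
  shows "(\<lambda>k. \<Sum>x\<leftarrow>xs. f x k) sums (\<Sum>x\<leftarrow>xs. S x)"
  using assms by (induction xs) (auto intro: sums_add)

lemma charge_exp_vertices: "charge (vcomp (map exp_vertex L)) = total_charge L"
  by (simp add: charge_vcomp total_charge_def comp_def case_prod_beta' split_def)
    (rule arg_cong[where f = sum_list], rule map_cong, auto)

lemma cre_exp_vertex: "cre (exp_vertex p) k = create_coeff (fst p) (snd p) k"
  and ann_exp_vertex: "ann (exp_vertex p) k = annih_coeff (fst p) (snd p) k"
  by (cases p, simp)+

lemma zmode_exp_vertices:
  assumes "radially_ordered L"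
  shows "zmode (vcomp (map exp_vertex L)) \<beta> = exp (\<beta> * charge_moment L + ordering_exponent L)"
  using assms
proof (induction L)
  case Nil
  show ?case by (simp add: charge_moment_def)
next
  case (Cons p L)
  obtain \<alpha> z where p: "p = (\<alpha>, z)" by force
  have lt: "Re z' < Re z" if "(\<alpha>', z') \<in> set L" for \<alpha>' z'
    using Cons.prems that by (auto simp: radially_ordered_def p)
  let ?c = "\<Sum>(\<alpha>', z')\<leftarrow>L. \<alpha> * \<alpha>' * contraction (z - z')"
  have "(\<lambda>k. \<Sum>p'\<leftarrow>L. annih_coeff \<alpha> z k * create_coeff (fst p') (snd p') k) sums ?c"
    unfolding split_def by (rule sums_sum_list) (rule contraction_sums, use lt in auto)
  then have "(\<Sum>k. ann (exp_vertex p) k * cre (vcomp (map exp_vertex L)) k) = ?c"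
    by (simp add: sums_iff cre_vcomp cre_exp_vertex ann_exp_vertex p comp_def sum_list_const_mult)
  moreover have "zmode (vcomp (map exp_vertex L)) \<beta> = exp (\<beta> * charge_moment L + ordering_exponent L)"
    using Cons by (simp add: radially_ordered_def)
  ultimately have "zmode (vcomp (map exp_vertex (p # L))) \<beta> = exp (z * \<alpha>\<^sup>2 / 2 + z * \<alpha> * (\<beta> + total_charge L)) *
      exp (\<beta> * charge_moment L + ordering_exponent L) * exp ?c"
    by (simp add: vcomp2_def charge_exp_vertices p)
  also have "\<dots> = exp (\<beta> * charge_moment (p # L) + ordering_exponent (p # L))"
    unfolding exp_add[symmetric] by (rule arg_cong[where f = exp]) (simp add: p charge_moment_def algebra_simps)
  finally show ?case .
qed

lemma trace_exponent_eq:
  assumes "\<And>\<alpha> z \<alpha>' z'. (\<alpha>, z) \<in> set L \<Longrightarrow> (\<alpha>', z') \<in> set L \<Longrightarrow> Re z - Re z' < 2 * pi * Im \<tau>"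
  shows "(\<Sum>k. cre (vcomp (map exp_vertex L)) k * ann (vcomp (map exp_vertex L)) k * q ^ Suc k / (1 - q ^ Suc k)) =
    trace_exponent L"
proof -
  have "(\<lambda>k. \<Sum>p\<leftarrow>L. \<Sum>p'\<leftarrow>L. create_coeff (fst p) (snd p) k * annih_coeff (fst p') (snd p') k * q ^ Suc k / (1 - q ^ Suc k))
     sums trace_exponent L"
    unfolding trace_exponent_def split_def
    by (intro sums_sum_list trace_contraction_sums) (use assms in force)
  moreover have "(\<Sum>p\<leftarrow>L. \<Sum>p'\<leftarrow>L. create_coeff (fst p) (snd p) k * annih_coeff (fst p') (snd p') k * q ^ Suc k / (1 - q ^ Suc k)) =
     cre (vcomp (map exp_vertex L)) k * ann (vcomp (map exp_vertex L)) k * q ^ Suc k / (1 - q ^ Suc k)" for k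
    unfolding cre_vcomp ann_vcomp map_map comp_def cre_exp_vertex ann_exp_vertex
    by (simp only: sum_list_const_mult sum_list_mult_const times_divide_eq_right[symmetric] mult.assoc)
  ultimately show ?thesis by (simp add: sums_iff)
qed

lemma sum_list_case_prod_add:
  "(\<Sum>(a, z)\<leftarrow>L. f a z + g a z) = (\<Sum>(a, z)\<leftarrow>L. f a z) + (\<Sum>(a, z)\<leftarrow>L. g a z :: complex)"
  by (induction L) (auto simp: algebra_simps)

lemma trace_exponent_Cons:
  "trace_exponent ((\<alpha>, z) # L) = \<alpha>\<^sup>2 * euler_log q q +
    (\<Sum>(\<alpha>', z')\<leftarrow>L. \<alpha> * \<alpha>' * (euler_log q (q * exp (z - z')) + euler_log q (q * exp (- (z - z'))))) + trace_exponent L"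
proof -
  have "(\<Sum>(\<alpha>', z')\<leftarrow>L. \<alpha> * \<alpha>' * (euler_log q (q * exp (z - z')) + euler_log q (q * exp (- (z - z'))))) =
     (\<Sum>(\<alpha>', z')\<leftarrow>L. \<alpha> * \<alpha>' * euler_log q (q * exp (z - z'))) + (\<Sum>(\<alpha>', z')\<leftarrow>L. \<alpha>' * \<alpha> * euler_log q (q * exp (z' - z)))"
    unfolding sum_list_case_prod_add[symmetric] by (simp add: algebra_simps)
  then show ?thesis
    unfolding trace_exponent_def by (simp add: split_def sum_list_addf power2_eq_square)
qed

text \<open>For a pair at distance u the contraction and the two trace terms add up to strip_log u -
  u / 2. The halves and the zero mode terms combine to total charge times moment over 2, which
  neutrality removes; the diagonal of the trace gives the term with
  \<open>charge_square\<close>.\<close>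

lemma exponent_sum:
  "ordering_exponent L + trace_exponent L =
    strip_log_sum L + charge_square L * euler_log q q + total_charge L * charge_moment L / 2"
proof (induction L)
  case Nil
  show ?case by (simp add: trace_exponent_def charge_square_def total_charge_def)
next
  case (Cons p L)
  obtain \<alpha> z where p: "p = (\<alpha>, z)" by force
  have "(\<Sum>(\<alpha>', z')\<leftarrow>L. \<alpha> * \<alpha>' * contraction (z - z')) +
     (\<Sum>(\<alpha>', z')\<leftarrow>L. \<alpha> * \<alpha>' * (euler_log q (q * exp (z - z')) + euler_log q (q * exp (- (z - z'))))) =
     (\<Sum>(\<alpha>', z')\<leftarrow>L. \<alpha> * \<alpha>' * strip_log (z - z')) - \<alpha> * z * total_charge L / 2 + \<alpha> * charge_moment L / 2"
  proof -
    have "(\<Sum>(\<alpha>', z')\<leftarrow>L. \<alpha> * \<alpha>' * strip_log (z - z')) =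
      (\<Sum>(\<alpha>', z')\<leftarrow>L. (\<alpha> * \<alpha>' * contraction (z - z')
        + \<alpha> * \<alpha>' * (euler_log q (q * exp (z - z')) + euler_log q (q * exp (- (z - z'))))) + \<alpha> * \<alpha>' * (z - z') / 2)"
      by (rule arg_cong[where f = sum_list], rule map_cong) (auto simp: strip_log_def field_simps)
    moreover have "(\<Sum>(\<alpha>', z')\<leftarrow>L. \<alpha> * \<alpha>' * (z - z') / 2) = \<alpha> * z * total_charge L / 2 - \<alpha> * charge_moment L / 2"
      unfolding total_charge_def charge_moment_def by (induction L) (auto simp: algebra_simps add_divide_distrib diff_divide_distrib)
    ultimately show ?thesis unfolding sum_list_case_prod_add by simp
  qed
  moreover have "ordering_exponent L + trace_exponent L =
    strip_log_sum L + charge_square L * euler_log q q + total_charge L * charge_moment L / 2" by (rule Cons.IH)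
  moreover have "total_charge (p # L) = \<alpha> + total_charge L" "charge_moment (p # L) = \<alpha> * z + charge_moment L"
    "charge_square (p # L) = \<alpha>\<^sup>2 + charge_square L"
    by (simp_all add: total_charge_def charge_moment_def charge_square_def p)
  moreover have "(z * \<alpha>\<^sup>2 / 2 + z * \<alpha> * t + a + r) + (\<alpha>\<^sup>2 * e + b + d) = (s + l) + (\<alpha>\<^sup>2 + c) * e + (\<alpha> + t) * (\<alpha> * z + m) / 2"
    if "a + b = s - \<alpha> * z * t / 2 + \<alpha> * m / 2" "r + d = l + c * e + t * m / 2" for t a r e b d s l c m
  proof -
    have "(z * \<alpha>\<^sup>2 / 2 + z * \<alpha> * t + a + r) + (\<alpha>\<^sup>2 * e + b + d) =
        z * \<alpha>\<^sup>2 / 2 + z * \<alpha> * t + (a + b) + (r + d) + \<alpha>\<^sup>2 * e" by simp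
    also have "\<dots> = (s + l) + (\<alpha>\<^sup>2 + c) * e + (\<alpha> + t) * (\<alpha> * z + m) / 2"
      unfolding that by (simp add: field_simps power2_eq_square)
    finally show ?thesis .
  qed
  ultimately show ?case
    unfolding p ordering_exponent.simps trace_exponent_Cons strip_log_sum.simps by (simp only:)
qed

lemma theta_lattice_has_sum:
  "((\<lambda>\<beta>. exp (2 * of_real pi * \<i> * of_real \<beta>\<^sub>1 * \<beta>) * exp (\<beta> * z + c) * exp (2 * of_real pi * \<i> * \<tau> * (\<beta>\<^sup>2 / 2 - 1 / 24)))
    has_sum exp c * vacuum_factor * theta \<alpha>\<^sub>1 \<beta>\<^sub>1 z \<tau>) {\<beta>. \<beta> - of_real \<alpha>\<^sub>1 \<in> \<int>}"
    (is "(?f has_sum _) _")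
proof -
  have bij: "bij_betw (\<lambda>n. of_int n + of_real \<alpha>\<^sub>1 :: complex) UNIV {\<beta>. \<beta> - of_real \<alpha>\<^sub>1 \<in> \<int>}"
    by (rule bij_betwI'[OF _ _ ]) (auto elim!: Ints_cases simp: algebra_simps)
  have "((\<lambda>n. exp c * vacuum_factor * exp (\<i> * of_real pi * (of_int n + of_real \<alpha>\<^sub>1)\<^sup>2 * \<tau> +
      (of_int n + of_real \<alpha>\<^sub>1) * (z + 2 * of_real pi * \<i> * of_real \<beta>\<^sub>1)))
    has_sum exp c * vacuum_factor * theta \<alpha>\<^sub>1 \<beta>\<^sub>1 z \<tau>) (UNIV :: int set)"
    by (intro has_sum_cmult_right theta_has_sum)
  moreover have "exp c * vacuum_factor * exp (\<i> * of_real pi * \<beta>\<^sup>2 * \<tau> +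
      \<beta> * (z + 2 * of_real pi * \<i> * of_real \<beta>\<^sub>1)) = ?f \<beta>" for \<beta>
    unfolding vacuum_factor_def exp_add[symmetric] by (rule arg_cong[where f = exp]) (simp add: field_simps)
  ultimately have "((\<lambda>n :: int. ?f (of_int n + of_real \<alpha>\<^sub>1)) has_sum
      exp c * vacuum_factor * theta \<alpha>\<^sub>1 \<beta>\<^sub>1 z \<tau>) UNIV"
    by simp
  then show ?thesis unfolding has_sum_reindex_bij_betw[OF bij, of ?f] .
qed

proposition insertion_trace:
  assumes ord: "radially_ordered L"
    and range: "\<And>\<alpha> z \<alpha>' z'. (\<alpha>, z) \<in> set L \<Longrightarrow> (\<alpha>', z') \<in> set L \<Longrightarrow> Re z - Re z' < 2 * pi * Im \<tau>"
    and neutral: "total_charge L = 0"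
  shows "(path_prod (map vertex_kernel (twist_vertex \<beta>\<^sub>1 # map exp_vertex L) @
      [weight_kernel]) has_sum
     vacuum_factor * partition_fn q * theta \<alpha>\<^sub>1 \<beta>\<^sub>1 (charge_moment L) \<tau> *
     exp (strip_log_sum L + charge_square L * euler_log q q))
     (closed_paths (lattice_basis \<alpha>\<^sub>1) (Suc (Suc (length L))))"
proof -
  let ?vs = "twist_vertex \<beta>\<^sub>1 # map exp_vertex L"
  have "(path_prod (map vertex_kernel ?vs @ [weight_kernel]) has_sum
    (exp (ordering_exponent L) * vacuum_factor * theta \<alpha>\<^sub>1 \<beta>\<^sub>1 (charge_moment L) \<tau>) *
      (exp (\<Sum>k. cre (vcomp ?vs) k * ann (vcomp ?vs) k * q ^ Suc k / (1 - q ^ Suc k)) * partition_fn q))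
      (closed_paths ({\<beta>. \<beta> - of_real \<alpha>\<^sub>1 \<in> \<int>} \<times> UNIV) (Suc (length ?vs)))"
    unfolding weight_kernel_def
  proof (rule closed_vertex_path_has_sum)
    have "sorted_wrt contractive (map exp_vertex L)"
      using ord unfolding radially_ordered_def sorted_wrt_map
      by (rule sorted_wrt_mono_rel[rotated]) (auto intro: contractive_exp_vertex)
    moreover have "contractive (twist_vertex \<beta>\<^sub>1) v" for v
      by (simp add: contractive_def twist_vertex_def)
    ultimately show "sorted_wrt contractive ?vs" by simp
    show "(\<Sum>v\<leftarrow>?vs. charge v) = 0"
      using charge_exp_vertices[of L] neutral by (simp add: charge_vcomp twist_vertex_def)
    show "norm q < 1" by (rule q_norm)
    show "summable (\<lambda>k. norm (cre v k) * norm (ann v' k) * norm q ^ Suc k)"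
      if vv: "v \<in> set ?vs" "v' \<in> set ?vs" for v v'
    proof (cases "v = twist_vertex \<beta>\<^sub>1 \<or> v' = twist_vertex \<beta>\<^sub>1")
      case True
      then show ?thesis by (auto simp: twist_vertex_def)
    next
      case False
      then obtain \<alpha> z \<alpha>' z' where p: "(\<alpha>, z) \<in> set L" "(\<alpha>', z') \<in> set L"
          "v = exp_vertex (\<alpha>, z)" "v' = exp_vertex (\<alpha>', z')" using vv by auto
      let ?r = "exp (Re z - Re z' - 2 * pi * Im \<tau>)"
      have "norm (cre v k) * norm (ann v' k) * norm q ^ Suc k = norm \<alpha>' * norm \<alpha> * (?r ^ Suc k / real (Suc k))" for k
      proof -
        have "norm (cre v k) * norm (ann v' k) * norm q ^ Suc k =
          norm \<alpha>' * norm \<alpha> * (exp (- (Re z' - Re z)) ^ Suc k / real (Suc k)) * exp (- (2 * pi * Im \<tau>)) ^ Suc k"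
          using norm_annih_create[of \<alpha>' z' k \<alpha> z] by (simp add: p norm_q mult_ac del: power_Suc of_nat_Suc)
        also have "\<dots> = norm \<alpha>' * norm \<alpha> * ((exp (- (Re z' - Re z)) * exp (- (2 * pi * Im \<tau>))) ^ Suc k / real (Suc k))"
          by (simp add: power_mult_distrib del: power_Suc of_nat_Suc)
        also have "exp (- (Re z' - Re z)) * exp (- (2 * pi * Im \<tau>)) = ?r"
          unfolding exp_add[symmetric] by simp
        finally show ?thesis .
      qed
      moreover have "summable (\<lambda>k. norm \<alpha>' * norm \<alpha> * (?r ^ Suc k / real (Suc k)))"
        using range[OF p(1,2)] by (intro summable_mult summable_power_over_Suc) auto
      ultimately show ?thesis by presburger
    qed
    have z: "zmode (vcomp ?vs) \<beta> = exp (2 * of_real pi * \<i> * of_real \<beta>\<^sub>1 * \<beta>) * exp (\<beta> * charge_moment L + ordering_exponent L)" for \<beta>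
      by (simp add: vcomp2_def charge_exp_vertices neutral zmode_exp_vertices[OF ord] twist_vertex_def)
    show "((\<lambda>\<beta>. zmode (vcomp ?vs) \<beta> * exp (2 * of_real pi * \<i> * \<tau> * (\<beta>\<^sup>2 / 2 - 1 / 24))) has_sum
      exp (ordering_exponent L) * vacuum_factor * theta \<alpha>\<^sub>1 \<beta>\<^sub>1 (charge_moment L) \<tau>) {\<beta>. \<beta> - of_real \<alpha>\<^sub>1 \<in> \<int>}"
      unfolding z by (rule theta_lattice_has_sum)
  qed
  moreover have tr: "(\<Sum>k. cre (vcomp ?vs) k * ann (vcomp ?vs) k * q ^ Suc k / (1 - q ^ Suc k)) = trace_exponent L"
    using trace_exponent_eq[OF range] by (simp add: vcomp2_def twist_vertex_def)
  moreover have "exp (ordering_exponent L) * c * t * (exp (trace_exponent L) * p) =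
      c * p * t * exp (strip_log_sum L + charge_square L * euler_log q q)" for c t p
  proof -
    have "exp (ordering_exponent L) * exp (trace_exponent L) = exp (strip_log_sum L + charge_square L * euler_log q q)"
      unfolding exp_add[symmetric] exponent_sum by (simp add: neutral)
    then show ?thesis by (simp add: mult_ac)
  qed
  moreover have "{\<beta>. \<beta> - of_real \<alpha>\<^sub>1 \<in> \<int>} \<times> UNIV = lattice_basis \<alpha>\<^sub>1" by (auto simp: lattice_basis_def)
  ultimately show ?thesis by (simp only: list.size length_map add_Suc_right add_0_right)
qed

end

section \<open>The alternating fermion insertions\<close>

definition psi_charges :: "nat \<Rightarrow> (nat \<Rightarrow> complex) \<Rightarrow> (nat \<Rightarrow> complex) \<Rightarrow> (complex \<times> complex) list" where
  "psi_charges n x y = concat (map (\<lambda>i. [(1, x i), (- 1, y i)]) [0..<n])"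

lemma psi_charges_0 [simp]: "psi_charges 0 x y = []"
  by (simp add: psi_charges_def)

lemma psi_charges_Suc:
  "psi_charges (Suc n) x y = (1, x 0) # (- 1, y 0) # psi_charges n (\<lambda>i. x (Suc i)) (\<lambda>i. y (Suc i))"
  by (simp add: psi_charges_def upt_conv_Cons map_Suc_upt[symmetric] comp_def del: upt_Suc)

lemma psi_insertions_eq: "psi_insertions n x y = map (\<lambda>(\<alpha>, z). (evec \<alpha>, z)) (psi_charges n x y)"
  by (simp add: psi_insertions_def psi_charges_def map_concat comp_def psi_plus_def psi_minus_def)

lemma set_psi_charges: "(\<alpha>, z) \<in> set (psi_charges n x y) \<Longrightarrow> \<exists>i<n. z = x i \<or> z = y i"
  by (auto simp: psi_charges_def)

lemma path_term_eq_path_prod: "path_term As = path_prod (map (\<lambda>A b b'. A (ket b') b) As)"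
  by (rule ext) (simp add: path_term_def path_prod_def)

lemma exp_L0_0: "exp_L0 0 v = v"
proof
  fix b show "exp_L0 0 v b = v b" by (cases b) (simp add: exp_L0_apply)
qed

context upper_half_plane
begin

lemma Z1_ops_kernels:
  assumes "sigma \<circ> f = exp_a0 (2 * of_real pi * \<i> * of_real \<beta>\<^sub>1)"
  shows "map (\<lambda>A b b'. A (ket b') b)
      (Z1_ops f \<tau> (map (\<lambda>(\<alpha>, z). (evec \<alpha>, z)) L) (evec \<alpha>) w (evec \<alpha>')) =
    map vertex_kernel (twist_vertex \<beta>\<^sub>1 # map exp_vertex (L @ [(\<alpha>, w), (\<alpha>', 0)])) @
    [weight_kernel]"
proof -
  \<comment> \<open>\<open>Z1_ops\<close> inserts the last vector without a power of L(0); at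
    logarithm 0 that power is the identity, so all insertions take the same form.\<close>
  have v0: "vop (evec \<alpha>') 0 = vop (exp_L0 0 (evec \<alpha>')) 0" by (simp only: exp_L0_0)
  show ?thesis
    unfolding Z1_ops_def assms v0
    by (simp add: comp_def split_def vop_eq_vertex_kernel exp_a0_eq_vertex_kernel qtau_eq_weight_kernel del: exp_vertex.simps)
qed

lemma Z1_eval:
  fixes L
  assumes L': "L' = L @ [(of_real \<kappa>, w), (- of_real \<kappa>, 0)]"
    and f: "sigma \<circ> f = exp_a0 (2 * of_real pi * \<i> * of_real \<beta>\<^sub>1)"
    and g: "sigma \<circ> g = exp_a0 (- 2 * of_real pi * \<i> * of_real \<alpha>\<^sub>1)"
    and ord: "radially_ordered L'"
    and range: "\<And>z. z \<in> snd ` set L' \<Longrightarrow> 0 \<le> Re z \<and> Re z < 2 * pi * Im \<tau>"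
    and neutral: "total_charge L = 0"
  shows "Z1_converges f g \<tau> (map (\<lambda>(\<alpha>, z). (evec \<alpha>, z)) L) (evec (of_real \<kappa>)) w (evec (- of_real \<kappa>)) \<and>
    Z1 f g \<tau> (map (\<lambda>(\<alpha>, z). (evec \<alpha>, z)) L) (evec (of_real \<kappa>)) w (evec (- of_real \<kappa>)) =
      vacuum_factor * partition_fn q * theta \<alpha>\<^sub>1 \<beta>\<^sub>1 (charge_moment L') \<tau> *
      exp (strip_log_sum L' + charge_square L' * euler_log q q)"
proof -
  let ?As = "Z1_ops f \<tau> (map (\<lambda>(\<alpha>, z). (evec \<alpha>, z)) L) (evec (of_real \<kappa>)) w (evec (- of_real \<kappa>))"
  have "length ?As = Suc (Suc (length L'))" by (simp add: Z1_ops_def L')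
  moreover have "(path_term ?As has_sum vacuum_factor * partition_fn q *
      theta \<alpha>\<^sub>1 \<beta>\<^sub>1 (charge_moment L') \<tau> *
      exp (strip_log_sum L' + charge_square L' * euler_log q q))
      (closed_paths (lattice_basis \<alpha>\<^sub>1) (Suc (Suc (length L'))))"
    unfolding path_term_eq_path_prod Z1_ops_kernels[OF f] L'[symmetric]
  proof (rule insertion_trace[OF ord])
    show "total_charge L' = 0" using neutral by (simp add: L' total_charge_def)
    show "Re z - Re z' < 2 * pi * Im \<tau>" if "(\<alpha>, z) \<in> set L'" "(\<alpha>', z') \<in> set L'" for \<alpha> z \<alpha>' z'
      using range[of z] range[of z'] that by (force simp: image_iff)
  qed
  ultimately show ?thesis
    unfolding Z1_converges_def Z1_def trace_converges_def trace_prod_def twisted_basis_eq[OF g]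
    by (simp_all add: has_sum_imp_summable infsumI)
qed

end

lemma insertion_decreasing:
  assumes "ordered_insertions \<tau> n x y w" "i < j" "j < n"
  shows "Re (x j) < Re (y i)"
  using assms(2,3)
proof (induction j)
  case (Suc j)
  have step: "Re (x (Suc j)) < Re (y j)" using assms(1) Suc.prems by (simp add: ordered_insertions_def)
  show ?case
  proof (cases "i = j")
    case False
    then have "Re (x j) < Re (y i)" using Suc by simp
    moreover have "Re (y j) < Re (x j)" using assms(1) Suc.prems by (simp add: ordered_insertions_def)
    ultimately show ?thesis using step by linarith
  qed (use step in simp)
qed simp

lemma insertion_bounds:
  assumes "ordered_insertions \<tau> n x y w" "i < n"
  shows "0 < Re w" "Re w < Re (y i)" "Re (y i) < Re (x i)" "Re (x i) < 2 * pi * Im \<tau>"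
proof -
  show "0 < Re w" "Re w < Re (y i)" "Re (y i) < Re (x i)"
    using assms by (simp_all add: ordered_insertions_def)
  show "Re (x i) < 2 * pi * Im \<tau>"
  proof (cases "i = 0")
    case False
    then have "Re (x i) < Re (y 0)" using insertion_decreasing[OF assms(1), of 0 i] assms(2) by simp
    then show ?thesis using assms by (auto simp: ordered_insertions_def)
  qed (use assms in \<open>simp add: ordered_insertions_def\<close>)
qed

lemma ordered_insertions_Suc:
  assumes "ordered_insertions \<tau> (Suc n) x y w" "n > 0"
  shows "ordered_insertions \<tau> n (\<lambda>i. x (Suc i)) (\<lambda>i. y (Suc i)) w"
  using assms insertion_bounds(4)[OF assms(1), of 1] by (simp add: ordered_insertions_def)

text \<open>The ordering is assumed for n > 0 only: at n = 0 it would still bound x 0, about which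
  nothing is known once the induction has removed all pairs.\<close>

lemma radially_ordered_psi_charges:
  assumes "n > 0 \<Longrightarrow> ordered_insertions \<tau> n x y w" "0 < Re w"
  shows "radially_ordered (psi_charges n x y @ [(\<alpha>, w), (\<alpha>', 0)])"
  using assms(1)
proof (induction n arbitrary: x y)
  case 0
  show ?case using assms(2) by (simp add: radially_ordered_def)
next
  case (Suc n)
  have o: "ordered_insertions \<tau> (Suc n) x y w" using Suc.prems by simp
  have b: "Re w < Re (y 0)" "Re (y 0) < Re (x 0)" using insertion_bounds[OF o, of 0] by auto
  have tail: "Re z < Re (y 0)" if mem: "(a, z) \<in> set (psi_charges n (\<lambda>i. x (Suc i)) (\<lambda>i. y (Suc i)))" for a z
  proof -
    obtain i where i: "i < n" "z = x (Suc i) \<or> z = y (Suc i)" using set_psi_charges[OF mem] by auto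
    have "Re (x (Suc i)) < Re (y 0)" using i insertion_decreasing[OF o, of 0 "Suc i"] by simp
    moreover have "Re (y (Suc i)) < Re (x (Suc i))" using i insertion_bounds[OF o, of "Suc i"] by simp
    ultimately show ?thesis using i by auto
  qed
  have "radially_ordered (psi_charges n (\<lambda>i. x (Suc i)) (\<lambda>i. y (Suc i)) @ [(\<alpha>, w), (\<alpha>', 0)])"
    using ordered_insertions_Suc[OF o] by (intro Suc.IH)
  then show ?case
    using b tail assms(2) unfolding psi_charges_Suc radially_ordered_def by (fastforce dest: tail)
qed

section \<open>Comparison with the kernel determinant\<close>

context upper_half_plane
begin

lemma exp_strip_log_diff:
  assumes "z \<in> theta1_strip \<tau>" "z' \<in> theta1_strip \<tau>"
  shows "exp (strip_log z - strip_log z') = th z / th z'"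
  unfolding exp_strip_log[OF assms(1), symmetric] exp_strip_log[OF assms(2), symmetric]
  using theta_const_nonzero by (simp add: exp_diff)

text \<open>The interaction of charge 1 at z with \<kappa> at w and -\<kappa> at 0, namely the
  \<kappa>-th power of theta_1(z - w) / theta_1(z) in the branch of \<open>strip_log\<close>. Charge
  -1 gives the inverse.\<close>

definition dressing :: "real \<Rightarrow> complex \<Rightarrow> complex \<Rightarrow> complex" where
  "dressing \<kappa> w z = exp (of_real \<kappa> * (strip_log (z - w) - strip_log z))"

text \<open>Equal charges put theta_1 into the numerator and opposite charges into the denominator,
  each time with \<open>theta_const\<close> to the opposite power. The n^2 opposite and n(n-1) equal
  pairs leave \<open>theta_const ^ n\<close>.\<close>

lemma exp_strip_log_sum_psi:
  assumes "n > 0 \<Longrightarrow> ordered_insertions \<tau> n x y w"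
  shows "exp (strip_log_sum (psi_charges n x y @ [(of_real \<kappa>, w), (- of_real \<kappa>, 0)])) =
    exp (strip_log_sum [(of_real \<kappa>, w), (- of_real \<kappa>, 0)]) *
    ((\<Prod>i<n. dressing \<kappa> w (x i)) * (\<Prod>j<n. inverse (dressing \<kappa> w (y j))) * theta_const ^ n * frobenius_factor n x y)"
  using assms
proof (induction n arbitrary: x y)
  case 0
  show ?case by simp
next
  case (Suc n)
  let ?x = "\<lambda>i. x (Suc i)" and ?y = "\<lambda>i. y (Suc i)"
  let ?L = "[(of_real \<kappa> :: complex, w), (- of_real \<kappa>, 0)]"
  let ?T = "psi_charges n ?x ?y @ ?L"
  have o: "ordered_insertions \<tau> (Suc n) x y w" using Suc.prems by simp
  have IH: "exp (strip_log_sum ?T) = exp (strip_log_sum ?L) *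
    ((\<Prod>i<n. dressing \<kappa> w (?x i)) * (\<Prod>j<n. inverse (dressing \<kappa> w (?y j))) * theta_const ^ n * frobenius_factor n ?x ?y)"
    by (rule Suc.IH) (rule ordered_insertions_Suc[OF o])
  have sum_psi: "(\<Sum>(\<alpha>', z')\<leftarrow>psi_charges n ?x ?y. \<alpha> * \<alpha>' * strip_log (z - z')) =
     (\<Sum>i<n. \<alpha> * (strip_log (z - ?x i) - strip_log (z - ?y i)))" for \<alpha> z
  proof -
    have "(\<Sum>(\<alpha>', z')\<leftarrow>psi_charges n u v. \<alpha> * \<alpha>' * strip_log (z - z')) =
      (\<Sum>i<n. \<alpha> * (strip_log (z - u i) - strip_log (z - v i)))" for u v
      by (induction n arbitrary: u v) (simp_all add: psi_charges_Suc sum.lessThan_Suc_shift algebra_simps del: sum.lessThan_Suc)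
    then show ?thesis .
  qed
  have sx: "x 0 - ?x i \<in> theta1_strip \<tau>" "x 0 - ?y i \<in> theta1_strip \<tau>"
    "y 0 - ?x i \<in> theta1_strip \<tau>" "y 0 - ?y i \<in> theta1_strip \<tau>" if "i < n" for i
  proof -
    have "Re (x (Suc i)) < Re (y 0)" using that insertion_decreasing[OF o, of 0 "Suc i"] by simp
    then show "x 0 - ?x i \<in> theta1_strip \<tau>" "x 0 - ?y i \<in> theta1_strip \<tau>"
    "y 0 - ?x i \<in> theta1_strip \<tau>" "y 0 - ?y i \<in> theta1_strip \<tau>"
      using insertion_bounds[OF o, of 0] insertion_bounds[OF o, of "Suc i"] that
      by (auto simp: theta1_strip_def)
  qed
  have s0: "x 0 - y 0 \<in> theta1_strip \<tau>"
    using insertion_bounds[OF o, of 0] by (auto simp: theta1_strip_def)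
  have "strip_log_sum (psi_charges (Suc n) x y @ ?L) = - strip_log (x 0 - y 0) +
     (\<Sum>i<n. strip_log (x 0 - ?x i) - strip_log (x 0 - ?y i)) + (\<Sum>i<n. strip_log (y 0 - ?y i) - strip_log (y 0 - ?x i)) +
     of_real \<kappa> * (strip_log (x 0 - w) - strip_log (x 0)) - of_real \<kappa> * (strip_log (y 0 - w) - strip_log (y 0)) + strip_log_sum ?T"
    unfolding psi_charges_Suc append_Cons strip_log_sum.simps
    by (simp only: list.map map_append sum_list.append sum_list.Cons sum_list.Nil prod.case sum_psi)
      (simp add: algebra_simps sum_subtractf sum_negf)
  then have "exp (strip_log_sum (psi_charges (Suc n) x y @ ?L)) = exp (- strip_log (x 0 - y 0)) *
     (\<Prod>i<n. exp (strip_log (x 0 - ?x i) - strip_log (x 0 - ?y i))) * (\<Prod>i<n. exp (strip_log (y 0 - ?y i) - strip_log (y 0 - ?x i))) *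
     dressing \<kappa> w (x 0) * inverse (dressing \<kappa> w (y 0)) * exp (strip_log_sum ?T)"
    by (simp only: dressing_def exp_sum finite_lessThan exp_add diff_conv_add_uminus[of _ "of_real \<kappa> * _"] exp_minus[of "of_real \<kappa> * _"])
  also have "exp (- strip_log (x 0 - y 0)) = theta_const / th (x 0 - y 0)"
    unfolding exp_strip_log[OF s0, symmetric] using theta_const_nonzero by (simp add: exp_minus field_simps)
  also have "(\<Prod>i<n. exp (strip_log (x 0 - ?x i) - strip_log (x 0 - ?y i))) = (\<Prod>i<n. th (x 0 - ?x i) / th (x 0 - ?y i))"
    by (intro prod.cong refl exp_strip_log_diff sx) auto
  \<comment> \<open>Here the strip contains the negatives of the arguments in
    \<open>frobenius_factor\<close>; the two signs from oddness cancel in each quotient.\<close>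
  also have "(\<Prod>i<n. exp (strip_log (y 0 - ?y i) - strip_log (y 0 - ?x i))) = (\<Prod>i<n. th (?y i - y 0) / th (?x i - y 0))"
  proof (intro prod.cong refl)
    fix i assume "i \<in> {..<n}"
    then have "exp (strip_log (y 0 - ?y i) - strip_log (y 0 - ?x i)) = th (y 0 - ?y i) / th (y 0 - ?x i)"
      by (intro exp_strip_log_diff sx) auto
    then show "exp (strip_log (y 0 - ?y i) - strip_log (y 0 - ?x i)) = th (?y i - y 0) / th (?x i - y 0)"
      using theta1_minus[of "?y i - y 0"] theta1_minus[of "?x i - y 0"] by simp
  qed
  finally have "exp (strip_log_sum (psi_charges (Suc n) x y @ ?L)) = theta_const / th (x 0 - y 0) *
     (\<Prod>i<n. th (x 0 - ?x i) / th (x 0 - ?y i)) * (\<Prod>i<n. th (?y i - y 0) / th (?x i - y 0)) *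
     dressing \<kappa> w (x 0) * inverse (dressing \<kappa> w (y 0)) * exp (strip_log_sum ?T)" .
  then show ?case
    unfolding IH prod.lessThan_Suc_shift frobenius_factor.simps prod_dividef by (simp add: mult_ac)
qed

text \<open>The two prefactors differ by the exponential of a linear function of z, which for z = x
  - y splits into a row and a column factor.\<close>

lemma theta_ratio:
  assumes "theta \<alpha> \<beta> u \<tau> \<noteq> 0"
  defines "t \<equiv> u + theta_offset \<alpha> \<beta>"
  shows "theta \<alpha> \<beta> (z + u) \<tau> / theta \<alpha> \<beta> u \<tau> = exp ((of_real \<alpha> - 1 / 2) * z) * (th (t + z) / th t)"
    and "th t \<noteq> 0"
proof -
  show "th t \<noteq> 0" using assms unfolding theta_eq_theta1 by simp
  have "theta_prefactor \<alpha> \<beta> (z + u) = exp ((of_real \<alpha> - 1 / 2) * z) * theta_prefactor \<alpha> \<beta> u"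
    unfolding theta_prefactor_def exp_add[symmetric] by (rule arg_cong[where f = exp]) (simp add: algebra_simps)
  then show "theta \<alpha> \<beta> (z + u) \<tau> / theta \<alpha> \<beta> u \<tau> = exp ((of_real \<alpha> - 1 / 2) * z) * (th (t + z) / th t)"
    unfolding theta_eq_theta1 by (simp add: theta_prefactor_def t_def add_ac)
qed

lemma det_S_matrix:
  assumes o: "ordered_insertions \<tau> n x y w" and nz: "theta \<alpha>\<^sub>1 \<beta>\<^sub>1 (of_real \<kappa> * w) \<tau> \<noteq> 0"
  shows "Determinant.det (S_matrix n \<alpha>\<^sub>1 \<beta>\<^sub>1 \<kappa> w \<tau> x y) =
    (theta_const * exp (2 * euler_log q q)) ^ n * ((\<Prod>i<n. dressing \<kappa> w (x i)) * (\<Prod>j<n. inverse (dressing \<kappa> w (y j)))) *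
    (theta \<alpha>\<^sub>1 \<beta>\<^sub>1 ((\<Sum>i<n. x i - y i) + of_real \<kappa> * w) \<tau> / theta \<alpha>\<^sub>1 \<beta>\<^sub>1 (of_real \<kappa> * w) \<tau>) * frobenius_factor n x y"
proof -
  define d where "d = (of_real \<alpha>\<^sub>1 - 1 / 2 :: complex)"
  define t where "t = of_real \<kappa> * w + theta_offset \<alpha>\<^sub>1 \<beta>\<^sub>1"
  define k where "k = theta_const * exp (2 * euler_log q q)"
  have t: "th t \<noteq> 0" using theta_ratio(2)[OF nz] by (simp add: t_def)
  have ratio: "theta \<alpha>\<^sub>1 \<beta>\<^sub>1 (z + of_real \<kappa> * w) \<tau> / theta \<alpha>\<^sub>1 \<beta>\<^sub>1 (of_real \<kappa> * w) \<tau> = exp (d * z) * (th (t + z) / th t)" for z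
    using theta_ratio(1)[OF nz] by (simp add: t_def d_def)
  \<comment> \<open>The constant of the prime form, rewritten as \<open>theta_const\<close> times
    the self contractions of one fermion pair.\<close>
  have k: "deriv (\<lambda>z. th z) 0 = k"
    unfolding deriv_theta1_0 k_def using euler_fn_eq_exp[OF q_norm] by (simp add: power2_eq_square flip: exp_add)
  have strip: "x i - w \<in> theta1_strip \<tau>" "x i \<in> theta1_strip \<tau>" "y i - w \<in> theta1_strip \<tau>" "y i \<in> theta1_strip \<tau>" if "i < n" for i
    using insertion_bounds[OF o that] by (auto simp: theta1_strip_def)
  \<comment> \<open>By the ordering, x_i - y_j lies in the strip for i \<le> j, and its negative
    does for i > j.\<close>
  have th_nz: "th (x i - y j) \<noteq> 0" if "i < n" "j < n" for i j
  proof (cases "i \<le> j")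
    case True
    have "Re (x j) \<le> Re (x i)"
      using True insertion_decreasing[OF o, of i j] insertion_bounds[OF o that(1)] that by (cases "i = j") auto
    then have "x i - y j \<in> theta1_strip \<tau>"
      using insertion_bounds[OF o that(1)] insertion_bounds[OF o that(2)] by (auto simp: theta1_strip_def)
    then show ?thesis by (rule theta1_nonzero)
  next
    case False
    then have "Re (x i) < Re (y j)" using insertion_decreasing[OF o, of j i] that by simp
    then have "- (x i - y j) \<in> theta1_strip \<tau>"
      using insertion_bounds[OF o that(1)] insertion_bounds[OF o that(2)] by (auto simp: theta1_strip_def)
    then have "th (- (x i - y j)) \<noteq> 0" by (rule theta1_nonzero)
    then show ?thesis unfolding theta1_minus by simp
  qed
  obtain c where c: "\<And>z. z \<in> theta1_strip \<tau> \<Longrightarrow> log_theta1 \<tau> z = strip_log z + c" using log_theta1_eq by blast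
  have entry: "S_kernel \<alpha>\<^sub>1 \<beta>\<^sub>1 \<kappa> w \<tau> (x i) (y j) = (k / th t * dressing \<kappa> w (x i) * exp (d * x i)) *
      (inverse (dressing \<kappa> w (y j)) * exp (- (d * y j))) * (th (t + x i - y j) / th (x i - y j))"
    if "i < n" "j < n" for i j
  proof -
    have "exp (of_real \<kappa> * (log_theta1 \<tau> (x i - w) + log_theta1 \<tau> (y j) - log_theta1 \<tau> (x i) - log_theta1 \<tau> (y j - w)))
       = dressing \<kappa> w (x i) * inverse (dressing \<kappa> w (y j))"
      unfolding c[OF strip(1)[OF that(1)]] c[OF strip(2)[OF that(1)]] c[OF strip(3)[OF that(2)]] c[OF strip(4)[OF that(2)]]
        dressing_def exp_minus[symmetric] exp_add[symmetric]
      by (rule arg_cong[where f = exp]) (simp add: algebra_simps)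
    moreover have "theta \<alpha>\<^sub>1 \<beta>\<^sub>1 (x i - y j + of_real \<kappa> * w) \<tau> / (theta \<alpha>\<^sub>1 \<beta>\<^sub>1 (of_real \<kappa> * w) \<tau> * prime_form (x i - y j) \<tau>)
      = exp (d * (x i - y j)) * (th (t + (x i - y j)) / th t) * (k / th (x i - y j))"
      unfolding ratio[symmetric] prime_form_def k by simp
    moreover have "exp (d * (x i - y j)) = exp (d * x i) * exp (- (d * y j))"
      unfolding exp_add[symmetric] by (simp add: algebra_simps)
    ultimately show ?thesis unfolding S_kernel_def by (simp add: add_diff_eq)
  qed
  let ?D = "Determinant.det (Matrix.mat n n (\<lambda>(i, j). th (t + x i - y j) / th (x i - y j)))"
  have "S_matrix n \<alpha>\<^sub>1 \<beta>\<^sub>1 \<kappa> w \<tau> x y = Matrix.mat n n (\<lambda>(i, j). (k / th t * dressing \<kappa> w (x i) * exp (d * x i)) *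
      (inverse (dressing \<kappa> w (y j)) * exp (- (d * y j))) * (\<lambda>(i, j). th (t + x i - y j) / th (x i - y j)) (i, j))"
    unfolding S_matrix_def by (rule cong_mat) (simp_all only: prod.case entry)
  then have "Determinant.det (S_matrix n \<alpha>\<^sub>1 \<beta>\<^sub>1 \<kappa> w \<tau> x y) =
      (\<Prod>i<n. k / th t * dressing \<kappa> w (x i) * exp (d * x i)) * (\<Prod>j<n. inverse (dressing \<kappa> w (y j)) * exp (- (d * y j))) * ?D"
    by (simp only: det_mat_scale[where r = "\<lambda>i. k / th t * dressing \<kappa> w (x i) * exp (d * x i)"
          and s = "\<lambda>j. inverse (dressing \<kappa> w (y j)) * exp (- (d * y j))" and f = "\<lambda>(i, j). th (t + x i - y j) / th (x i - y j)"])
  also have "\<dots> = k ^ n * ((\<Prod>i<n. dressing \<kappa> w (x i)) * (\<Prod>j<n. inverse (dressing \<kappa> w (y j)))) *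
      ((\<Prod>i<n. exp (d * x i)) * (\<Prod>j<n. exp (- (d * y j)))) * (?D / th t ^ n)"
    by (simp add: prod.distrib prod_dividef)
  also have "(\<Prod>i<n. exp (d * x i)) * (\<Prod>j<n. exp (- (d * y j))) = exp (d * (\<Sum>i<n. x i - y i))"
    unfolding exp_sum[OF finite_lessThan, symmetric] exp_add[symmetric]
    by (simp add: sum_distrib_left sum_subtractf sum_negf algebra_simps)
  also have "?D / th t ^ n = th (t + (\<Sum>i<n. x i - y i)) / th t * frobenius_factor n x y"
  proof -
    have "?D * th t = th t ^ n * th (t + (\<Sum>i<n. x i - y i)) * frobenius_factor n x y"
      by (rule frobenius_det[OF th_nz])
    then show ?thesis using t by (simp add: field_simps)
  qed
  finally show ?thesis unfolding ratio k_def[symmetric] by simp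
qed

end

theorem proposition4p4:
  fixes \<alpha>\<^sub>1 \<beta>\<^sub>1 \<kappa> :: real and \<tau> w :: complex
    and f\<^sub>1 g\<^sub>1 :: "state \<Rightarrow> state"
    and n :: nat and x y :: "nat \<Rightarrow> complex"
  assumes "Im \<tau> > 0"
    and "\<kappa> \<in> {-1/2<..<1/2}"
    and "sigma \<circ> f\<^sub>1 = exp_a0 (2 * of_real pi * \<i> * of_real \<beta>\<^sub>1)"
    and "sigma \<circ> g\<^sub>1 = exp_a0 (- 2 * of_real pi * \<i> * of_real \<alpha>\<^sub>1)"
    and "n \<ge> 1"
    and "ordered_insertions \<tau> n x y w"
    and "theta \<alpha>\<^sub>1 \<beta>\<^sub>1 (of_real \<kappa> * w) \<tau> \<noteq> 0"
  shows "Z1_converges f\<^sub>1 g\<^sub>1 \<tau> (psi_insertions n x y) (evec (of_real \<kappa>)) w (evec (- of_real \<kappa>)) \<and>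
    Z1_converges f\<^sub>1 g\<^sub>1 \<tau> [] (evec (of_real \<kappa>)) w (evec (- of_real \<kappa>)) \<and>
    gen_form f\<^sub>1 g\<^sub>1 \<tau> \<kappa> w n x y =
      Z1 f\<^sub>1 g\<^sub>1 \<tau> [] (evec (of_real \<kappa>)) w (evec (- of_real \<kappa>))
      * Determinant.det (S_matrix n \<alpha>\<^sub>1 \<beta>\<^sub>1 \<kappa> w \<tau> x y)"
proof -
  interpret upper_half_plane \<tau> by unfold_locales (rule assms(1))
  let ?L = "[(of_real \<kappa> :: complex, w), (- of_real \<kappa>, 0)]"
  note o = assms(6) and nz = assms(7)
  have w: "0 < Re w" "Re w < 2 * pi * Im \<tau>" and T: "0 < 2 * pi * Im \<tau>"
    using insertion_bounds[OF o, of 0] assms(1,5) by auto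
  have range: "0 \<le> Re z \<and> Re z < 2 * pi * Im \<tau>" if "z \<in> snd ` set (psi_charges m x y @ ?L)" "m \<le> n" for z m
  proof (cases "z \<in> snd ` set (psi_charges m x y)")
    case True
    then obtain i where "i < m" "z = x i \<or> z = y i" using set_psi_charges by force
    then show ?thesis using insertion_bounds[OF o, of i] that(2) by auto
  qed (use that w T in auto)
  have neutral: "total_charge (psi_charges m u v) = 0" for m u v
    by (induction m arbitrary: u v) (simp_all add: psi_charges_Suc total_charge_def)
  have square: "charge_square (psi_charges m u v @ ?L) = 2 * of_nat m + charge_square ?L" for m u v
    by (induction m arbitrary: u v) (simp_all add: psi_charges_Suc charge_square_def)
  have moment: "charge_moment (psi_charges m u v @ ?L) = (\<Sum>i<m. u i - v i) + of_real \<kappa> * w" for m u v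
    by (induction m arbitrary: u v)
      (simp_all add: psi_charges_Suc charge_moment_def sum.lessThan_Suc_shift del: sum.lessThan_Suc)
  let ?K = "vacuum_factor * partition_fn q"
  \<comment> \<open>One evaluation serves m = n, the generating form, and m = 0, the factor in front
    of the determinant.\<close>
  have Z: "Z1_converges f\<^sub>1 g\<^sub>1 \<tau> (psi_insertions m x y) (evec (of_real \<kappa>)) w (evec (- of_real \<kappa>)) \<and>
      Z1 f\<^sub>1 g\<^sub>1 \<tau> (psi_insertions m x y) (evec (of_real \<kappa>)) w (evec (- of_real \<kappa>)) =
      ?K * theta \<alpha>\<^sub>1 \<beta>\<^sub>1 ((\<Sum>i<m. x i - y i) + of_real \<kappa> * w) \<tau> *
      exp (strip_log_sum (psi_charges m x y @ ?L) + charge_square (psi_charges m x y @ ?L) * euler_log q q)"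
    if "m \<le> n" "m > 0 \<Longrightarrow> m = n" for m
  proof -
    have ord: "radially_ordered (psi_charges m x y @ ?L)"
      using o that(2) by (intro radially_ordered_psi_charges[OF _ w(1)]) auto
    have rng: "0 \<le> Re z \<and> Re z < 2 * pi * Im \<tau>" if "z \<in> snd ` set (psi_charges m x y @ ?L)" for z
      using range[OF that \<open>m \<le> n\<close>] .
    show ?thesis
      unfolding psi_insertions_eq moment[symmetric]
      by (intro Z1_eval[OF refl assms(3,4) ord rng neutral])
  qed
  have Zn: "Z1_converges f\<^sub>1 g\<^sub>1 \<tau> (psi_insertions n x y) (evec (of_real \<kappa>)) w (evec (- of_real \<kappa>))"
    using Z[of n] by blast
  have Z0: "Z1_converges f\<^sub>1 g\<^sub>1 \<tau> [] (evec (of_real \<kappa>)) w (evec (- of_real \<kappa>))"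
    "Z1 f\<^sub>1 g\<^sub>1 \<tau> [] (evec (of_real \<kappa>)) w (evec (- of_real \<kappa>)) = ?K *
      theta \<alpha>\<^sub>1 \<beta>\<^sub>1 (of_real \<kappa> * w) \<tau> * exp (strip_log_sum ?L + charge_square ?L * euler_log q q)"
    using Z[of 0] by (simp_all only: psi_insertions_eq psi_charges_0 list.map append_Nil lessThan_0 sum.empty add_0_left le0 less_irrefl simp_thms)
  have "Z1 f\<^sub>1 g\<^sub>1 \<tau> (psi_insertions n x y) (evec (of_real \<kappa>)) w (evec (- of_real \<kappa>)) =
      ?K * theta \<alpha>\<^sub>1 \<beta>\<^sub>1 ((\<Sum>i<n. x i - y i) + of_real \<kappa> * w) \<tau> *
      (exp (strip_log_sum (psi_charges n x y @ ?L)) * exp (charge_square (psi_charges n x y @ ?L) * euler_log q q))"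
    using Z[of n] unfolding exp_add by blast
  \<comment> \<open>Each fermion pair has squared charge 2; the resulting power, together with
    \<open>theta_const ^ n\<close>, is the n-th power of theta_1'(0) from the prime forms.\<close>
  also have "exp (charge_square (psi_charges n x y @ ?L) * euler_log q q) =
      exp (2 * euler_log q q) ^ n * exp (charge_square ?L * euler_log q q)"
    unfolding square exp_of_nat_mult[symmetric] exp_add[symmetric]
    by (rule arg_cong[where f = exp]) (simp add: algebra_simps)
  also have "exp (strip_log_sum (psi_charges n x y @ ?L)) = exp (strip_log_sum ?L) *
    ((\<Prod>i<n. dressing \<kappa> w (x i)) * (\<Prod>j<n. inverse (dressing \<kappa> w (y j))) * theta_const ^ n * frobenius_factor n x y)"
    by (rule exp_strip_log_sum_psi[OF o])
  finally have "Z1 f\<^sub>1 g\<^sub>1 \<tau> (psi_insertions n x y) (evec (of_real \<kappa>)) w (evec (- of_real \<kappa>)) =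
    Z1 f\<^sub>1 g\<^sub>1 \<tau> [] (evec (of_real \<kappa>)) w (evec (- of_real \<kappa>)) * Determinant.det (S_matrix n \<alpha>\<^sub>1 \<beta>\<^sub>1 \<kappa> w \<tau> x y)"
    \<comment> \<open>The theta value at \<kappa> w in the two-point function cancels the
      denominator of the theta ratio in the determinant.\<close>
    unfolding Z0(2) det_S_matrix[OF o nz] exp_add using nz by (simp add: power_mult_distrib field_simps)
  then show ?thesis
    using Zn Z0(1) by (simp add: gen_form_def)
qed

end
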